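(* Let $L=\bigoplus_{i\ge 1}L_i$ be a Nottingham algebra (of finite or infinite dimension) over a field $\mathbb{F}$ of characteristic $p$, with second diamond $L_q$ and standard generators $x$ and $y$. Suppose $L_{2q-1}$ is a diamond of infinite type. Suppose that the earliest diamond of finite type past $L_q$ (possibly fake) occurs in degree $a(q-1)+1$, and has type $\mu\in\mathbb{F}$. Then the following assertions hold: (a) $a$ is even; (b) if $a\not\equiv 1\pmod p$ then $L_{(a+1)(q-1)+3}=0$, unless $a\equiv 0\pmod p$, $\mu=1$, and $[L_{(a+1)(q-1)},y]=0$; (c) if $a\equiv 1\pmod p$ but $a-1$ is not a power of $p$, then $L_{(a+p^s)(q-1)+2}=0$, where $p^s$ is the highest power of $p$ which divides $a-1$; (d) if $a\equiv 0\pmod p$, $\mu=1$, $[L_{(a+1)(q-1)},y]=0$, and $a/2$ is not a power of $p$, then $L_{(a+p^s)(q-1)+3}=0$, where $p^s$ is the highest power of $p$ which divides $a$.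
   Context: Lie products are usually written without commas and are left-normed: $[abc]=[[ab]c]$, and $[ab^i]=[ab\cdots b]$ with $b$ occurring $i$ times. A thin Lie algebra is a graded Lie algebra $L=\bigoplus_{i\ge 1}L_i$ over a field $\mathbb{F}$ with $\dim L_1=2$ satisfying the covering property: for each $i$ and each nonzero $z\in L_i$ one has $[zL_1]=L_{i+1}$. All homogeneous components then have dimension at most two. Components of dimension two are called (genuine) diamonds; $L_1$ is the first diamond, and thin Lie algebras are required to have at least one further diamond; the earliest diamond past $L_1$ is the second diamond. Thin Lie algebras may have finite or infinite dimension. A Nottingham algebra is a thin Lie algebra over a field of characteristic $p>3$ with second diamond $L_q$, where $q>5$ is a power of $p$. Standard generators: in a Nottingham algebra $L$ with second diamond $L_q$ there are generators $x,y$ of $L_1$, each unique up to scalar multiples, such that $[yxy]=0$ and, setting $v_1=[yx^{q-2}]$ (which spans $L_{q-1}$), $[v_1xx]=0=[v_1yy]$ and $[v_1yx]=-2[v_1xy]$. Types: let $L_m$ be a two-dimensional component with $m>1$ and $L_{m+1}\ne 0$, and let $w$ be a nonzero element of $L_{m-1}$ (which is one-dimensional). $L_m$ is a diamond of finite type $\mu\in\mathbb{F}$ if $[wxx]=0=[wyy]$ and $\mu[wyx]=(1-\mu)[wxy]$; it is a diamond of infinite type if $[wxx]=0=[wyy]$ and $[wyx]=-[wxy]$. (The second diamond $L_q$ always has type $-1$; $L_1$ has no type; for two-dimensional $L_m$ one always has $\mu\ne 0,1$.) Fake diamonds: if $L_{m-1}$ is one-dimensional, spanned by $w$, with $m>1$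 and $L_{m+1}\neq 0$, then $L_m$ is a (fake) diamond of type $1$ if $[wxx]=0$ and $[wy]=0$, and a (fake) diamond of type $0$ if $[wx]=0$ and $[wyy]=0$; fake diamonds are one-dimensional components and count as diamonds of finite type. If $L_m$ satisfies the definition of type $1$ then $L_{m+1}$ satisfies the definition of type $0$; by convention one calls (fake) diamond precisely one of $L_m$, $L_{m+1}$, of the appropriate type, and not the other. It is known that consecutive diamonds differ in degree by $q-1$ (with a suitable choice, under the convention, for fake diamonds), and that $y$ centralizes each homogeneous component which is not a diamond and does not immediately precede a diamond; in particular the earliest diamond of finite type past $L_q$ has degree of the form $a(q-1)+1$ with $a$ an integer, and $L_{k(q-1)+1}$ is a diamond of infinite type for $2\le k\le a-1$.
   Formalization: The thin Lie algebra L is additionally required to be generated by L_1, since the covering property alone is vacuous at a zero component and would allow unrelated nonzero components after a gap, making the vanishing assertions false. *)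

theory Defs
  imports "HOL-Number_Theory.Number_Theory"
begin

locale lie_algebra = vector_space scale
  for scale :: "'f::field \<Rightarrow> 'a::ab_group_add \<Rightarrow> 'a" +
  fixes br :: "'a \<Rightarrow> 'a \<Rightarrow> 'a"
  assumes br_linear_left: "Vector_Spaces.linear scale scale (\<lambda>u. br u v)"
    and br_linear_right: "Vector_Spaces.linear scale scale (br u)"
    and br_self: "br u u = 0"
    and jacobi: "br (br u v) w + br (br v w) u + br (br w u) v = 0"
begin

text \<open>Left-normed products: the product $[u v_1 \ldots v_n]$ is \<open>lnprod u [v\<^sub>1, \<dots>, v\<^sub>n]\<close>.\<close>

definition lnprod :: "'a \<Rightarrow> 'a list \<Rightarrow> 'a" where
  "lnprod u vs = foldl br u vs"

definition lie_subalgebra :: "'a set \<Rightarrow> bool" where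
  "lie_subalgebra S \<longleftrightarrow> subspace S \<and> (\<forall>u\<in>S. \<forall>v\<in>S. br u v \<in> S)"

end

text \<open>The grading is over the positive integers, so the component of index 0 is trivial.\<close>

locale graded_lie_algebra = lie_algebra scale br
  for scale :: "'f::field \<Rightarrow> 'a::ab_group_add \<Rightarrow> 'a" and br :: "'a \<Rightarrow> 'a \<Rightarrow> 'a" +
  fixes L :: "nat \<Rightarrow> 'a set"
  assumes subspace_component: "subspace (L i)"
    and component_0: "L 0 = {0}"
    and br_component: "u \<in> L i \<Longrightarrow> v \<in> L j \<Longrightarrow> br u v \<in> L (i + j)"
    and direct_sum: "\<exists>!f. (\<forall>i. f i \<in> L i) \<and> finite {i. f i \<noteq> 0} \<and> v = (\<Sum>i | f i \<noteq> 0. f i)"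

text \<open>
  Generation by the first component is the usual companion of the covering property. The latter
  is vacuous at a trivial component, so on its own it would allow a nonzero component of
  arbitrary dimension after a trivial one.
\<close>

locale thin_lie_algebra = graded_lie_algebra scale br L
  for scale :: "'f::field \<Rightarrow> 'a::ab_group_add \<Rightarrow> 'a" and br :: "'a \<Rightarrow> 'a \<Rightarrow> 'a"
    and L :: "nat \<Rightarrow> 'a set" +
  assumes dim_component_1: "dim (L 1) = 2"
    and generated: "lie_subalgebra S \<Longrightarrow> L 1 \<subseteq> S \<Longrightarrow> S = UNIV"
    and covering: "i \<ge> 1 \<Longrightarrow> z \<in> L i \<Longrightarrow> z \<noteq> 0 \<Longrightarrow> br z ` L 1 = L (i + 1)"
    and further_diamond: "\<exists>m>1. dim (L m) = 2"
begin

definition second_diamond :: "nat \<Rightarrow> bool" where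
  "second_diamond m \<longleftrightarrow> m > 1 \<and> dim (L m) = 2 \<and> (\<forall>i. 1 < i \<and> i < m \<longrightarrow> dim (L i) \<noteq> 2)"

definition genuine_finite_type :: "'a \<Rightarrow> 'a \<Rightarrow> nat \<Rightarrow> 'f \<Rightarrow> bool" where
  "genuine_finite_type x y m \<mu> \<longleftrightarrow> m > 1 \<and> dim (L m) = 2 \<and> L (m + 1) \<noteq> {0} \<and>
     (\<exists>w. w \<noteq> 0 \<and> L (m - 1) = span {w} \<and>
        lnprod w [x, x] = 0 \<and> lnprod w [y, y] = 0 \<and>
        scale \<mu> (lnprod w [y, x]) = scale (1 - \<mu>) (lnprod w [x, y]))"

definition infinite_type :: "'a \<Rightarrow> 'a \<Rightarrow> nat \<Rightarrow> bool" where
  "infinite_type x y m \<longleftrightarrow> m > 1 \<and> dim (L m) = 2 \<and> L (m + 1) \<noteq> {0} \<and>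
     (\<exists>w. w \<noteq> 0 \<and> L (m - 1) = span {w} \<and>
        lnprod w [x, x] = 0 \<and> lnprod w [y, y] = 0 \<and>
        lnprod w [y, x] = - lnprod w [x, y])"

text \<open>The bare conditions for a fake diamond, before the convention that selects the degree.\<close>

definition fake_type :: "'a \<Rightarrow> 'a \<Rightarrow> nat \<Rightarrow> 'f \<Rightarrow> bool" where
  "fake_type x y m \<mu> \<longleftrightarrow> m > 1 \<and> L (m + 1) \<noteq> {0} \<and>
     (\<exists>w. w \<noteq> 0 \<and> L (m - 1) = span {w} \<and>
        (\<mu> = 1 \<and> lnprod w [x, x] = 0 \<and> br w y = 0 \<or>
         \<mu> = 0 \<and> br w x = 0 \<and> lnprod w [y, y] = 0))"

end

locale nottingham_algebra = thin_lie_algebra scale br L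
  for scale :: "'f::field \<Rightarrow> 'a::ab_group_add \<Rightarrow> 'a" and br :: "'a \<Rightarrow> 'a \<Rightarrow> 'a"
    and L :: "nat \<Rightarrow> 'a set" +
  fixes p q :: nat
  assumes char_p: "CHAR('f) = p" and p_gt_3: "p > 3"
    and q_power: "\<exists>n. q = p ^ n" and q_gt_5: "q > 5"
    and second_diamond_q: "second_diamond q"
begin

definition standard_generators :: "'a \<Rightarrow> 'a \<Rightarrow> bool" where
  "standard_generators x y \<longleftrightarrow> L 1 = span {x, y} \<and> lnprod y [x, y] = 0 \<and>
     (let v = lnprod y (replicate (q - 2) x) in
        L (q - 1) = span {v} \<and>
        lnprod v [x, x] = 0 \<and> lnprod v [y, y] = 0 \<and>
        lnprod v [y, x] = scale (- 2) (lnprod v [x, y]))"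

text \<open>
  The conditions for a fake diamond of type 1 in degree \<open>m\<close> imply those for a fake diamond of
  type 0 in degree \<open>m + 1\<close>, and only one of the two components is to be called a diamond. Since
  consecutive diamonds differ in degree by \<open>q - 1\<close>, starting with the second diamond in degree
  \<open>q\<close>, the one which counts is the one whose degree is congruent to 1 modulo \<open>q - 1\<close>.
\<close>

definition finite_type :: "'a \<Rightarrow> 'a \<Rightarrow> nat \<Rightarrow> 'f \<Rightarrow> bool" where
  "finite_type x y m \<mu> \<longleftrightarrow>
     genuine_finite_type x y m \<mu> \<or> fake_type x y m \<mu> \<and> [m = 1] (mod (q - 1))"

definition earliest_finite_type :: "'a \<Rightarrow> 'a \<Rightarrow> nat \<Rightarrow> 'f \<Rightarrow> bool" where
  "earliest_finite_type x y m \<mu> \<longleftrightarrow> q < m \<and> finite_type x y m \<mu> \<and>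
     (\<forall>i \<nu>. q < i \<and> i < m \<longrightarrow> \<not> finite_type x y i \<nu>)"

end

end

theory Submission
  imports Defs
begin

text \<open>
  Write \<open>v\<^sub>k\<close> for a generator of the component just below the diamond in degree \<open>k (q - 1) + 1\<close>. Between
  consecutive diamonds everything is determined by right multiplication by \<open>x\<close>, and as long as the
  diamonds have infinite type, \<open>ad v\<^sub>1\<close> shifts one segment to the next. Hence products such as
  \<open>[[v\<^sub>l x] [v\<^sub>m y]]\<close> satisfy Pascal's recursion in \<open>l\<close> and \<open>m\<close>; they vanish for \<open>l + m < a\<close>, and for
  \<open>l + m = a + j\<close> they are binomial coefficients times fixed elements around the diamond in degree
  \<open>(a + j) (q - 1) + 1\<close>. Comparing both ends of the antidiagonal \<open>l + m = a\<close> gives the parity of \<open>a\<close>,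
  and the antidiagonal \<open>l + m = a + 1\<close> gives (b). In (c) and (d) anticommutativity and the Jacobi
  identity force the diamonds for \<open>0 < j < p\<^sup>s\<close> to have infinite type, while for \<open>j = p\<^sup>s\<close> the
  binomial coefficients, evaluated modulo p, leave nothing but 0 when \<open>a - 1\<close> or \<open>a / 2\<close> is not a power
  of p.

  That \<open>y\<close> centralizes the components between diamonds comes from expanding \<open>[e [y x\<^sup>i] y] = 0\<close> for \<open>e\<close>
  in the preceding segment: the unknown product appears with binomial coefficients which do not all
  vanish modulo p.
\<close>

section \<open>Binomial coefficients in characteristic p\<close>

text \<open>Neither the positions of the diamonds nor the centralizing property of \<open>y\<close>
  is assumed, and no component beyond degree \<open>a (q - 1) + 2\<close> is known to be nonzero. So
  the vanishing claims are proved by contradiction: a nonzero component makes all earlier ones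
  nonzero, and this nonvanishing is what lets \<open>y\<close> centralize the segment after the
  diamond of finite type (\<open>central_d\<close>). The binomial coefficients in (c) and (d) are
  governed by Lucas' theorem. With \<open>P = p ^ s\<close>, the indices \<open>l = j + P\<close>
  and \<open>m = a - P\<close> give a coefficient equal to 1 modulo p for one order of the two
  factors, and 0 or a sign for the other, so comparing both orders leaves exactly the relation of
  infinite type. For \<open>j = P\<close> the coefficients add up to the cofactor of P in
  \<open>a - 1\<close> or \<open>a\<close>, prime to p by maximality of s. The comparison needs
  \<open>2 P < a\<close>, and this is where powers of p have to be excluded. Small integers such as
  2, 3, 4 and 12 are cancelled throughout; here p > 3 enters.\<close>

locale prime_char_field =
  fixes field_type :: "'f::field itself" and p :: nat
  assumes CHAR_eq: "CHAR('f) = p" and prime_p: "prime p"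
begin

lemma of_nat_eq_0: "(of_nat n :: 'f) = 0 \<longleftrightarrow> p dvd n"
  by (simp add: of_nat_eq_0_iff_char_dvd CHAR_eq)

text \<open>By the absorption identity, \<open>p ^ s\<close> divides k times the coefficient, but it
  does not divide k.\<close>

lemma choose_power_eq_0:
  assumes "0 < k" "k < p ^ s"
  shows "of_nat (p ^ s choose k) = (0::'f)"
proof -
  have "p ^ s dvd k * (p ^ s choose k)"
    using times_binomial_minus1_eq[OF assms(1), of "p ^ s"] by simp
  moreover have "\<not> p ^ s dvd k"
    using assms by (auto dest: dvd_imp_le)
  ultimately have "\<not> coprime (p ^ s) (p ^ s choose k)"
    using coprime_dvd_mult_left_iff by blast
  then have "p dvd (p ^ s choose k)"
    using prime_p by (metis coprime_power_left_iff prime_imp_coprime)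
  then show ?thesis
    by (simp add: of_nat_eq_0)
qed

text \<open>Vandermonde's identity: every term except k = 0 contains a coefficient covered by
  \<open>choose_power_eq_0\<close>. This and the next lemmas are the instances of Lucas' theorem
  used later.\<close>

lemma choose_add_power:
  assumes "i < p ^ s"
  shows "of_nat ((n + p ^ s) choose i) = (of_nat (n choose i) :: 'f)"
proof -
  have "(of_nat ((n + p ^ s) choose i) :: 'f)
      = (\<Sum>k\<le>i. of_nat (p ^ s choose k) * of_nat (n choose (i - k)))"
    by (simp add: vandermonde[symmetric] add.commute[of n])
  also have "\<dots> = (\<Sum>k\<in>{0}. of_nat (p ^ s choose k) * of_nat (n choose (i - k)))"
    using assms by (intro sum.mono_neutral_right) (auto simp: choose_power_eq_0)
  finally show ?thesis
    by simp
qed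

lemma choose_add_power_self:
  "of_nat ((n + p ^ s) choose p ^ s) = (of_nat (n choose p ^ s) + 1 :: 'f)"
proof -
  have P: "p ^ s > 0"
    using prime_p by (simp add: prime_gt_0_nat)
  have "(of_nat ((n + p ^ s) choose p ^ s) :: 'f)
      = (\<Sum>k\<le>p ^ s. of_nat (p ^ s choose k) * of_nat (n choose (p ^ s - k)))"
    by (simp add: vandermonde[symmetric] add.commute[of n])
  also have "\<dots> = (\<Sum>k\<in>{0, p ^ s}. of_nat (p ^ s choose k) * of_nat (n choose (p ^ s - k)))"
    by (intro sum.mono_neutral_right) (auto simp: choose_power_eq_0)
  finally show ?thesis
    using P by simp
qed

lemma choose_add_mult_power:
  assumes "i < p ^ s"
  shows "of_nat ((p ^ s * k + n) choose i) = (of_nat (n choose i) :: 'f)"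
proof (induction k)
  case (Suc k)
  have "p ^ s * Suc k + n = (p ^ s * k + n) + p ^ s"
    by simp
  then show ?case
    using choose_add_power[OF assms] Suc by presburger
qed simp

lemma choose_mult_power:
  assumes "b < p ^ s"
  shows "of_nat ((p ^ s * k + b) choose p ^ s) = (of_nat k :: 'f)"
proof (induction k)
  case (Suc k)
  have "p ^ s * Suc k + b = (p ^ s * k + b) + p ^ s"
    by simp
  then show ?case
    using choose_add_power_self[of "p ^ s * k + b" s] Suc by (simp add: add_ac)
qed (use assms in \<open>simp add: binomial_eq_0\<close>)

lemma choose_pred_power:
  assumes "k < p ^ s"
  shows "of_nat ((p ^ s - 1) choose k) = ((- 1) ^ k :: 'f)"
  using assms
proof (induction k)
  case (Suc k)
  have "p ^ s choose Suc k = ((p ^ s - 1) choose k) + ((p ^ s - 1) choose Suc k)"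
    using Suc.prems choose_reduce_nat[of "p ^ s" "Suc k"] prime_gt_0_nat[OF prime_p] by simp
  then have "(0::'f) = of_nat ((p ^ s - 1) choose k) + of_nat ((p ^ s - 1) choose Suc k)"
    using choose_power_eq_0[of "Suc k" s] Suc.prems by (metis of_nat_add zero_less_Suc)
  then show ?case
    using Suc by (simp add: eq_neg_iff_add_eq_0 add.commute)
qed simp

lemma choose_pred_pred_power:
  assumes "k < p ^ s - 1"
  shows "of_nat ((p ^ s - 2) choose k) = ((- 1) ^ k * of_nat (k + 1) :: 'f)"
  using assms
proof (induction k)
  case (Suc k)
  have "p ^ s - 2 = p ^ s - 1 - 1"
    by simp
  then have "(p ^ s - 1) choose Suc k = ((p ^ s - 2) choose k) + ((p ^ s - 2) choose Suc k)"
    using Suc.prems choose_reduce_nat[of "p ^ s - 1" "Suc k"] by simp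
  then have "((- 1) ^ Suc k :: 'f) = of_nat ((p ^ s - 2) choose k) + of_nat ((p ^ s - 2) choose Suc k)"
    using choose_pred_power[of "Suc k" s] Suc.prems by (metis of_nat_add less_diff_conv add_lessD1)
  then have "of_nat ((p ^ s - 2) choose Suc k) = ((- 1) ^ Suc k - (- 1) ^ k * of_nat (k + 1) :: 'f)"
    using Suc by (simp add: eq_diff_eq add.commute)
  then show ?case
    by (simp add: algebra_simps)
qed simp

lemma choose_power_cases:
  assumes "P = p ^ s"
  shows "i < P \<Longrightarrow> of_nat ((i + P) choose P) = (1 :: 'f)"
    "j < P \<Longrightarrow> of_nat ((i + P) choose j) = (of_nat (i choose j) :: 'f)"
    "i < P \<Longrightarrow> of_nat ((P * k + j) choose i) = (of_nat (j choose i) :: 'f)"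
    "j < P \<Longrightarrow> of_nat ((P * k + j) choose P) = (of_nat k :: 'f)"
    "i < P \<Longrightarrow> of_nat ((P - 1) choose i) = ((- 1) ^ i :: 'f)"
  unfolding assms
  using choose_add_power_self[of i s] choose_add_power[of j s i] choose_add_mult_power[of i s k j]
    choose_mult_power[of j s k] choose_pred_power[of i s]
  by (simp_all add: binomial_eq_0)

lemma of_nat_choose_two: "2 * of_nat (n choose 2) = (of_nat n * (of_nat n - 1) :: 'f)"
  by (induction n) (simp_all add: numeral_2_eq_2 algebra_simps)

lemma of_nat_choose_three:
  "6 * of_nat (n choose 3) = (of_nat n * (of_nat n - 1) * (of_nat n - 2) :: 'f)"
proof (induction n)
  case (Suc n)
  have "6 * of_nat (Suc n choose 3) = 3 * (2 * of_nat (n choose 2)) + 6 * (of_nat (n choose 3) :: 'f)"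
    by (simp add: numeral_3_eq_3 numeral_2_eq_2)
  also have "\<dots> = of_nat (Suc n) * (of_nat (Suc n) - 1) * (of_nat (Suc n) - 2)"
    unfolding Suc of_nat_choose_two by (simp add: algebra_simps)
  finally show ?case .
qed (simp add: numeral_3_eq_3)

lemma power_eq_mult_multiplicity:
  assumes "0 < n"
  obtains m where "n = p ^ multiplicity p n * m" "(of_nat m :: 'f) \<noteq> 0"
  using assms prime_p multiplicity_decompose'[of n p]
  by (metis of_nat_eq_0 not_prime_unit neq0_conv)

end

section \<open>Products in a Lie algebra\<close>

context lie_algebra
begin

notation scale (infixr \<open>*s\<close> 75)
notation br (infixl \<open>\<bullet>\<close> 70)

lemma br_add_left: "(u + v) \<bullet> w = u \<bullet> w + v \<bullet> w"
  and br_scale_left: "(c *s u) \<bullet> w = c *s (u \<bullet> w)"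
  using br_linear_left[of w] by (simp_all add: Vector_Spaces.linear_iff)

lemma br_add_right: "w \<bullet> (u + v) = w \<bullet> u + w \<bullet> v"
  and br_scale_right: "w \<bullet> (c *s u) = c *s (w \<bullet> u)"
  using br_linear_right[of w] by (simp_all add: Vector_Spaces.linear_iff)

lemma br_zero_left [simp]: "0 \<bullet> w = 0" and br_zero_right [simp]: "w \<bullet> 0 = 0"
  using br_scale_left[of 0 0 w] br_scale_right[of w 0 0] by simp_all

lemma br_minus_left: "(- u) \<bullet> w = - (u \<bullet> w)" and br_minus_right: "w \<bullet> (- u) = - (w \<bullet> u)"
  using br_scale_left[of "-1" u w] br_scale_right[of w "-1" u] by simp_all

lemma br_diff_left: "(u - v) \<bullet> w = u \<bullet> w - v \<bullet> w"
  and br_diff_right: "w \<bullet> (u - v) = w \<bullet> u - w \<bullet> v"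
  using br_add_left[of u "- v" w] br_add_right[of w u "- v"]
  by (simp_all add: br_minus_left br_minus_right)

lemmas br_linear_simps = br_add_left br_add_right br_scale_left br_scale_right
  br_minus_left br_minus_right br_diff_left br_diff_right

lemma br_sum_left: "(\<Sum>i\<in>I. f i) \<bullet> w = (\<Sum>i\<in>I. f i \<bullet> w)"
  by (induction I rule: infinite_finite_induct) (simp_all add: br_linear_simps)

declare br_self [simp]

lemma br_anti: "u \<bullet> v = - (v \<bullet> u)"
proof -
  have "0 = u \<bullet> (u + v) + v \<bullet> (u + v)"
    using br_add_left[of u v "u + v"] by simp
  then have "v \<bullet> u + u \<bullet> v = 0"
    by (simp add: br_add_right add.commute)
  then show ?thesis
    by (metis add.commute eq_neg_iff_add_eq_0)
qed

lemma br_br_left: "u \<bullet> v \<bullet> w = u \<bullet> w \<bullet> v + u \<bullet> (v \<bullet> w)"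
  using jacobi[of u v w] br_anti[of "v \<bullet> w" u] br_anti[of w u]
  by (simp add: br_linear_simps algebra_simps)

lemma br_br_right: "u \<bullet> (v \<bullet> w) = u \<bullet> v \<bullet> w - u \<bullet> w \<bullet> v"
  using br_br_left[of u v w] by simp

lemma lnprod_two: "lnprod u [v, w] = u \<bullet> v \<bullet> w"
  by (simp add: lnprod_def)

lemma span_pair: "v \<in> span {u, w} \<longleftrightarrow> (\<exists>c d. v = c *s u + d *s w)"
proof -
  have "v - c *s u = d *s w \<longleftrightarrow> v = c *s u + d *s w" for c d
    by (auto simp: algebra_simps)
  then show ?thesis
    by (auto simp: span_insert span_singleton)
qed

end

locale lie_algebra_elem = lie_algebra scale br
  for scale :: "'f::field \<Rightarrow> 'a::ab_group_add \<Rightarrow> 'a" and br :: "'a \<Rightarrow> 'a \<Rightarrow> 'a" +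
  fixes x :: 'a
begin

definition adpow :: "'a \<Rightarrow> nat \<Rightarrow> 'a" (infixl \<open>\<star>\<close> 70) where
  "u \<star> n = ((\<lambda>v. v \<bullet> x) ^^ n) u"

lemma adpow_0 [simp]: "u \<star> 0 = u"
  and adpow_Suc: "u \<star> Suc n = u \<star> n \<bullet> x"
  by (simp_all add: adpow_def)

lemma adpow_1 [simp]: "u \<star> 1 = u \<bullet> x" "u \<star> Suc 0 = u \<bullet> x"
  by (simp_all add: adpow_def)

lemma adpow_adpow: "u \<star> m \<star> n = u \<star> (m + n)"
  by (induction n) (simp_all add: adpow_Suc)

lemma adpow_2: "u \<star> 2 = u \<bullet> x \<bullet> x"
  by (simp add: numeral_2_eq_2 adpow_Suc)

lemma adpow_Suc': "u \<star> Suc n = u \<bullet> x \<star> n"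
  using adpow_adpow[of u 1 n] by simp

lemma adpow_zero [simp]: "0 \<star> n = 0"
  by (induction n) (simp_all add: adpow_Suc)

lemma adpow_linear:
  "(u + v) \<star> n = u \<star> n + v \<star> n" "(u - v) \<star> n = u \<star> n - v \<star> n"
  "(- u) \<star> n = - (u \<star> n)" "(c *s u) \<star> n = c *s (u \<star> n)"
  by (induction n) (simp_all add: adpow_Suc br_linear_simps)

lemma adpow_eq_0: "u \<star> m = 0 \<Longrightarrow> m \<le> n \<Longrightarrow> u \<star> n = 0"
  using adpow_adpow[of u m "n - m"] by simp

text \<open>The map ad [c x^n] is an n-fold commutator of ad c with ad x. Most arguments below apply
  this with c = y, when all but one or two terms are known to vanish.\<close>

lemma br_adpow:
  "z \<bullet> (c \<star> n) = (\<Sum>k\<le>n. ((- 1) ^ k * of_nat (n choose k)) *s (z \<star> k \<bullet> c \<star> (n - k)))"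
proof (induction n arbitrary: z)
  case (Suc n)
  let ?t = "\<lambda>k. z \<star> k \<bullet> c \<star> (Suc n - k)"
  have A: "z \<bullet> (c \<star> n) \<bullet> x = (\<Sum>k\<le>n. ((- 1) ^ k * of_nat (n choose k)) *s ?t k)"
    by (auto simp: Suc br_sum_left br_scale_left adpow_Suc[symmetric] Suc_diff_le
        intro!: sum.cong)
  have B: "z \<bullet> x \<bullet> (c \<star> n) = (\<Sum>k\<le>n. ((- 1) ^ k * of_nat (n choose k)) *s ?t (Suc k))"
    by (simp add: Suc adpow_Suc'[symmetric])
  have "z \<bullet> (c \<star> Suc n) = z \<bullet> (c \<star> n) \<bullet> x - z \<bullet> x \<bullet> (c \<star> n)"
    by (simp add: adpow_Suc br_br_right)
  also have "\<dots> = ?t 0 + (\<Sum>k\<le>n. ((- 1) ^ Suc k * of_nat (n choose Suc k)) *s ?t (Suc k))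
      + (\<Sum>k\<le>n. ((- 1) ^ Suc k * of_nat (n choose k)) *s ?t (Suc k))"
  proof -
    have "(\<Sum>k\<le>n. ((- 1) ^ k * of_nat (n choose k)) *s ?t k)
        = (\<Sum>k\<le>Suc n. ((- 1) ^ k * of_nat (n choose k)) *s ?t k)"
      by (simp add: binomial_eq_0)
    also have "\<dots> = ?t 0 + (\<Sum>k\<le>n. ((- 1) ^ Suc k * of_nat (n choose Suc k)) *s ?t (Suc k))"
      by (subst sum.atMost_Suc_shift) simp
    finally show ?thesis
      unfolding A B by (simp add: sum_negf)
  qed
  also have "\<dots> = ?t 0 + (\<Sum>k\<le>n. ((- 1) ^ Suc k * of_nat (Suc n choose Suc k)) *s ?t (Suc k))"
    by (simp add: sum.distrib[symmetric] algebra_simps)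
  also have "\<dots> = (\<Sum>k\<le>Suc n. ((- 1) ^ k * of_nat (Suc n choose k)) *s ?t k)"
    by (subst sum.atMost_Suc_shift) simp
  finally show ?case .
qed simp

lemma br_adpow_single:
  assumes "m \<le> n" "\<And>k. k \<le> n \<Longrightarrow> k \<noteq> m \<Longrightarrow> z \<star> k \<bullet> c \<star> (n - k) = 0"
  shows "z \<bullet> (c \<star> n) = ((- 1) ^ m * of_nat (n choose m)) *s (z \<star> m \<bullet> c \<star> (n - m))"
proof -
  have "z \<bullet> (c \<star> n) = (\<Sum>k\<in>{m}. ((- 1) ^ k * of_nat (n choose k)) *s (z \<star> k \<bullet> c \<star> (n - k)))"
    unfolding br_adpow by (rule sum.mono_neutral_right) (use assms in auto)
  then show ?thesis
    by simp
qed

lemma br_adpow_pair: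
  assumes "m < n" "\<And>k. k \<le> n \<Longrightarrow> k \<noteq> m \<Longrightarrow> k \<noteq> Suc m \<Longrightarrow> z \<star> k \<bullet> c \<star> (n - k) = 0"
  shows "z \<bullet> (c \<star> n) = ((- 1) ^ m * of_nat (n choose m)) *s (z \<star> m \<bullet> c \<star> (n - m))
     - ((- 1) ^ m * of_nat (n choose Suc m)) *s (z \<star> Suc m \<bullet> c \<star> (n - Suc m))"
proof -
  have "z \<bullet> (c \<star> n) = (\<Sum>k\<in>{m, Suc m}. ((- 1) ^ k * of_nat (n choose k)) *s (z \<star> k \<bullet> c \<star> (n - k)))"
    unfolding br_adpow by (rule sum.mono_neutral_right) (use assms in auto)
  then show ?thesis
    by simp
qed

lemma br_adpow_zero:
  assumes "\<And>k. k \<le> n \<Longrightarrow> z \<star> k \<bullet> c \<star> (n - k) = 0"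
  shows "z \<bullet> (c \<star> n) = 0"
  unfolding br_adpow by (rule sum.neutral) (use assms in simp)

lemma adpow_br_leibniz:
  "(u \<bullet> v) \<star> n = (\<Sum>k\<le>n. of_nat (n choose k) *s (u \<star> k \<bullet> (v \<star> (n - k))))"
proof (induction n)
  case (Suc n)
  let ?t = "\<lambda>k. u \<star> k \<bullet> (v \<star> (Suc n - k))"
  have step: "a \<bullet> b \<bullet> x = a \<bullet> x \<bullet> b + a \<bullet> (b \<bullet> x)" for a b
    by (rule br_br_left)
  have "(u \<bullet> v) \<star> Suc n
      = (\<Sum>k\<le>n. of_nat (n choose k) *s (u \<star> k \<bullet> x \<bullet> (v \<star> (n - k)) + u \<star> k \<bullet> (v \<star> (n - k) \<bullet> x)))"
    by (simp add: adpow_Suc Suc br_sum_left br_scale_left step)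
  also have "\<dots> = (\<Sum>k\<le>n. of_nat (n choose k) *s ?t (Suc k)) + (\<Sum>k\<le>n. of_nat (n choose k) *s ?t k)"
    by (simp add: adpow_Suc[symmetric] scale_right_distrib sum.distrib Suc_diff_le)
  also have "(\<Sum>k\<le>n. of_nat (n choose k) *s ?t k) = (\<Sum>k\<le>Suc n. of_nat (n choose k) *s ?t k)"
    by (simp add: binomial_eq_0)
  also have "\<dots> = ?t 0 + (\<Sum>k\<le>n. of_nat (n choose Suc k) *s ?t (Suc k))"
    by (subst sum.atMost_Suc_shift) simp
  also have "(\<Sum>k\<le>n. of_nat (n choose k) *s ?t (Suc k)) + (?t 0 + (\<Sum>k\<le>n. of_nat (n choose Suc k) *s ?t (Suc k)))
      = ?t 0 + (\<Sum>k\<le>n. of_nat (Suc n choose Suc k) *s ?t (Suc k))"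
    by (simp add: sum.distrib[symmetric] algebra_simps)
  also have "\<dots> = (\<Sum>k\<le>Suc n. of_nat (Suc n choose k) *s ?t k)"
    by (subst sum.atMost_Suc_shift) simp
  finally show ?case .
qed simp

end

section \<open>Components of a thin Lie algebra\<close>

context graded_lie_algebra
begin

text \<open>Uniqueness of the homogeneous decomposition: v is its own component of degree n, and
  also a sum of components of degrees below m.\<close>

lemma component_span_eq_0:
  assumes "v \<in> span (\<Union>i<m. L i)" "v \<in> L n" "m \<le> n"
  shows "v = 0"
proof -
  have "\<exists>f. (\<forall>i. f i \<in> L i) \<and> u = (\<Sum>i<m. f i)" if "u \<in> span (\<Union>i<m. L i)" for u
    using that
  proof (induction rule: span_induct_alt)
    case base
    show ?case
      by (rule exI[of _ "\<lambda>_. 0"]) (simp add: subspace_0[OF subspace_component])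
  next
    case (step c u w)
    then obtain i f where i: "i < m" "u \<in> L i" and f: "\<forall>i. f i \<in> L i" "w = (\<Sum>i<m. f i)"
      by auto
    have "(\<Sum>k<m. f k + (if k = i then c *s u else 0)) = w + c *s u"
      using i f by (simp add: sum.distrib)
    moreover have "f k + (if k = i then c *s u else 0) \<in> L k" for k
      using f i by (auto intro!: subspace_add subspace_scale subspace_component)
    ultimately show ?case
      by (intro exI[of _ "\<lambda>k. f k + (if k = i then c *s u else 0)"]) (simp add: add.commute)
  qed
  then obtain f where f: "\<forall>i. f i \<in> L i" "v = (\<Sum>i<m. f i)"
    using assms(1) by blast
  define g where "g i = (if i < m then f i else 0)" for i
  define h where "h i = (if i = n then v else 0)" for i
  have fin: "{i. g i \<noteq> 0} \<subseteq> {..<m}" "{i. h i \<noteq> 0} \<subseteq> {n}"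
    by (auto simp: g_def h_def split: if_splits)
  have "v = (\<Sum>i | g i \<noteq> 0. g i)" "v = (\<Sum>i | h i \<noteq> 0. h i)"
  proof -
    have "v = (\<Sum>i<m. g i)"
      using f by (simp add: g_def)
    also have "\<dots> = (\<Sum>i | g i \<noteq> 0. g i)"
      by (rule sum.mono_neutral_right) (use fin in auto)
    finally show "v = (\<Sum>i | g i \<noteq> 0. g i)" .
    have "v = (\<Sum>i\<in>{n}. h i)"
      by (simp add: h_def)
    also have "\<dots> = (\<Sum>i | h i \<noteq> 0. h i)"
      by (rule sum.mono_neutral_right) (use fin in auto)
    finally show "v = (\<Sum>i | h i \<noteq> 0. h i)" .
  qed
  moreover have "\<forall>i. g i \<in> L i" "\<forall>i. h i \<in> L i"
    using f assms(2) subspace_0[OF subspace_component] by (auto simp: g_def h_def)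
  moreover have "finite {i. g i \<noteq> 0}" "finite {i. h i \<noteq> 0}"
    using fin finite_subset by blast+
  ultimately have "g = h"
    using direct_sum[of v] by blast
  then have "g n = h n"
    by simp
  then show ?thesis
    using assms(3) by (simp add: g_def h_def)
qed

end

context thin_lie_algebra
begin

fun monomials :: "nat \<Rightarrow> 'a set" where
  "monomials 0 = L 1"
| "monomials (Suc n) = (\<Union>z\<in>L 1. (\<lambda>u. u \<bullet> z) ` monomials n)"

lemma monomials_component: "monomials n \<subseteq> L (n + 1)"
proof (induction n)
  case (Suc n)
  then show ?case
    using br_component[of _ "n + 1" _ 1] by auto
qed simp

text \<open>By \<open>generated\<close> only closure under brackets is at stake, and [u [w t]] =
  [u w t] - [u t w] reduces a bracket with a monomial to right multiplications by elements of
  \<open>L 1\<close>.\<close>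

lemma span_monomials: "span (\<Union>n. monomials n) = UNIV"
proof (rule generated)
  let ?S = "span (\<Union>n. monomials n)"
  have mono: "u \<bullet> z \<in> ?S" if "u \<in> ?S" "z \<in> L 1" for u z
    using that(1)
  proof (induction rule: span_induct_alt)
    case (step c u w)
    then obtain n where "u \<in> monomials n"
      by auto
    then have "u \<bullet> z \<in> monomials (Suc n)"
      using that(2) by auto
    then have "u \<bullet> z \<in> ?S"
      by (meson UNIV_I UN_I span_base)
    then show ?case
      using step by (auto simp: br_linear_simps intro: span_add span_scale)
  qed (simp add: span_zero)
  have *: "u \<bullet> z \<in> ?S" if "u \<in> ?S" "z \<in> monomials n" for u z n
    using that
  proof (induction n arbitrary: u z)
    case (Suc n)
    then obtain w t where z: "z = w \<bullet> t" "w \<in> monomials n" "t \<in> L 1"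
      by auto
    then have "u \<bullet> w \<bullet> t - u \<bullet> t \<bullet> w \<in> ?S"
      using Suc mono by (intro span_diff) auto
    then show ?case
      by (simp add: z br_br_right)
  qed (use mono in auto)
  have "u \<bullet> z \<in> ?S" if "u \<in> ?S" "z \<in> ?S" for u z
    using that(2)
  proof (induction rule: span_induct_alt)
    case (step c z w)
    then show ?case
      using * that(1) by (auto simp: br_linear_simps intro!: span_add span_scale)
  qed (simp add: span_zero)
  then show "lie_subalgebra ?S"
    by (auto simp: lie_subalgebra_def subspace_span)
  show "L 1 \<subseteq> ?S"
    using span_superset[of "\<Union>n. monomials n"] by (metis UNIV_I UN_subset_iff monomials.simps(1))
qed

text \<open>Covering is silent after a zero component, generation is not: monomials of degree at
  least m vanish, so the components below m span the algebra.\<close>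

lemma component_eq_0_mono:
  assumes "L m = {0}" "m \<le> n" "0 < m"
  shows "L n = {0}"
proof -
  have zero: "monomials k \<subseteq> {0}" if "m \<le> k + 1" for k
    using that
  proof (induction k)
    case 0
    then show ?case
      using assms by (auto simp: le_Suc_eq)
  next
    case (Suc k)
    show ?case
    proof (cases "m \<le> k + 1")
      case True
      then show ?thesis
        using Suc by auto
    next
      case False
      then have "m = Suc k + 1"
        using Suc.prems by simp
      then show ?thesis
        using monomials_component[of "Suc k"] assms by simp
    qed
  qed
  have "monomials k \<subseteq> span (\<Union>i<m. L i)" for k
  proof (cases "m \<le> k + 1")
    case True
    then show ?thesis
      using zero[of k] span_zero by blast
  next
    case False
    then have "monomials k \<subseteq> (\<Union>i<m. L i)"
      using monomials_component[of k] by (auto intro!: bexI[of _ "Suc k"])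
    then show ?thesis
      using span_superset by blast
  qed
  then have "span (\<Union>n. monomials n) \<subseteq> span (\<Union>i<m. L i)"
    by (intro span_minimal) (auto simp: subspace_span)
  then have "v \<in> span (\<Union>i<m. L i)" for v
    by (auto simp: span_monomials)
  then show ?thesis
    using component_span_eq_0[of _ m n] assms subspace_0[OF subspace_component] by blast
qed

lemma component_neq_0_mono: "L n \<noteq> {0} \<Longrightarrow> m \<le> n \<Longrightarrow> 0 < m \<Longrightarrow> L m \<noteq> {0}"
  using component_eq_0_mono by blast

context
  fixes x y :: 'a
  assumes L1: "L 1 = span {x, y}"
begin

lemma x_in_L1: "x \<in> L 1" and y_in_L1: "y \<in> L 1"
  unfolding L1 by (auto intro: span_base)

lemma br_x_component: "u \<in> L m \<Longrightarrow> u \<bullet> x \<in> L (Suc m)"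
  and br_y_component: "u \<in> L m \<Longrightarrow> u \<bullet> y \<in> L (Suc m)"
  using br_component[of u m x 1] br_component[of u m y 1] x_in_L1 y_in_L1 by auto

lemma covering_span:
  assumes "z \<in> L m" "z \<noteq> 0" "1 \<le> m"
  shows "L (Suc m) = span {z \<bullet> x, z \<bullet> y}"
proof -
  have "L (Suc m) = br z ` span {x, y}"
    using covering[OF assms(3,1,2)] L1 by simp
  also have "\<dots> = span {z \<bullet> x, z \<bullet> y}"
  proof (intro equalityI subsetI)
    fix v assume "v \<in> br z ` span {x, y}"
    then obtain c d where "v = z \<bullet> (c *s x + d *s y)"
      by (auto simp: span_pair)
    then show "v \<in> span {z \<bullet> x, z \<bullet> y}"
      by (auto simp: span_pair br_linear_simps)
  next
    fix v assume "v \<in> span {z \<bullet> x, z \<bullet> y}"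
    then obtain c d where "v = z \<bullet> (c *s x + d *s y)"
      by (auto simp: span_pair br_linear_simps)
    moreover have "c *s x + d *s y \<in> span {x, y}"
      by (auto simp: span_pair)
    ultimately show "v \<in> br z ` span {x, y}"
      by simp
  qed
  finally show ?thesis .
qed

lemma covering_eq_0:
  assumes "z \<in> L m" "z \<noteq> 0" "1 \<le> m" "z \<bullet> x = 0" "z \<bullet> y = 0"
  shows "L (Suc m) = {0}"
  using covering_span[OF assms(1-3)] assms(4,5) by (simp add: span_zero span_singleton)

lemma span_component_Suc:
  assumes "L m = span S" "1 \<le> m"
  shows "L (Suc m) = span ((\<lambda>u. u \<bullet> x) ` S \<union> (\<lambda>u. u \<bullet> y) ` S)"
proof (cases "S \<subseteq> {0}")
  case True
  then have "L m = {0}"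
    using assms(1) by (metis span_delete_0 Diff_eq_empty_iff span_empty)
  then have "L (Suc m) = {0}"
    using component_eq_0_mono[of m "Suc m"] assms(2) by simp
  moreover have "(\<lambda>u. u \<bullet> x) ` S \<union> (\<lambda>u. u \<bullet> y) ` S \<subseteq> {0}"
    using True by auto
  ultimately show ?thesis
    by (metis span_delete_0 Diff_eq_empty_iff span_empty)
next
  case False
  then obtain z where z: "z \<in> S" "z \<noteq> 0"
    by auto
  have S: "S \<subseteq> L m"
    using assms(1) span_superset by blast
  have "L (Suc m) = span {z \<bullet> x, z \<bullet> y}"
    using covering_span[of z m] z S assms(2) by auto
  also have "\<dots> \<subseteq> span ((\<lambda>u. u \<bullet> x) ` S \<union> (\<lambda>u. u \<bullet> y) ` S)"
    using z by (intro span_mono) auto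
  finally show ?thesis
    using S br_x_component[of _ m] br_y_component[of _ m]
    by (intro equalityI span_minimal subspace_component) auto
qed

lemma span_component_Suc_single:
  assumes "L m = span {u}" "1 \<le> m"
  shows "L (Suc m) = span {u \<bullet> x, u \<bullet> y}"
proof -
  have "(\<lambda>u. u \<bullet> x) ` {u} \<union> (\<lambda>u. u \<bullet> y) ` {u} = {u \<bullet> x, u \<bullet> y}"
    by auto
  then show ?thesis
    using span_component_Suc[OF assms] by simp
qed

lemma span_component_Suc_central:
  assumes "L m = span {u}" "1 \<le> m" "u \<bullet> y = 0"
  shows "L (Suc m) = span {u \<bullet> x}"
proof -
  have "{u \<bullet> x, u \<bullet> y} = insert 0 {u \<bullet> x}"
    using assms(3) by auto
  then show ?thesis
    using span_component_Suc_single[OF assms(1,2)] by (simp add: span_insert_0)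
qed

lemma span_component_Suc_Suc:
  assumes "L m = span {u}" "1 \<le> m"
  shows "L (Suc (Suc m)) = span {u \<bullet> x \<bullet> x, u \<bullet> x \<bullet> y, u \<bullet> y \<bullet> x, u \<bullet> y \<bullet> y}"
proof -
  have "L (Suc (Suc m)) = span ((\<lambda>u. u \<bullet> x) ` {u \<bullet> x, u \<bullet> y} \<union> (\<lambda>u. u \<bullet> y) ` {u \<bullet> x, u \<bullet> y})"
    using span_component_Suc[OF span_component_Suc_single[OF assms]] by simp
  then show ?thesis
    by (simp add: insert_commute)
qed

end

end

section \<open>The components up to the third diamond\<close>

locale nottingham_generators = nottingham_algebra scale br L p q
  for scale :: "'f::field \<Rightarrow> 'a::ab_group_add \<Rightarrow> 'a" and br :: "'a \<Rightarrow> 'a \<Rightarrow> 'a"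
    and L :: "nat \<Rightarrow> 'a set" and p q :: nat +
  fixes x y :: 'a
  assumes standard: "standard_generators x y"
    and infinite_2: "infinite_type x y (2 * q - 1)"

sublocale nottingham_generators \<subseteq> prime_char_field "TYPE('f)" p
proof
  show "CHAR('f) = p"
    by (rule char_p)
  then show "prime p"
    using p_gt_3 prime_CHAR_semidom[where 'a = 'f] by simp
qed

sublocale nottingham_generators \<subseteq> lie_algebra_elem scale br x ..

context nottingham_generators
begin

lemma of_nat_neq_0: "0 < n \<Longrightarrow> n < p \<Longrightarrow> (of_nat n :: 'f) \<noteq> 0"
  by (auto simp: of_nat_eq_0 dest: dvd_imp_le)

lemma numeral_neq_0 [simp]:
  "(2::'f) \<noteq> 0" "(3::'f) \<noteq> 0" "(4::'f) \<noteq> 0" "(6::'f) \<noteq> 0" "(12::'f) \<noteq> 0"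
proof -
  show 2: "(2::'f) \<noteq> 0" and 3: "(3::'f) \<noteq> 0"
    using of_nat_neq_0[of 2] of_nat_neq_0[of 3] p_gt_3 by simp_all
  have "(4::'f) = 2 * 2" "(6::'f) = 2 * 3" "(12::'f) = 2 * 2 * 3"
    by simp_all
  with 2 3 show "(4::'f) \<noteq> 0" "(6::'f) \<noteq> 0" "(12::'f) \<noteq> 0"
    by (metis mult_eq_0_iff)+
qed

lemmas numeral_neq_0' [simp] = numeral_neq_0[symmetric]

lemma odd_p: "odd p"
  using prime_p p_gt_3 prime_odd_nat by auto

lemma p_ge_5: "5 \<le> p"
  using odd_p p_gt_3 by presburger

lemma odd_p_power: "odd (p ^ s)"
  using odd_p by simp

lemma multiplicity_power_facts:
  assumes "p dvd n" "0 < n" "P = p ^ multiplicity p n"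
  shows "p dvd P" "5 \<le> P" "odd P" "\<exists>m. n = P * m \<and> (of_nat m :: 'f) \<noteq> 0"
proof -
  have "multiplicity p n \<noteq> 0"
    using assms prime_p by (metis multiplicity_eq_zero_iff not_prime_unit not_gr0)
  then show "p dvd P"
    by (simp add: assms(3))
  moreover have "0 < P"
    using prime_p by (simp add: assms(3) prime_gt_0_nat)
  ultimately show "5 \<le> P"
    using p_ge_5 dvd_imp_le[of p P] by linarith
  show "odd P"
    unfolding assms(3) by (rule odd_p_power)
  show "\<exists>m. n = P * m \<and> (of_nat m :: 'f) \<noteq> 0"
    using power_eq_mult_multiplicity[OF assms(2)] assms(3) by metis
qed

definition qe :: nat where "qe = (SOME n. q = p ^ n)"

lemma q_eq: "q = p ^ qe"
  unfolding qe_def using someI_ex[OF q_power] .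

lemma odd_q: "odd q"
  using q_eq odd_p_power by metis

lemma q_ge_7: "7 \<le> q"
proof -
  have "q \<noteq> 6"
    using odd_q by auto
  then show ?thesis
    using q_gt_5 by linarith
qed

lemma p_dvd_q: "p dvd q"
proof (cases qe)
  case 0
  then show ?thesis
    using q_eq q_gt_5 by simp
qed (use q_eq in simp)

lemma of_nat_q [simp]: "(of_nat q :: 'f) = 0"
  using p_dvd_q by (simp add: of_nat_eq_0)

lemma of_nat_q_diff: "k \<le> q \<Longrightarrow> (of_nat (q - k) :: 'f) = - of_nat k"
  by (simp add: of_nat_diff)

lemma minus_one_power_q_diff: "k \<le> q \<Longrightarrow> (- 1 :: 'f) ^ (q - k) = - ((- 1) ^ k)"
  using odd_q by (cases "even k") auto

text \<open>A power of p that divides a number below q = p^qe also divides q, hence the positive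
  difference q - n.\<close>

lemma power_dvd_less:
  assumes "p ^ s dvd n" "0 < n" "n < q"
  shows "n + p ^ s \<le> q"
proof -
  have "p ^ s < p ^ qe"
    using assms q_eq dvd_imp_le by (metis order_le_less_trans)
  then have "s < qe"
    using prime_p by (simp add: prime_gt_Suc_0_nat)
  then have "p ^ s dvd q"
    using q_eq le_imp_power_dvd by (metis less_imp_le)
  then have "p ^ s dvd q - n"
    using assms(1) by simp
  then have "p ^ s \<le> q - n"
    using assms(3) by (intro dvd_imp_le) auto
  then show ?thesis
    using assms(3) by simp
qed

section \<open>The segment before the second diamond and the products around it\<close>

definition v1 :: 'a where "v1 = y \<star> (q - 2)"
definition g :: 'a where "g = v1 \<bullet> y"
definition h :: 'a where "h = v1 \<bullet> x \<bullet> y"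

lemma L1: "L 1 = span {x, y}"
  and yxy: "y \<bullet> x \<bullet> y = 0"
  and L_v1: "L (q - 1) = span {v1}"
  and v1xx: "v1 \<bullet> x \<bullet> x = 0"
  and gy: "g \<bullet> y = 0"
  and gx: "g \<bullet> x = - (2 *s h)"
proof -
  have *: "foldl br u (replicate n x) = u \<star> n" for u n
    by (induction n arbitrary: u) (simp_all add: adpow_Suc')
  then have "lnprod y (replicate (q - 2) x) = v1"
    by (simp add: lnprod_def v1_def)
  then show "L 1 = span {x, y}" "y \<bullet> x \<bullet> y = 0" "L (q - 1) = span {v1}" "v1 \<bullet> x \<bullet> x = 0"
    "g \<bullet> y = 0" "g \<bullet> x = - (2 *s h)"
    using standard by (simp_all add: standard_generators_def Let_def lnprod_two g_def h_def)
qed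

lemmas br_x_component = br_x_component[OF L1]
  and br_y_component = br_y_component[OF L1]
  and covering_span = covering_span[OF L1]
  and covering_eq_0 = covering_eq_0[OF L1]
  and span_component_Suc = span_component_Suc[OF L1]
  and span_component_Suc_single = span_component_Suc_single[OF L1]
  and span_component_Suc_central = span_component_Suc_central[OF L1]
  and span_component_Suc_Suc = span_component_Suc_Suc[OF L1]

lemma y_adpow_q_pred: "y \<star> (q - 1) = v1 \<bullet> x"
proof -
  have "q - 1 = Suc (q - 2)"
    using q_gt_5 by simp
  then show ?thesis
    by (simp add: v1_def adpow_Suc)
qed

lemma y_adpow_q: "y \<star> q = 0"
proof -
  have "q = Suc (q - 1)"
    using q_gt_5 by simp
  then show ?thesis
    using v1xx y_adpow_q_pred adpow_Suc by metis
qed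

lemma g_adpow: "0 < n \<Longrightarrow> g \<star> n = - (2 *s (h \<star> (n - 1)))"
  by (cases n) (simp_all add: adpow_Suc' gx adpow_linear)

text \<open>In characteristic p the map \<open>u \<mapsto> [u x\<^sup>q]\<close> is again a derivation.\<close>

lemma adpow_q_eq_0: "u \<star> q = 0"
proof -
  have "lie_subalgebra {u. u \<star> q = 0}"
    unfolding lie_subalgebra_def
  proof (intro conjI ballI)
    show "subspace {u. u \<star> q = 0}"
      by (auto simp: subspace_def adpow_linear)
    fix u v assume "u \<in> {u. u \<star> q = 0}" "v \<in> {u. u \<star> q = 0}"
    then have uv: "u \<star> q = 0" "v \<star> q = 0"
      by auto
    have "(u \<bullet> v) \<star> q = 0"
      unfolding adpow_br_leibniz
    proof (rule sum.neutral, intro ballI)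
      fix k assume "k \<in> {..q}"
      then consider "k = 0" | "0 < k" "k < q" | "k = q"
        by fastforce
      then show "of_nat (q choose k) *s (u \<star> k \<bullet> (v \<star> (q - k))) = 0"
      proof cases
        case 2
        then have "(of_nat (q choose k) :: 'f) = 0"
          using choose_power_eq_0[of k qe] q_eq by simp
        then show ?thesis
          by simp
      qed (use uv in auto)
    qed
    then show "u \<bullet> v \<in> {u. u \<star> q = 0}"
      by simp
  qed
  moreover have "L 1 \<subseteq> {u. u \<star> q = 0}"
  proof -
    have "x \<star> q = 0"
      using q_gt_5 by (cases q) (simp_all add: adpow_Suc')
    then show ?thesis
      using y_adpow_q unfolding L1 by (auto simp: span_pair adpow_linear)
  qed
  ultimately have "{u. u \<star> q = 0} = UNIV"
    by (rule generated)
  then show ?thesis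
    by auto
qed

lemma component_neq_0: "0 < m \<Longrightarrow> m \<le> 2 * q \<Longrightarrow> L m \<noteq> {0}"
proof -
  have "L (2 * q) \<noteq> {0}"
    using infinite_2 q_gt_5 by (simp add: infinite_type_def)
  then show "0 < m \<Longrightarrow> m \<le> 2 * q \<Longrightarrow> L m \<noteq> {0}"
    using component_neq_0_mono by blast
qed

lemma dim_neq_2: "1 < i \<Longrightarrow> i < q \<Longrightarrow> dim (L i) \<noteq> 2"
  using second_diamond_q by (auto simp: second_diamond_def)

lemma y_adpow_neq_0:
  assumes "i \<le> q - 2"
  shows "y \<star> i \<noteq> 0"
proof
  assume "y \<star> i = 0"
  then have "v1 = 0"
    using adpow_eq_0 assms v1_def by metis
  then have "L (q - 1) = {0}"
    using L_v1 by simp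
  moreover have "L (q - 1) \<noteq> {0}"
    by (rule component_neq_0) (use q_gt_5 in auto)
  ultimately show False
    by simp
qed

text \<open>Of the two spanning products [y x^(i+1)] and [y x^i y] the first is nonzero because
  \<open>v1\<close> is, and independence would create a diamond before degree q.\<close>

lemma L_y_adpow:
  assumes "1 \<le> i" "i \<le> q - 2"
  shows "L (Suc i) = span {y \<star> i}"
  using assms
proof (induction i rule: dec_induct)
  case base
  have xy: "x \<bullet> y = - (y \<bullet> x)"
    by (rule br_anti)
  have "L (Suc 1) = span ((\<lambda>u. u \<bullet> x) ` {x, y} \<union> (\<lambda>u. u \<bullet> y) ` {x, y})"
    by (rule span_component_Suc[OF L1]) simp
  also have "\<dots> = span {y \<bullet> x}"
    using span_neg[OF span_base, of "y \<bullet> x" "{y \<bullet> x}"] xy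
    by (intro equalityI span_minimal subspace_span) (auto intro: span_base span_zero)
  finally show ?case
    by simp
next
  case (step i)
  then have IH: "L (Suc i) = span {y \<star> i}"
    by simp
  have L: "L (Suc (Suc i)) = span {y \<star> Suc i, y \<star> i \<bullet> y}"
    using span_component_Suc_single[OF IH] by (simp add: adpow_Suc)
  have neq: "y \<star> Suc i \<noteq> 0"
    using step by (intro y_adpow_neq_0) auto
  have "y \<star> i \<bullet> y \<in> span {y \<star> Suc i}"
  proof (rule ccontr)
    assume *: "y \<star> i \<bullet> y \<notin> span {y \<star> Suc i}"
    then have "independent {y \<star> i \<bullet> y, y \<star> Suc i}"
      using neq by (simp add: independent_insert)
    moreover have "y \<star> i \<bullet> y \<noteq> y \<star> Suc i"
      using * by (auto intro: span_base)
    ultimately have "dim (span {y \<star> i \<bullet> y, y \<star> Suc i}) = 2"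
      by (subst dim_span_eq_card_independent) auto
    then have "dim (L (Suc (Suc i))) = 2"
      using L by (simp add: insert_commute)
    then show False
      using dim_neq_2[of "Suc (Suc i)"] step by auto
  qed
  then show ?case
    unfolding L by (metis insert_commute span_redundant)
qed

lemma y_adpow_y:
  assumes "1 \<le> i" "i \<le> q - 3"
  shows "\<exists>c. y \<star> i \<bullet> y = c *s (y \<star> Suc i)"
proof -
  have "y \<star> i \<bullet> y \<in> L (Suc (Suc i))"
    using assms L_y_adpow[of i] by (intro br_y_component) (auto intro: span_base)
  then show ?thesis
    using L_y_adpow[of "Suc i"] assms by (auto simp: span_singleton)
qed

section \<open>The segment between the second and the third diamond\<close>

lemma L_Suc_q: "L (q + 1) = span {h}"
proof -
  have "L (Suc (Suc (q - 1))) = span {v1 \<bullet> x \<bullet> x, v1 \<bullet> x \<bullet> y, v1 \<bullet> y \<bullet> x, v1 \<bullet> y \<bullet> y}"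
    using span_component_Suc_Suc[OF L_v1] q_gt_5 by simp
  also have "\<dots> = span {0, h, - (2 *s h), 0}"
    using v1xx gy gx by (simp add: h_def g_def)
  also have "\<dots> = span {h}"
    by (intro equalityI span_minimal subspace_span)
      (auto intro: span_base span_neg span_zero span_scale)
  finally show ?thesis
    using q_gt_5 by simp
qed

lemma L_h_adpow:
  assumes "\<And>i. i < n \<Longrightarrow> h \<star> i \<bullet> y = 0"
  shows "L (q + 1 + n) = span {h \<star> n}"
  using assms
proof (induction n)
  case (Suc n)
  then show ?case
    using span_component_Suc_central[of "q + 1 + n" "h \<star> n"] by (simp add: adpow_Suc)
qed (use L_Suc_q in simp)

lemma h_adpow_neq_0:
  assumes "\<And>i. i < n \<Longrightarrow> h \<star> i \<bullet> y = 0" "n \<le> q - 1"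
  shows "h \<star> n \<noteq> 0"
proof -
  have "L (q + 1 + n) \<noteq> {0}"
    by (rule component_neq_0) (use assms(2) q_gt_5 in auto)
  then show ?thesis
    using L_h_adpow[of n] assms(1) by auto
qed

lemma h_neq_0: "h \<noteq> 0"
  using h_adpow_neq_0[of 0] by simp

text \<open>Structure constants: [[y x^i] [y x^j]] is \<open>K j n\<close> times [h x^(n-1)] when i
  + j = q - 2 + n. One binomial belongs to \<open>g\<close>, the other to \<open>h\<close>; the
  factor 2 is that of [g x] = -2 h.\<close>

definition K :: "nat \<Rightarrow> nat \<Rightarrow> 'f" where
  "K j n = - ((- 1) ^ (j + n)) * (2 * of_nat (j choose n) + of_nat (j choose (n - 1)))"

text \<open>Below exponent q - 2 a product [y x^k y] is a multiple of [y x^(k+1)], and the remaining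
  factors x then raise the exponent to at least q. Only the terms with \<open>g\<close> and
  \<open>h\<close> survive.\<close>

lemma y_adpow_br_y_adpow:
  assumes "i \<le> q - 2" "i + j = q - 2 + n" "1 \<le> n"
  shows "(y \<star> i) \<bullet> (y \<star> j) = K j n *s (h \<star> (n - 1))"
proof -
  have nj: "n \<le> j"
    using assms by linarith
  have q: "2 \<le> q"
    using q_gt_5 by simp
  have zero: "y \<star> i \<star> k \<bullet> y \<star> (j - k) = 0" if "k \<le> j" "k \<noteq> j - n" "k \<noteq> Suc (j - n)" for k
  proof (cases "q \<le> i + k")
    case True
    then show ?thesis
      using adpow_eq_0[OF y_adpow_q] by (simp add: adpow_adpow)
  next
    case False
    then have ik: "i + k \<le> q - 3"
      using that assms nj by linarith
    show ?thesis
    proof (cases "i + k = 0")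
      case True
      then show ?thesis
        by simp
    next
      case False
      then have "1 \<le> i + k"
        by linarith
      then obtain c where "y \<star> (i + k) \<bullet> y = c *s (y \<star> Suc (i + k))"
        using y_adpow_y[OF _ ik] by blast
      moreover have "y \<star> (Suc (i + k) + (j - k)) = 0"
        by (rule adpow_eq_0[OF y_adpow_q]) (use assms that in linarith)
      ultimately show ?thesis
        by (simp add: adpow_adpow adpow_linear)
    qed
  qed
  have i: "i + (j - n) = q - 2" "i + Suc (j - n) = q - 1"
    using assms nj q by linarith+
  have "y \<star> i \<star> (j - n) \<bullet> y = g" "y \<star> i \<star> Suc (j - n) \<bullet> y = h"
    unfolding adpow_adpow i y_adpow_q_pred g_def h_def v1_def by (rule refl)+
  moreover have "j - (j - n) = n" "j - Suc (j - n) = n - 1" "j - n < j"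
    using nj assms by auto
  moreover have "j choose (j - n) = j choose n" "j choose Suc (j - n) = j choose (n - 1)"
    using binomial_symmetric[OF nj] binomial_symmetric[of "n - 1" j] nj assms by (auto simp: Suc_diff_le)
  moreover have "(- 1 :: 'f) ^ (j - n) = (- 1) ^ (j + n)"
    using nj by (cases "even (j - n)"; cases "even (j + n)") auto
  ultimately have "(y \<star> i) \<bullet> (y \<star> j) = ((- 1) ^ (j + n) * of_nat (j choose n)) *s (g \<star> n)
      - ((- 1) ^ (j + n) * of_nat (j choose (n - 1))) *s (h \<star> (n - 1))"
    using br_adpow_pair[of "j - n" j "y \<star> i" y] zero by simp
  also have "\<dots> = K j n *s (h \<star> (n - 1))"
    using assms(3) by (simp add: g_adpow K_def algebra_simps)
  finally show ?thesis .
qed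

text \<open>Bracket \<open>y_adpow_br_y_adpow\<close> with y; Leibniz' rule raises one of the two
  exponents at a time.\<close>

lemma K_relation:
  assumes "1 \<le> i" "i \<le> q - 3" "1 \<le> j" "j \<le> q - 3" "i + j = q - 2 + n" "1 \<le> n"
    and "y \<star> i \<bullet> y = ci *s (y \<star> Suc i)" "y \<star> j \<bullet> y = cj *s (y \<star> Suc j)"
  shows "K j n *s (h \<star> (n - 1) \<bullet> y) = (ci * K j (Suc n) + cj * K (Suc j) (Suc n)) *s (h \<star> n)"
proof -
  have "(y \<star> i) \<bullet> (y \<star> j) \<bullet> y = y \<star> i \<bullet> y \<bullet> (y \<star> j) + (y \<star> i) \<bullet> (y \<star> j \<bullet> y)"
    by (rule br_br_left)
  also have "y \<star> i \<bullet> y \<bullet> (y \<star> j) = (ci * K j (Suc n)) *s (h \<star> n)"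
    using y_adpow_br_y_adpow[of "Suc i" j "Suc n"] assms q_gt_5 by (simp add: br_linear_simps)
  also have "(y \<star> i) \<bullet> (y \<star> j \<bullet> y) = (cj * K (Suc j) (Suc n)) *s (h \<star> n)"
    using y_adpow_br_y_adpow[of i "Suc j" "Suc n"] assms q_gt_5 by (simp add: br_linear_simps)
  also have "(y \<star> i) \<bullet> (y \<star> j) \<bullet> y = K j n *s (h \<star> (n - 1) \<bullet> y)"
    using y_adpow_br_y_adpow[of i j n] assms q_gt_5 by (simp add: br_linear_simps)
  finally show ?thesis
    by (simp add: algebra_simps)
qed

text \<open>Evaluate [v1 [y x^n] y] by expanding the inner bracket, and again as [g [y x^n]], which
  is legitimate because y commutes with [y x^n].\<close>

lemma h_adpow_y_relation:
  assumes "1 \<le> n" "y \<star> n \<bullet> y = 0" "\<And>s. s < n - 1 \<Longrightarrow> h \<star> s \<bullet> y = 0"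
  shows "(of_nat n + 2 - 2 * (- 1) ^ n) *s (h \<star> (n - 1) \<bullet> y) = 0"
proof -
  have "v1 \<star> k = 0" if "2 \<le> k" for k
    using v1xx adpow_eq_0[of v1 2 k] that by (simp add: adpow_2)
  then have "v1 \<bullet> (y \<star> n) = g \<star> n - of_nat n *s (h \<star> (n - 1))"
    using br_adpow_pair[of 0 n v1 y] assms(1) by (simp add: g_def h_def)
  also have "\<dots> = - ((of_nat n + 2) *s (h \<star> (n - 1)))"
    using assms(1) by (simp add: g_adpow algebra_simps)
  finally have "v1 \<bullet> (y \<star> n) \<bullet> y = - ((of_nat n + 2) *s (h \<star> (n - 1) \<bullet> y))"
    by (simp add: br_linear_simps)
  moreover have "v1 \<bullet> (y \<star> n) \<bullet> y = g \<bullet> (y \<star> n)"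
    using br_br_left[of v1 "y \<star> n" y] assms(2) by (simp add: g_def)
  moreover have "g \<bullet> (y \<star> n) = ((- 1) ^ n) *s (g \<star> n \<bullet> y)"
  proof -
    have "g \<star> k \<bullet> y = 0" if "k \<le> n" "k \<noteq> n" for k
      using assms(3)[of "k - 1"] that gy by (cases "k = 0") (simp_all add: g_adpow br_linear_simps)
    then show ?thesis
      using br_adpow_single[of n n g y] by simp
  qed
  moreover have "g \<star> n \<bullet> y = - (2 *s (h \<star> (n - 1) \<bullet> y))"
    using assms(1) by (simp add: g_adpow br_linear_simps)
  ultimately have "(of_nat n + 2) *s (h \<star> (n - 1) \<bullet> y) = (2 * (- 1) ^ n) *s (h \<star> (n - 1) \<bullet> y)"
    by (auto simp: mult.commute)
  then show ?thesis
    by (simp add: algebra_simps)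
qed

text \<open>This is the pair with i = q - 3. It is useless for n = -4 modulo p, for which
  \<open>K_Suc_Suc\<close> supplies the pair with i = q - 4.\<close>

lemma K_Suc: "2 * K (Suc n) n = (of_nat n + 1) * (of_nat n + 4)" if "1 \<le> n"
proof -
  have "Suc n choose (n - 1) = Suc n choose 2"
    using binomial_symmetric[of "n - 1" "Suc n"] that by (simp add: Suc_diff_le numeral_2_eq_2)
  moreover have "2 * K (Suc n) n = 4 * (of_nat n + 1) + 2 * of_nat (Suc n choose (n - 1))"
    by (simp add: K_def algebra_simps)
  ultimately have "2 * K (Suc n) n = 4 * (of_nat n + 1) + of_nat (Suc n) * (of_nat (Suc n) - 1)"
    using of_nat_choose_two[of "Suc n"] by simp
  then show ?thesis
    by (simp add: algebra_simps)
qed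

lemma K_Suc_Suc: "6 * K (Suc (Suc n)) n = - ((of_nat n + 1) * (of_nat n + 2) * (of_nat n + 6))"
  if "1 \<le> n"
proof -
  have "Suc (Suc n) choose (n - 1) = Suc (Suc n) choose 3" "Suc (Suc n) choose n = Suc (Suc n) choose 2"
    using binomial_symmetric[of "n - 1" "Suc (Suc n)"] binomial_symmetric[of n "Suc (Suc n)"] that
    by (simp_all add: Suc_diff_le numeral_2_eq_2 numeral_3_eq_3)
  then have "6 * K (Suc (Suc n)) n
      = - (6 * (2 * of_nat (Suc (Suc n) choose 2)) + 6 * of_nat (Suc (Suc n) choose 3))"
    by (simp add: K_def algebra_simps)
  then show ?thesis
    unfolding of_nat_choose_two of_nat_choose_three by (simp add: algebra_simps)
qed

text \<open>If the product is nonzero, \<open>h_adpow_y_relation\<close> leaves n = 0 or n = -4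
  modulo p, where \<open>K_Suc\<close> and \<open>K_Suc_Suc\<close> respectively are nonzero. For n
  = q - 4 the latter would need j = q - 2, which is out of range.\<close>

lemma h_adpow_y_step:
  assumes n: "1 \<le> n" "n \<le> q - 3" "n \<noteq> q - 4"
    and zero: "y \<star> n \<bullet> y = 0" "\<And>s. s < n - 1 \<Longrightarrow> h \<star> s \<bullet> y = 0"
    and c1: "n \<le> q - 4 \<Longrightarrow> y \<star> Suc n \<bullet> y = 0 \<and> y \<star> (q - 3) \<bullet> y = 0"
    and c2: "n \<le> q - 5 \<Longrightarrow> y \<star> Suc (Suc n) \<bullet> y = 0 \<and> y \<star> (q - 4) \<bullet> y = 0"
  shows "h \<star> (n - 1) \<bullet> y = 0"
proof (rule ccontr)
  assume neq: "h \<star> (n - 1) \<bullet> y \<noteq> 0"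
  have Kzero: "K j n = 0" if "1 \<le> i" "i \<le> q - 3" "1 \<le> j" "j \<le> q - 3" "i + j = q - 2 + n"
    "y \<star> i \<bullet> y = 0" "y \<star> j \<bullet> y = 0" for i j
    using K_relation[of i j n 0 0] that n neq by simp
  have cases: "(of_nat n :: 'f) = 0 \<or> of_nat n = (- 4 :: 'f)"
  proof -
    have "of_nat n + 2 - 2 * (- 1) ^ n = (0 :: 'f)"
      using h_adpow_y_relation[OF n(1) zero] neq by simp
    then show ?thesis
      by (cases "even n") (auto simp: algebra_simps eq_neg_iff_add_eq_0)
  qed
  have "n \<noteq> q - 3"
  proof
    assume "n = q - 3"
    then have "(of_nat n :: 'f) = - 3"
      using of_nat_q_diff[of 3] q_gt_5 by simp
    moreover have "(4::'f) \<noteq> 3"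
      using add_cancel_right_right[of "3::'f" 1] by simp
    ultimately show False
      using cases by auto
  qed
  then have n5: "n \<le> q - 5"
    using n by linarith
  show False
  proof (cases "(of_nat n :: 'f) = 0")
    case True
    have "K (Suc n) n = 0"
      by (rule Kzero[of "q - 3"]) (use n5 n q_ge_7 c1 in auto)
    then show False
      using K_Suc[OF n(1)] True by simp
  next
    case False
    then have "(of_nat n :: 'f) = - 4"
      using cases by simp
    moreover have "K (Suc (Suc n)) n = 0"
      by (rule Kzero[of "q - 4"]) (use n5 n q_ge_7 c2 in auto)
    ultimately show False
      using K_Suc_Suc[OF n(1)] by simp
  qed
qed

text \<open>
  The relations \<open>K_relation\<close> are linear in the coefficients \<open>c\<^sub>i\<close> with \<open>[y x\<^sup>i y] = c\<^sub>i [y x\<^sup>i\<^sup>+\<^sup>1]\<close>, and the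
  smallest \<open>r\<close> with \<open>c\<^sub>r \<noteq> 0\<close> satisfies \<open>r \<equiv> -1 (mod p)\<close>. If \<open>P\<close> is the highest power of p dividing
  \<open>r + 1\<close>, the relation with \<open>n = P - 1\<close> and \<open>j = r\<close> has only the term in \<open>c\<^sub>r\<close>.
\<close>

lemma y_adpow_y_eq_0_aux:
  assumes r: "1 \<le> r" "r \<le> q - 3" and zero: "\<And>i. 1 \<le> i \<Longrightarrow> i < r \<Longrightarrow> y \<star> i \<bullet> y = 0"
  shows "y \<star> r \<bullet> y = 0"
proof (rule ccontr)
  assume neq: "y \<star> r \<bullet> y \<noteq> 0"
  obtain c where c: "y \<star> r \<bullet> y = c *s (y \<star> Suc r)"
    using y_adpow_y[OF r] by blast
  have c0: "c \<noteq> 0"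
    using neq c by auto
  \<comment> \<open>For r = 2 j, expanding [u u] = 0 with u = [y x^j] leaves only [y x^r y] up to
    sign.\<close>
  have "odd r"
  proof
    assume "even r"
    then obtain j where j: "r = 2 * j"
      by auto
    have "(y \<star> j) \<bullet> (y \<star> j) = (- 1) ^ j *s (y \<star> r \<bullet> y)"
      using br_adpow_single[of j j "y \<star> j" y] zero j r
      by (auto simp: adpow_adpow mult_2)
    then have "(- 1) ^ j *s (y \<star> r \<bullet> y) = 0"
      by simp
    then show False
      using neq by simp
  qed
  then have r4: "r \<le> q - 4"
    using r odd_q by (cases "r = q - 3") auto
  have r3: "3 \<le> r"
    using \<open>odd r\<close> r neq yxy by (cases "r = 1") (auto elim: oddE)
  have Suc_r: "y \<star> Suc r \<bullet> y = 0"
  proof -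
    have "y \<star> 1 \<bullet> (y \<star> (r - 1)) = (- 1) ^ (r - 1) *s (y \<star> r \<bullet> y)"
      using br_adpow_single[of "r - 1" "r - 1" "y \<star> 1" y] zero r3
      by (simp add: adpow_Suc'[symmetric])
    moreover have "y \<star> 1 \<bullet> (y \<star> (r - 1)) \<bullet> y = 0"
      using br_br_left[of "y \<star> 1" "y \<star> (r - 1)" y] zero[of 1] zero[of "r - 1"] r3 by simp
    ultimately show ?thesis
      using c c0 by (simp add: br_linear_simps)
  qed
  \<comment> \<open>The same trick with u = [y x^j], where now 2 j = r + 1, shows that j c =
    0.\<close>
  have dvd: "p dvd Suc r"
  proof -
    obtain j where j: "Suc r = 2 * j"
      using \<open>odd r\<close> by (metis dvd_def even_Suc)
    have j2: "2 \<le> j"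
      using j r3 by linarith
    have sum: "j + (j - 1) = r" "j + j = Suc r"
      using j j2 by linarith+
    have "(y \<star> j) \<bullet> (y \<star> j) = ((- 1) ^ (j - 1) * of_nat (j choose (j - 1))) *s (y \<star> r \<bullet> y \<star> (j - (j - 1)))
        - ((- 1) ^ (j - 1) * of_nat (j choose j)) *s (y \<star> Suc r \<bullet> y \<star> (j - j))"
      using br_adpow_pair[of "j - 1" j "y \<star> j" y] zero j2 sum
      by (auto simp: adpow_adpow)
    also have "\<dots> = ((- 1) ^ (j - 1) * of_nat j * c) *s (y \<star> Suc (Suc r))"
      using Suc_r c j2 binomial_symmetric[of "j - 1" j] by (simp add: adpow_linear adpow_Suc br_linear_simps)
    finally have "((- 1) ^ (j - 1) * of_nat j * c) *s (y \<star> Suc (Suc r)) = 0"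
      by simp
    moreover have "y \<star> Suc (Suc r) \<noteq> 0"
      by (rule y_adpow_neq_0) (use r4 q_ge_7 in linarith)
    ultimately have "(of_nat j :: 'f) = 0"
      using c0 by auto
    then show ?thesis
      unfolding j by (simp add: of_nat_eq_0)
  qed
  define t where "t = multiplicity p (Suc r)"
  define P where "P = p ^ t"
  have "P = p ^ multiplicity p (Suc r)"
    by (simp only: P_def t_def)
  then obtain m where P: "Suc r = P * m" and m: "(of_nat m :: 'f) \<noteq> 0"
    and pP: "p dvd P" and P5: "5 \<le> P" and "odd P"
    using multiplicity_power_facts[OF dvd] by blast
  then have "even m"
    using P \<open>odd r\<close> by (metis even_Suc even_mult_iff)
  moreover have "m \<noteq> 0"
    using P by (metis mult_0_right Suc_not_Zero)
  ultimately have m2: "2 \<le> m"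
    by auto
  then have rP: "2 * P - 1 \<le> r"
    using P mult_le_mono2[of 2 m P] by linarith
  \<comment> \<open>Two evaluations of [y x^(q-3) [y x] y] give d = -3 d. In the next step [y x x]
    takes the place of [y x] and the outcome is d = 5 d.\<close>
  have c_q3: "y \<star> (q - 3) \<bullet> y = 0"
  proof -
    obtain d where d: "y \<star> (q - 3) \<bullet> y = d *s (y \<star> Suc (q - 3))"
      using y_adpow_y[of "q - 3"] q_ge_7 by fastforce
    have *: "Suc (q - 3) = q - 2"
      using q_ge_7 by simp
    let ?z = "y \<star> (q - 3)"
    have zx: "?z \<bullet> x = v1"
      using adpow_Suc[of y "q - 3"] by (simp add: * v1_def)
    have zy: "?z \<bullet> y = d *s v1"
      using d by (simp add: * v1_def)
    have "?z \<bullet> (y \<bullet> x) = d *s (v1 \<bullet> x) - g"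
      by (simp add: br_br_right zx zy br_linear_simps g_def)
    then have "?z \<bullet> (y \<bullet> x) \<bullet> y = d *s h"
      by (simp add: br_linear_simps h_def gy)
    moreover have "?z \<bullet> (y \<bullet> x) \<bullet> y = d *s (v1 \<bullet> (y \<bullet> x))"
      using br_br_left[of ?z "y \<bullet> x" y] yxy zy by (simp add: br_linear_simps)
    moreover have "v1 \<bullet> (y \<bullet> x) = - (3 *s h)"
      using gx scale_left_distrib[of 2 1 h] by (simp add: br_br_right g_def h_def)
    ultimately have "d *s h = - ((d * 3) *s h)"
      by (simp add: br_linear_simps)
    then have "(d + d * 3) *s h = 0"
      unfolding scale_left_distrib by (simp add: add_eq_0_iff)
    then have "d * 4 = 0"
      using h_neq_0 by simp
    then show ?thesis
      using zy by simp
  qed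
  have c_q4: "y \<star> (q - 4) \<bullet> y = 0"
  proof -
    obtain d where d: "y \<star> (q - 4) \<bullet> y = d *s (y \<star> Suc (q - 4))"
      using y_adpow_y[of "q - 4"] q_ge_7 by fastforce
    have *: "Suc (q - 4) = q - 3" "Suc (q - 3) = q - 2"
      using q_ge_7 by simp_all
    let ?z = "y \<star> (q - 4)"
    have zx: "?z \<bullet> x = y \<star> (q - 3)"
      using adpow_Suc[of y "q - 4"] by (simp add: *)
    have zxx: "y \<star> (q - 3) \<bullet> x = v1"
      using adpow_Suc[of y "q - 3"] by (simp add: * v1_def)
    have zy: "?z \<bullet> y = d *s (y \<star> (q - 3))"
      using d by (simp add: *)
    have y2: "y \<bullet> x \<bullet> x \<bullet> y = 0"
      using zero[of 2] r3 by (simp add: adpow_2)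
    have "?z \<bullet> (y \<bullet> x \<bullet> x) = d *s (v1 \<bullet> x) + g"
      by (simp add: br_br_right zx zxx zy c_q3 br_linear_simps g_def)
    then have "?z \<bullet> (y \<bullet> x \<bullet> x) \<bullet> y = d *s h"
      by (simp add: br_linear_simps h_def gy)
    moreover have "?z \<bullet> (y \<bullet> x \<bullet> x) \<bullet> y = d *s (y \<star> (q - 3) \<bullet> (y \<bullet> x \<bullet> x))"
      using br_br_left[of ?z "y \<bullet> x \<bullet> x" y] y2 zy by (simp add: br_linear_simps)
    moreover have "y \<star> (q - 3) \<bullet> (y \<bullet> x \<bullet> x) = 5 *s h"
    proof -
      have "v1 \<bullet> y \<bullet> x = - (2 *s h)"
        using gx by (simp add: g_def)
      then have "y \<star> (q - 3) \<bullet> (y \<bullet> x \<bullet> x) = 2 *s h + (2 *s h + h)"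
        by (simp add: br_br_right zxx c_q3 h_def br_linear_simps)
      also have "\<dots> = 5 *s h"
        using scale_left_distrib[of 2 "2 + 1" h] scale_left_distrib[of 2 1 h] by simp
      finally show ?thesis .
    qed
    ultimately have "d *s h = (5 * d) *s h"
      by (simp add: mult.commute)
    then have "(5 * d - d) *s h = 0"
      by (simp only: scale_left_diff_distrib) simp
    moreover have "5 * d - d = 4 * d"
      by (simp add: algebra_simps)
    ultimately have "d = 0"
      using h_neq_0 by simp
    then show ?thesis
      using zy by simp
  qed
  \<comment> \<open>The constants 5 and -7 may vanish for p = 5 or p = 7, but their sum is
    -2.\<close>
  have hy: "h \<bullet> y = 0"
  proof -
    have "K 2 1 *s (h \<star> (1 - 1) \<bullet> y) = (0 * K 2 (Suc 1) + 0 * K (Suc 2) (Suc 1)) *s (h \<star> 1)"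
      by (rule K_relation[of "q - 3"]) (use q_ge_7 zero[of 2] c_q3 r3 in auto)
    moreover have "K 3 1 *s (h \<star> (1 - 1) \<bullet> y) = (0 * K 3 (Suc 1) + 0 * K (Suc 3) (Suc 1)) *s (h \<star> 1)"
      by (rule K_relation[of "q - 4"]) (use q_ge_7 zero[of 3] c_q4 rP P5 in auto)
    ultimately have "K 2 1 *s (h \<bullet> y) = 0" "K 3 1 *s (h \<bullet> y) = 0"
      by simp_all
    moreover have "K 2 1 = 5" "K 3 1 = - 7"
      by (simp_all add: K_def)
    ultimately have "(7 - 5) *s (h \<bullet> y) = 0"
      by (simp only: scale_left_diff_distrib) simp
    then show ?thesis
      by simp
  qed
  \<comment> \<open>\<open>K_relation\<close> for n = 1, where the left side vanishes by
    \<open>hy\<close> and \<open>K j 2\<close> is j^2 up to sign.\<close>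
  have c_sym: "y \<star> (q - 1 - j) \<bullet> y = 0" if j: "2 \<le> j" "j < r" "\<not> p dvd j" for j
  proof -
    have j': "1 \<le> q - 1 - j" "q - 1 - j \<le> q - 3" "j \<le> q - 3"
      using j r4 q_ge_7 by linarith+
    obtain d where d: "y \<star> (q - 1 - j) \<bullet> y = d *s (y \<star> Suc (q - 1 - j))"
      using y_adpow_y[OF j'(1,2)] by blast
    have "K j 1 *s (h \<star> (1 - 1) \<bullet> y) = (d * K j (Suc 1) + 0 * K (Suc j) (Suc 1)) *s (h \<star> 1)"
      by (rule K_relation[of "q - 1 - j"]) (use j j' q_ge_7 zero[of j] d in auto)
    then have "(d * K j 2) *s (h \<bullet> x) = 0"
      using hy by (simp add: numeral_2_eq_2)
    moreover have "h \<bullet> x \<noteq> 0"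
      using h_adpow_neq_0[of 1] hy q_ge_7 by simp
    moreover have "K j 2 \<noteq> 0"
    proof -
      have "K j 2 = - ((- 1) ^ (j + 2) * (of_nat j * of_nat j))"
        unfolding K_def of_nat_choose_two by (simp add: algebra_simps)
      then show ?thesis
        using j by (simp add: of_nat_eq_0)
    qed
    ultimately show ?thesis
      using d by simp
  qed
  have h_central: "h \<star> (n - 1) \<bullet> y = 0" if "1 \<le> n" "n \<le> P - 1" for n
    using that
  proof (induction n rule: less_induct)
    case (less n)
    have n: "Suc (Suc n) < r"
      using less.prems rP P5 by linarith
    show ?case
    proof (rule h_adpow_y_step)
      show "h \<star> s \<bullet> y = 0" if "s < n - 1" for s
        using less.IH[of "Suc s"] less.prems that by simp
    qed (use n less.prems r4 zero c_q3 c_q4 in auto)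
  qed
  \<comment> \<open>Chosen so that the exponents q - 1 - b and r add up to q - 2 + (P - 1). As b = 1
    modulo p, \<open>c_sym\<close> applies to it.\<close>
  let ?b = "r + 2 - P"
  have b: "2 \<le> ?b" "?b < r" "\<not> p dvd ?b"
  proof -
    show "2 \<le> ?b" "?b < r"
      using rP P5 by linarith+
    have "?b = Suc r - P + 1"
      using rP P5 by linarith
    moreover have "p dvd Suc r - P"
      using dvd pP by (rule dvd_diff_nat)
    moreover have "\<not> p dvd 1"
      using prime_p not_prime_unit by blast
    ultimately show "\<not> p dvd ?b"
      using dvd_add_right_iff by metis
  qed
  have "K r (P - 1) *s (h \<star> (P - 1 - 1) \<bullet> y)
      = (0 * K r (Suc (P - 1)) + c * K (Suc r) (Suc (P - 1))) *s (h \<star> (P - 1))"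
    by (rule K_relation[of "q - 1 - ?b"]) (use c c_sym[OF b] r4 r rP P5 b q_ge_7 in auto)
  then have "(c * K (Suc r) P) *s (h \<star> (P - 1)) = 0"
    using h_central[of "P - 1"] P5 by simp
  moreover have "h \<star> (P - 1) \<noteq> 0"
  proof (rule h_adpow_neq_0)
    show "h \<star> i \<bullet> y = 0" if "i < P - 1" for i
      using h_central[of "Suc i"] that by simp
    show "P - 1 \<le> q - 1"
      using rP r by linarith
  qed
  moreover have "K (Suc r) P = - ((- 1) ^ (Suc r + P) * (2 * of_nat m))"
  proof -
    have "(of_nat (Suc r choose P) :: 'f) = of_nat m"
      using choose_mult_power[of 0 t m] P prime_gt_0_nat[OF prime_p] by (simp add: P_def)
    moreover have "(of_nat (Suc r choose (P - 1)) :: 'f) = 0"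
      using choose_add_mult_power[of "P - 1" t m 0] P P5 prime_gt_0_nat[OF prime_p]
      by (simp add: P_def binomial_eq_0)
    ultimately show ?thesis
      by (simp add: K_def)
  qed
  ultimately show False
    using c0 m by simp
qed

lemma y_adpow_y_eq_0: "1 \<le> i \<Longrightarrow> i \<le> q - 3 \<Longrightarrow> y \<star> i \<bullet> y = 0"
proof (induction i rule: less_induct)
  case (less i)
  show ?case
    by (rule y_adpow_y_eq_0_aux[OF less.prems]) (use less in simp)
qed

lemma br_y_adpow_y: "z \<bullet> y = 0 \<Longrightarrow> 1 \<le> i \<Longrightarrow> i \<le> q - 3 \<Longrightarrow> z \<bullet> (y \<star> i) \<bullet> y = 0"
  using br_br_left[of z "y \<star> i" y] y_adpow_y_eq_0[of i] by simp

text \<open>With w = [z x x], brackets with [y x], [y x x] and [y x x x], which commute with y, give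
  [w y y] = 0 and show [w x y y] to be both twice and three times [w y x y].\<close>

lemma after_two_central:
  assumes "z \<bullet> y = 0" "z \<bullet> x \<bullet> y = 0"
  shows "z \<bullet> x \<bullet> x \<bullet> y \<bullet> y = 0" "z \<bullet> x \<bullet> x \<bullet> y \<bullet> x \<bullet> y = 0" "z \<bullet> x \<bullet> x \<bullet> x \<bullet> y \<bullet> y = 0"
proof -
  let ?w = "z \<bullet> x \<bullet> x"
  have q: "3 \<le> q - 3"
    using q_ge_7 by simp
  have "z \<bullet> x \<bullet> (y \<star> 1) \<bullet> y = 0" "z \<bullet> x \<bullet> (y \<star> 2) \<bullet> y = 0" "z \<bullet> (y \<star> 3) \<bullet> y = 0"
    using br_y_adpow_y[of "z \<bullet> x" 1] br_y_adpow_y[of "z \<bullet> x" 2] br_y_adpow_y[of z 3] assms q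
    by auto
  then have *: "z \<bullet> x \<bullet> (y \<bullet> x) \<bullet> y = 0" "z \<bullet> x \<bullet> (y \<bullet> x \<bullet> x) \<bullet> y = 0"
    "z \<bullet> (y \<bullet> x \<bullet> x \<bullet> x) \<bullet> y = 0"
    by (simp_all add: numeral_2_eq_2 numeral_3_eq_3 adpow_Suc)
  show "?w \<bullet> y \<bullet> y = 0"
    using *(1) assms by (simp add: br_br_right br_linear_simps)
  have "?w \<bullet> x \<bullet> y \<bullet> y = ?w \<bullet> y \<bullet> x \<bullet> y + ?w \<bullet> y \<bullet> x \<bullet> y"
    using *(2) assms by (simp add: br_br_right br_linear_simps algebra_simps)
  moreover have "?w \<bullet> x \<bullet> y \<bullet> y = ?w \<bullet> y \<bullet> x \<bullet> y + ?w \<bullet> y \<bullet> x \<bullet> y + ?w \<bullet> y \<bullet> x \<bullet> y"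
    using *(3) assms by (simp add: br_br_right br_linear_simps algebra_simps)
  ultimately show "?w \<bullet> y \<bullet> x \<bullet> y = 0" "?w \<bullet> x \<bullet> y \<bullet> y = 0"
    by simp_all
qed

lemma dim_span_single_neq_2: "dim (span {u}) \<noteq> 2"
proof -
  have "dim (span {u}) \<le> card {u}"
    by (simp add: dim_le_card' del: card_insert_disjoint)
  then show ?thesis
    by simp
qed

lemma dim_third: "dim (L (2 * q - 1)) = 2"
  using infinite_2 by (simp add: infinite_type_def)

lemma h_adpow_y: "s < q - 3 \<Longrightarrow> h \<star> s \<bullet> y = 0"
proof (induction s rule: less_induct)
  case (less s)
  show ?case
  proof (cases "s = q - 5")
    case False
    have "h \<star> (Suc s - 1) \<bullet> y = 0"
      by (rule h_adpow_y_step) (use False less q_ge_7 y_adpow_y_eq_0 in auto)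
    then show ?thesis
      by simp
  next
    case True
    \<comment> \<open>In the case left out by \<open>h_adpow_y_step\<close>, a nonzero [h x^(q-5) y]
      would by covering make \<open>L (2 * q - 1)\<close> the span of a single element, contrary to
      the third diamond.\<close>
    define z where "z = h \<star> s"
    define z' where "z' = h \<star> (s - 2)"
    have s: "s = Suc (Suc (s - 2))"
      using True q_ge_7 by simp
    then have z: "z = z' \<bullet> x \<bullet> x"
      unfolding z_def z'_def using adpow_Suc by metis
    have "h \<star> (s - 2) \<bullet> y = 0" "h \<star> Suc (s - 2) \<bullet> y = 0"
      using less.IH[of "s - 2"] less.IH[of "Suc (s - 2)"] s less.prems by linarith+
    then have "z' \<bullet> y = 0" "z' \<bullet> x \<bullet> y = 0"
      by (simp_all add: z'_def adpow_Suc)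
    then have zyy: "z \<bullet> y \<bullet> y = 0" "z \<bullet> y \<bullet> x \<bullet> y = 0"
      unfolding z using after_two_central by blast+
    have "L (q + 1 + s) = span {z}"
      unfolding z_def by (rule L_h_adpow) (use less in auto)
    then have zy: "z \<bullet> y \<in> L (q + 2 + s)"
      using br_y_component[of z "q + 1 + s"] by (auto intro: span_base)
    show ?thesis
    proof (rule ccontr)
      assume "h \<star> s \<bullet> y \<noteq> 0"
      then have "L (Suc (q + 2 + s)) = span {z \<bullet> y \<bullet> x, z \<bullet> y \<bullet> y}"
        using covering_span[OF zy] by (simp add: z_def)
      then have "L (Suc (q + 2 + s)) = span {z \<bullet> y \<bullet> x}"
        using zyy(1) by (simp add: insert_commute[of _ 0] span_insert_0)
      then have "L (Suc (Suc (q + 2 + s))) = span {z \<bullet> y \<bullet> x \<bullet> x}"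
        using span_component_Suc_central zyy(2) by simp
      moreover have "Suc (Suc (q + 2 + s)) = 2 * q - 1"
        using True q_ge_7 by simp
      ultimately show False
        using dim_third dim_span_single_neq_2 by metis
    qed
  qed
qed

section \<open>Diamonds of infinite type\<close>

text \<open>Meant for e = [w x y], two degrees above the component just below a diamond. Then
  [e x^(q-3)] lies just below the next diamond, where y may act nontrivially; hence the
  bound.\<close>

definition central :: "'a \<Rightarrow> bool" where
  "central e \<longleftrightarrow> (\<forall>i<q - 3. e \<star> i \<bullet> y = 0)"

lemma centralD: "central e \<Longrightarrow> i < q - 3 \<Longrightarrow> e \<star> i \<bullet> y = 0"
  by (simp add: central_def)

definition nxt :: "'a \<Rightarrow> 'a" where
  "nxt w = w \<bullet> x \<bullet> y \<star> (q - 3)"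

text \<open>
  For \<open>w\<close> spanning the component just below a diamond: the diamond has infinite type, and \<open>y\<close>
  centralizes the components up to the one preceding the next diamond, which is spanned by
  \<open>nxt w\<close>.
\<close>

definition infinite :: "'a \<Rightarrow> bool" where
  "infinite w \<longleftrightarrow> w \<bullet> x \<bullet> x = 0 \<and> w \<bullet> y \<bullet> y = 0 \<and> w \<bullet> y \<bullet> x = - (w \<bullet> x \<bullet> y) \<and> central (w \<bullet> x \<bullet> y)"

lemma q_diff: "q - 2 = Suc (q - 3)" "q - 1 = Suc (Suc (q - 3))"
  using q_ge_7 by simp_all

lemma central_h: "central h"
  using h_adpow_y by (simp add: central_def)

lemma L_central:
  assumes "central e" "L m = span {e}" "1 \<le> m" "i \<le> q - 3"
  shows "L (m + i) = span {e \<star> i}"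
  using assms(4)
proof (induction i)
  case (Suc i)
  then show ?case
    using span_component_Suc_central[of "m + i" "e \<star> i"] assms centralD[of e i]
    by (simp add: adpow_Suc)
qed (use assms in simp)

section \<open>Brackets with \<open>v1\<close> and the propagation of infinite type\<close>

lemma adpow_zero_ge: "w \<bullet> x \<bullet> x = 0 \<Longrightarrow> 2 \<le> k \<Longrightarrow> w \<star> k = 0"
  using adpow_eq_0[of w 2 k] by (simp add: adpow_2)

text \<open>The signs of \<open>br_adpow\<close> cancel those of the row q - 2 of Pascal's triangle
  modulo p, so the coefficients in a bracket with \<open>v1\<close> are 1, 2, 3, ...\<close>

lemma coeff_v1: "m \<le> q - 2 \<Longrightarrow> (- 1) ^ m * of_nat (q - 2 choose m) = (of_nat (m + 1) :: 'f)"
  using choose_pred_pred_power[of m qe] q_eq q_ge_7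
  by (simp add: mult.assoc[symmetric] power_add[symmetric] mult_2[symmetric])

lemma coeff_y_adpow_q_pred: "k \<le> q - 1 \<Longrightarrow> (- 1) ^ k * of_nat (q - 1 choose k) = (1 :: 'f)"
  using choose_pred_power[of k qe] q_eq q_ge_7
  by (simp add: power_add[symmetric] mult_2[symmetric])

lemma br_v1_single:
  assumes "m \<le> q - 2" "\<And>k. k \<le> q - 2 \<Longrightarrow> k \<noteq> m \<Longrightarrow> z \<star> k \<bullet> y = 0"
  shows "z \<bullet> v1 = of_nat (m + 1) *s (z \<star> m \<bullet> y \<star> (q - 2 - m))"
  using br_adpow_single[of m "q - 2" z y] assms coeff_v1[OF assms(1)] by (simp add: v1_def)

lemma br_v1_pair:
  assumes "m < q - 2" "\<And>k. k \<le> q - 2 \<Longrightarrow> k \<noteq> m \<Longrightarrow> k \<noteq> Suc m \<Longrightarrow> z \<star> k \<bullet> y = 0"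
  shows "z \<bullet> v1 = of_nat (m + 1) *s (z \<star> m \<bullet> y \<star> (q - 2 - m))
    + of_nat (m + 2) *s (z \<star> Suc m \<bullet> y \<star> (q - 3 - m))"
proof -
  have "(- 1) ^ m * of_nat (q - 2 choose Suc m) = (- of_nat (m + 2) :: 'f)"
    using coeff_v1[of "Suc m"] assms(1) by (simp add: neg_eq_iff_add_eq_0 eq_neg_iff_add_eq_0 add_eq_0_iff)
  moreover have "(- 1) ^ m * of_nat (q - 2 choose m) = (of_nat (m + 1) :: 'f)"
    using coeff_v1[of m] assms(1) by simp
  moreover have "q - 2 - Suc m = q - 3 - m"
    by simp
  ultimately show ?thesis
    using br_adpow_pair[of m "q - 2" z y] assms
    by (simp add: v1_def del: of_nat_add of_nat_Suc add_2_eq_Suc')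
qed

text \<open>Only the terms that reach w and [w x] survive: earlier ones are centralized by y, later
  ones contain [w x x]. Their coefficients are q - (i + 2) and q - (i + 1), reduced modulo
  p.\<close>

lemma chain_br_v1:
  assumes "central e" "w = e \<star> (q - 3)" "i \<le> q - 3" "i = 0 \<or> w \<bullet> x \<bullet> x = 0"
  shows "e \<star> i \<bullet> v1
    = - (of_nat (i + 2) *s (w \<bullet> y \<star> Suc i)) - of_nat (i + 1) *s (w \<bullet> x \<bullet> y \<star> i)"
proof -
  let ?m = "q - 3 - i"
  have m: "i + ?m = q - 3" "i + Suc ?m = Suc (q - 3)" "?m < q - 2" "q - 2 - ?m = Suc i" "q - 3 - ?m = i"
    "?m + 1 = q - (i + 2)" "?m + 2 = q - (i + 1)"
    using assms(3) q_ge_7 by auto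
  have zero: "e \<star> i \<star> k \<bullet> y = 0" if k: "k \<le> q - 2" "k \<noteq> ?m" "k \<noteq> Suc ?m" for k
  proof (cases "k < ?m")
    case True
    then show ?thesis
      using centralD[OF assms(1), of "i + k"] by (simp add: adpow_adpow)
  next
    case False
    then have "0 < i" "q - 3 + 2 \<le> i + k"
      using k assms(3) by linarith+
    then have "w \<star> (i + k - (q - 3)) = 0"
      using adpow_zero_ge[of w] assms(4) by simp
    then have "e \<star> (i + k) = 0"
      using \<open>q - 3 + 2 \<le> i + k\<close> by (simp add: assms(2) adpow_adpow)
    then show ?thesis
      by (simp add: adpow_adpow)
  qed
  have "of_nat (?m + 1) = (- of_nat (i + 2) :: 'f)" "of_nat (?m + 2) = (- of_nat (i + 1) :: 'f)"
    using of_nat_q_diff[of "i + 2"] of_nat_q_diff[of "i + 1"] assms(3) q_ge_7 unfolding m by auto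
  then show ?thesis
    using br_v1_pair[of ?m "e \<star> i"] zero m
    by (simp add: adpow_adpow assms(2) adpow_Suc del: of_nat_add of_nat_Suc)
qed

lemma chain_start_br_v1:
  assumes "central e" "w = e \<star> (q - 3)"
  shows "e \<bullet> v1 = - (2 *s (w \<bullet> y \<bullet> x)) - w \<bullet> x \<bullet> y"
  using chain_br_v1[OF assms, of 0] by simp

lemma x_br_v1:
  assumes "w \<bullet> x \<bullet> x = 0"
  shows "w \<bullet> x \<bullet> v1 = w \<bullet> x \<bullet> y \<star> (q - 2)"
proof -
  have "w \<bullet> x \<star> k = 0" if "k \<noteq> 0" for k
    using adpow_zero_ge[OF assms, of "Suc k"] that by (simp add: adpow_Suc')
  then show ?thesis
    using br_v1_single[of 0 "w \<bullet> x"] by simp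
qed

lemma x_br_v1_nxt: "w \<bullet> x \<bullet> x = 0 \<Longrightarrow> w \<bullet> x \<bullet> v1 = nxt w \<bullet> x"
  using x_br_v1[of w] unfolding q_diff nxt_def adpow_Suc .

lemma br_v1:
  assumes "w \<bullet> x \<bullet> x = 0"
  shows "w \<bullet> v1 = w \<bullet> y \<star> (q - 2) + 2 *s nxt w"
  using br_v1_pair[of 0 w] adpow_zero_ge[OF assms] q_ge_7 by (simp add: nxt_def)

lemma y_br_v1:
  assumes "w \<bullet> y \<bullet> y = 0" "central (w \<bullet> y \<bullet> x)"
  shows "w \<bullet> y \<bullet> v1 = - (w \<bullet> y \<bullet> x \<star> (q - 3) \<bullet> y)"
proof -
  have "w \<bullet> y \<star> k \<bullet> y = 0" if "k \<le> q - 2" "k \<noteq> q - 2" for k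
    using assms centralD[OF assms(2), of "k - 1"] that by (cases k) (auto simp: adpow_Suc')
  moreover have "q - 2 + 1 = q - 1" "q - 2 = Suc (q - 3)"
    using q_ge_7 by auto
  moreover have "(of_nat (q - 1) :: 'f) = - 1"
    using of_nat_q_diff[of 1] q_ge_7 by simp
  ultimately show ?thesis
    using br_v1_single[of "q - 2" "w \<bullet> y"] by (simp add: adpow_Suc' del: of_nat_add)
qed

text \<open>This is the shift property of \<open>v1\<close>. The last product is a shift as well
  exactly when [w' y x] = -[w' x y] for the next generator w', the relation of infinite
  type.\<close>

lemma infinite_br_v1:
  assumes "infinite w"
  shows "w \<bullet> v1 = nxt w" "w \<bullet> x \<bullet> v1 = nxt w \<bullet> x" "w \<bullet> y \<bullet> v1 = nxt w \<bullet> y"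
    "w \<bullet> x \<bullet> y \<bullet> v1 = - (2 *s (nxt w \<bullet> y \<bullet> x)) - nxt w \<bullet> x \<bullet> y"
proof -
  have w: "w \<bullet> x \<bullet> x = 0" "w \<bullet> y \<bullet> y = 0" "w \<bullet> y \<bullet> x = - (w \<bullet> x \<bullet> y)" "central (w \<bullet> x \<bullet> y)"
    using assms by (auto simp: infinite_def)
  have *: "w \<bullet> y \<star> Suc n = - (w \<bullet> x \<bullet> y \<star> n)" for n
    by (simp add: adpow_Suc' w adpow_linear)
  have "w \<bullet> y \<star> (q - 2) = - nxt w"
    using *[of "q - 3"] by (simp only: nxt_def q_diff)
  then show "w \<bullet> v1 = nxt w"
    using br_v1[OF w(1)] scale_left_distrib[of 1 1 "nxt w"] by simp
  show "w \<bullet> x \<bullet> v1 = nxt w \<bullet> x"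
    by (rule x_br_v1_nxt[OF w(1)])
  have "central (w \<bullet> y \<bullet> x)"
    using w by (simp add: central_def adpow_linear br_linear_simps)
  then show "w \<bullet> y \<bullet> v1 = nxt w \<bullet> y"
    using y_br_v1[OF w(2)] w(3) by (simp add: nxt_def adpow_linear br_linear_simps)
  show "w \<bullet> x \<bullet> y \<bullet> v1 = - (2 *s (nxt w \<bullet> y \<bullet> x)) - nxt w \<bullet> x \<bullet> y"
    by (rule chain_start_br_v1[OF w(4)]) (simp add: nxt_def)
qed

lemma central_after:
  assumes "central e" "w = e \<star> (q - 3)"
  shows "w \<bullet> y \<bullet> y = 0" "w \<bullet> y \<bullet> x \<bullet> y = 0" "w \<bullet> x \<bullet> y \<bullet> y = 0"
proof -
  have *: "q - 3 = Suc (Suc (q - 5))"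
    using q_ge_7 by simp
  then have w: "w = e \<star> (q - 5) \<bullet> x \<bullet> x"
    by (simp add: assms adpow_Suc)
  have "e \<star> (q - 5) \<bullet> y = 0" "e \<star> Suc (q - 5) \<bullet> y = 0"
    by (rule centralD[OF assms(1)], use * in linarith)+
  then show "w \<bullet> y \<bullet> y = 0" "w \<bullet> y \<bullet> x \<bullet> y = 0" "w \<bullet> x \<bullet> y \<bullet> y = 0"
    unfolding w using after_two_central[of "e \<star> (q - 5)"] by (simp_all add: adpow_Suc)
qed

text \<open>Infinite type turns [w x y x^(q-1)] into -[w y x^q], and (ad x)^q = 0.\<close>

lemma infinite_nxt:
  assumes "infinite w"
  shows "nxt w \<bullet> x \<bullet> x = 0" "nxt w \<bullet> y \<bullet> y = 0"
proof -
  have w: "w \<bullet> y \<bullet> x = - (w \<bullet> x \<bullet> y)" "central (w \<bullet> x \<bullet> y)"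
    using assms by (auto simp: infinite_def)
  have "nxt w \<bullet> x \<bullet> x = w \<bullet> x \<bullet> y \<star> (q - 1)"
    by (simp only: nxt_def q_diff adpow_Suc)
  also have "\<dots> = - (w \<bullet> y \<bullet> x \<star> (q - 1))"
    using w by (simp add: adpow_linear)
  also have "\<dots> = - (w \<bullet> y \<star> q)"
    using q_ge_7 by (simp add: adpow_Suc'[symmetric])
  finally show "nxt w \<bullet> x \<bullet> x = 0"
    by (simp add: adpow_q_eq_0)
  show "nxt w \<bullet> y \<bullet> y = 0"
    by (rule central_after[OF w(2)]) (simp add: nxt_def)
qed

text \<open>Let [f x^r y] with f = [w x y] be the first failure and n = r + 1. Brackets of w give 1
  + n = (-1)^n, brackets of the preceding segment give C(J, n) = 0 for J from n + 2 to q - 2, and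
  the two are incompatible.\<close>

lemma infinite_central:
  assumes e: "central e" "w = e \<star> (q - 3)"
    and w: "w \<bullet> x \<bullet> x = 0" "w \<bullet> y \<bullet> y = 0" "w \<bullet> y \<bullet> x = - (w \<bullet> x \<bullet> y)"
  shows "infinite w"
proof -
  let ?f = "w \<bullet> x \<bullet> y"
  have wy: "w \<bullet> y \<star> Suc n = - (?f \<star> n)" for n
    by (simp add: adpow_Suc' w adpow_linear)
  have "?f \<star> r \<bullet> y = 0" if "r < q - 3" for r
    using that
  proof (induction r rule: less_induct)
    case (less r)
    define n where "n = Suc r"
    have n: "1 \<le> n" "n \<le> q - 3"
      using less.prems by (auto simp: n_def)
    have IH: "?f \<star> s \<bullet> y = 0" if "s < r" for s
      using less.IH that less.prems by simp
    show ?case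
    proof (rule ccontr)
      assume neq: "?f \<star> r \<bullet> y \<noteq> 0"
      have rel1: "1 + of_nat n = ((- 1) ^ n :: 'f)"
      proof -
        have "w \<bullet> (y \<star> n) = w \<bullet> y \<star> n - of_nat n *s (?f \<star> (n - 1))"
          using br_adpow_pair[of 0 n w y] adpow_zero_ge[OF w(1)] by (simp add: n_def)
        also have "w \<bullet> y \<star> n = - (?f \<star> r)"
          by (simp add: n_def wy)
        also have "- (?f \<star> r) - of_nat n *s (?f \<star> (n - 1)) = - ((1 + of_nat n) *s (?f \<star> r))"
          using n_def by (simp add: scale_left_distrib del: of_nat_Suc)
        finally have "w \<bullet> (y \<star> n) \<bullet> y = - ((1 + of_nat n) *s (?f \<star> r \<bullet> y))"
          by (simp only: br_linear_simps)
        moreover have "w \<bullet> (y \<star> n) \<bullet> y = w \<bullet> y \<bullet> (y \<star> n)"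
          using br_br_left[of w "y \<star> n" y] y_adpow_y_eq_0[OF n] by simp
        moreover have "w \<bullet> y \<bullet> (y \<star> n) = (- 1) ^ n *s (w \<bullet> y \<star> n \<bullet> y)"
        proof -
          have "w \<bullet> y \<star> k \<bullet> y = 0" if "k \<le> n" "k \<noteq> n" for k
            using IH[of "k - 1"] that w(2) by (cases k) (auto simp: wy n_def br_linear_simps)
          then show ?thesis
            using br_adpow_single[of n n "w \<bullet> y" y] by simp
        qed
        moreover have "w \<bullet> y \<star> n \<bullet> y = - (?f \<star> r \<bullet> y)"
          by (simp add: n_def wy br_linear_simps)
        ultimately have "(1 + of_nat n) *s (?f \<star> r \<bullet> y) = (- 1) ^ n *s (?f \<star> r \<bullet> y)"
          by auto
        then show ?thesis
          using neq by auto
      qed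
      \<comment> \<open>The starting point in the preceding segment is placed so that only w and
        [w x] contribute. Their terms are multiples of the same [f x^r], and Pascal's rule merges
        the two coefficients into one with J = j + 1.\<close>
      have rel2: "(of_nat (J choose n) :: 'f) = 0" if J: "n + 2 \<le> J" "J \<le> q - 2" for J
      proof -
        obtain j where j: "J = Suc j" "n + 1 \<le> j"
          using J by (cases J) auto
        let ?i = "q - 3 + n - j"
        have i: "?i < q - 3" "?i + (j - n) = q - 3" "j - (j - n) = n" "j - Suc (j - n) = r" "j - n < j"
          using j n J by (auto simp: n_def)
        have zero: "e \<star> ?i \<star> k \<bullet> y = 0" if "k \<noteq> j - n" "k \<noteq> Suc (j - n)" for k
        proof (cases "k < j - n")
          case True
          then show ?thesis
            using centralD[OF e(1), of "?i + k"] i by (simp add: adpow_adpow)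
        next
          case False
          then have k: "q - 3 + 2 \<le> ?i + k"
            using that i by linarith
          then have "w \<star> (?i + k - (q - 3)) = 0"
            using adpow_zero_ge[OF w(1)] by simp
          then show ?thesis
            using k by (simp add: e(2) adpow_adpow)
        qed
        have ei: "e \<star> ?i \<star> (j - n) = w" "e \<star> ?i \<star> Suc (j - n) = w \<bullet> x"
          using i(2) by (simp_all add: adpow_adpow e(2) adpow_Suc)
        have "Suc (j - n) = j - r"
          using j by (simp add: n_def)
        then have "j choose (j - n) = j choose n" "j choose Suc (j - n) = j choose r"
          using binomial_symmetric[of n j] binomial_symmetric[of r j] j by (auto simp: n_def)
        then have "e \<star> ?i \<bullet> (y \<star> j) = ((- 1) ^ (j - n) * of_nat (j choose n)) *s (w \<bullet> y \<star> n)
            - ((- 1) ^ (j - n) * of_nat (j choose r)) *s (?f \<star> r)"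
          using br_adpow_pair[OF i(5), of "e \<star> ?i" y] zero by (simp add: ei i(3,4))
        also have "\<dots> = - (((- 1) ^ (j - n) * of_nat (J choose n)) *s (?f \<star> r))"
          by (simp add: n_def wy j(1) algebra_simps)
        finally have "e \<star> ?i \<bullet> (y \<star> j) \<bullet> y = - (((- 1) ^ (j - n) * of_nat (J choose n)) *s (?f \<star> r \<bullet> y))"
          by (simp only: br_linear_simps)
        moreover have "e \<star> ?i \<bullet> (y \<star> j) \<bullet> y = 0"
          by (rule br_y_adpow_y[OF centralD[OF e(1) i(1)]]) (use j n J in auto)
        ultimately show ?thesis
          using neq by simp
      qed
      have "n \<noteq> q - 3"
      proof
        assume *: "n = q - 3"
        then have "(of_nat n :: 'f) = - 3" "even n"
          using of_nat_q_diff[of 3] q_ge_7 odd_q by auto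
        then have "(- 3 :: 'f) = 0"
          using rel1 by simp
        then show False
          by simp
      qed
      then have n4: "n + 2 \<le> q - 2"
        using n q_ge_7 by linarith
      \<comment> \<open>Taking J = n + 2 leaves n = -1 and n = -2 modulo p; \<open>rel1\<close>
        excludes the former.\<close>
      have "(of_nat (n + 2) :: 'f) * (of_nat (n + 2) - 1) = 0"
        using of_nat_choose_two[of "n + 2"] rel2[of "n + 2"] n4 binomial_symmetric[of n "n + 2"] by simp
      then have "(of_nat n :: 'f) = - 2 \<or> of_nat n = (- 1 :: 'f)"
        by (auto simp: eq_neg_iff_add_eq_0 add.commute)
      moreover have "(of_nat n :: 'f) \<noteq> - 1"
        using rel1 by auto
      ultimately have "(of_nat (n + 2) :: 'f) = 0"
        by simp
      then have dvd: "p dvd n + 2"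
        by (simp only: of_nat_eq_0)
      define t where "t = multiplicity p (n + 2)"
      obtain m where t: "n + 2 = p ^ t * m" and m: "(of_nat m :: 'f) \<noteq> 0" and "5 \<le> p ^ t"
        using multiplicity_power_facts[OF dvd _ refl] unfolding t_def by auto
      then have P: "2 \<le> p ^ t"
        by linarith
      \<comment> \<open>For n = -2 modulo p take J = n + P, with P the highest power of p in n + 2 =
        P m. It is still in range and its coefficient is m.\<close>
      have "n + 2 + p ^ t \<le> q"
      proof (rule power_dvd_less)
        show "p ^ t dvd n + 2"
          unfolding t by (rule dvd_triv_left)
      qed (use n4 q_ge_7 in linarith)+
      then have "(of_nat ((n + p ^ t) choose n) :: 'f) = 0"
        using P by (intro rel2) auto
      moreover have "(n + p ^ t) choose n = (p ^ t * m + (p ^ t - 2)) choose p ^ t"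
      proof -
        have e: "n + p ^ t = p ^ t * m + (p ^ t - 2)"
          using t P by linarith
        have "(n + p ^ t) choose n = (n + p ^ t) choose p ^ t"
          using binomial_symmetric[of n "n + p ^ t"] by simp
        then show ?thesis
          unfolding e .
      qed
      moreover have "(of_nat ((p ^ t * m + (p ^ t - 2)) choose p ^ t) :: 'f) = of_nat m"
        by (rule choose_mult_power) (use P in auto)
      ultimately show False
        using m by simp
    qed
  qed
  then show ?thesis
    using w by (simp add: infinite_def central_def)
qed

lemma infinite_br_g: "infinite w \<Longrightarrow> w \<bullet> g = 0"
  using infinite_br_v1[of w] by (simp add: g_def br_br_right)

lemma infinite_br_v1x: "infinite w \<Longrightarrow> w \<bullet> (v1 \<bullet> x) = 0"
  using infinite_br_v1[of w] by (simp add: br_br_right)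

lemma infinite_nxt_iff:
  assumes "infinite w"
  shows "infinite (nxt w) \<longleftrightarrow> nxt w \<bullet> x \<bullet> y + nxt w \<bullet> y \<bullet> x = 0"
proof
  assume "nxt w \<bullet> x \<bullet> y + nxt w \<bullet> y \<bullet> x = 0"
  then have "nxt w \<bullet> y \<bullet> x = - (nxt w \<bullet> x \<bullet> y)"
    by (simp add: eq_neg_iff_add_eq_0 add.commute)
  moreover have "central (w \<bullet> x \<bullet> y)"
    using assms by (simp add: infinite_def)
  ultimately show "infinite (nxt w)"
    using infinite_central[of "w \<bullet> x \<bullet> y" "nxt w"] infinite_nxt[OF assms] by (simp add: nxt_def)
qed (simp add: infinite_def)

text \<open>The slack 6 is a lower bound for q - 1, the degree gained by raising the multiplier by
  one.\<close>

lemma component_mult_mono: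
  assumes "L (n * (q - 1) + i) \<noteq> {0}" "m < n" "j \<le> i + 6" "0 < m * (q - 1) + j"
  shows "L (m * (q - 1) + j) \<noteq> {0}"
proof (rule component_neq_0_mono[OF assms(1)])
  have "Suc m * (q - 1) \<le> n * (q - 1)"
    using assms(2) by (intro mult_le_mono1) simp
  then show "m * (q - 1) + j \<le> n * (q - 1) + i"
    using assms(3) q_ge_7 by simp
qed (use assms in auto)

text \<open>Right multiplication by \<open>v1\<close> is a derivation, so [A (l+1) B m] =
  [A l B m v1] - t m [A l B (m+1)], which is Pascal's rule. The bound T limits the shifts to those
  already established. From m = M on the factor t m is arbitrary, because the product that it
  multiplies vanishes.\<close>

lemma shifted_products:
  assumes A: "\<And>l. 1 \<le> l \<Longrightarrow> l < N \<Longrightarrow> A l \<bullet> v1 = A (Suc l)"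
    and B: "\<And>m. m0 \<le> m \<Longrightarrow> Suc (Suc m) \<le> T \<Longrightarrow> B m \<bullet> v1 = t m *s B (Suc m)"
    and t: "\<And>m. m0 \<le> m \<Longrightarrow> m < M \<Longrightarrow> t m = 1"
    and init: "\<And>m. m0 \<le> m \<Longrightarrow> Suc m \<le> T \<Longrightarrow> A 1 \<bullet> B m = (if m = M then \<psi> 0 else 0)"
    and \<psi>: "\<And>k. M + Suc (Suc k) \<le> T \<Longrightarrow> \<psi> k \<bullet> v1 = \<psi> (Suc k)"
    and lm: "1 \<le> l" "l \<le> N" "m0 \<le> m" "l + m \<le> T"
  shows "A l \<bullet> B m = (if m \<le> M
    then ((- 1) ^ (M - m) * of_nat (l - 1 choose (M - m))) *s \<psi> (l - 1 - (M - m)) else 0)"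
  using lm
proof (induction l arbitrary: m rule: dec_induct)
  case base
  then show ?case
    using init[of m] base by (cases "m < M"; cases "m = M") (simp_all add: binomial_eq_0)
next
  case (step l)
  have "A (Suc l) \<bullet> B m = A l \<bullet> v1 \<bullet> B m"
    using A step by simp
  also have "\<dots> = A l \<bullet> B m \<bullet> v1 - A l \<bullet> (B m \<bullet> v1)"
    by (simp add: br_br_right)
  also have "\<dots> = A l \<bullet> B m \<bullet> v1 - t m *s (A l \<bullet> B (Suc m))"
    using B[of m] step by (simp add: br_linear_simps)
  finally have rec: "A (Suc l) \<bullet> B m = A l \<bullet> B m \<bullet> v1 - t m *s (A l \<bullet> B (Suc m))" .
  have IH: "A l \<bullet> B m = (if m \<le> M
      then ((- 1) ^ (M - m) * of_nat (l - 1 choose (M - m))) *s \<psi> (l - 1 - (M - m)) else 0)"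
    "A l \<bullet> B (Suc m) = (if Suc m \<le> M
      then ((- 1) ^ (M - Suc m) * of_nat (l - 1 choose (M - Suc m))) *s \<psi> (l - 1 - (M - Suc m)) else 0)"
    using step by auto
  consider "M < m" | "m = M" | "m < M"
    by linarith
  then show ?case
  proof cases
    case 1
    then show ?thesis
      using rec IH by simp
  next
    case 2
    then show ?thesis
      using rec IH \<psi>[of "l - 1"] step by simp
  next
    case 3
    define n where "n = M - Suc m"
    have n: "M - m = Suc n"
      using 3 by (simp add: n_def)
    have first: "A l \<bullet> B m \<bullet> v1 = ((- 1) ^ Suc n * of_nat (l - 1 choose Suc n)) *s \<psi> (l - Suc n)"
    proof (cases "Suc n \<le> l - 1")
      case True
      have "\<psi> (l - 1 - Suc n) \<bullet> v1 = \<psi> (Suc (l - 1 - Suc n))"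
        by (rule \<psi>) (use True n 3 step in linarith)
      moreover have "Suc (l - 1 - Suc n) = l - Suc n"
        using True by simp
      ultimately show ?thesis
        using IH 3 n by (simp add: br_linear_simps)
    next
      case False
      then show ?thesis
        using IH 3 n by (simp add: binomial_eq_0)
    qed
    have second: "A l \<bullet> B (Suc m) = ((- 1) ^ n * of_nat (l - 1 choose n)) *s \<psi> (l - Suc n)"
      using IH 3 n by (simp add: n_def)
    have "l choose Suc n = (l - 1 choose n) + (l - 1 choose Suc n)"
      using step by (cases l) auto
    moreover have "t m = 1"
      using t 3 step.prems by simp
    ultimately have "A (Suc l) \<bullet> B m = ((- 1) ^ Suc n * of_nat (l choose Suc n)) *s \<psi> (l - Suc n)"
      unfolding rec first second by (simp add: algebra_simps)
    then show ?thesis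
      using 3 n by simp
  qed
qed

section \<open>The generators just below the diamonds, and diamond types in terms of them\<close>

definition v :: "nat \<Rightarrow> 'a" where
  "v k = (nxt ^^ (k - 1)) v1"

lemma v_1 [simp]: "v (Suc 0) = v1"
  and v_Suc: "1 \<le> k \<Longrightarrow> v (Suc k) = nxt (v k)"
  by (cases k; simp add: v_def)+

lemma L_after_infinite:
  assumes "infinite w" "L m = span {w}" "1 \<le> m"
  shows "L (m + 2) = span {w \<bullet> x \<bullet> y}" "L (m + (q - 1)) = span {nxt w}"
proof -
  have w: "w \<bullet> x \<bullet> x = 0" "w \<bullet> y \<bullet> y = 0" "w \<bullet> y \<bullet> x = - (w \<bullet> x \<bullet> y)" "central (w \<bullet> x \<bullet> y)"
    using assms by (auto simp: infinite_def)
  have "L (Suc (Suc m)) = span {0, w \<bullet> x \<bullet> y, - (w \<bullet> x \<bullet> y), 0}"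
    using span_component_Suc_Suc[OF assms(2,3)] w by simp
  also have "\<dots> = span {w \<bullet> x \<bullet> y}"
    by (intro equalityI span_minimal subspace_span) (auto intro: span_base span_neg span_zero)
  finally show *: "L (m + 2) = span {w \<bullet> x \<bullet> y}"
    by simp
  have m: "m + (q - 1) = m + 2 + (q - 3)"
    using q_ge_7 by simp
  show "L (m + (q - 1)) = span {nxt w}"
    unfolding nxt_def m by (rule L_central[OF w(4) *]) simp_all
qed

text \<open>Fake diamonds obey the equation of genuine ones, both sides being 0 because [w y] or
  [w x] is. The nonzero sum is what separates finite from infinite type.\<close>

lemma finite_type_D:
  assumes "finite_type x y (Suc m) \<nu>" "L m = span {u}" "1 \<le> m"
  shows "u \<bullet> x \<bullet> x = 0" "u \<bullet> y \<bullet> y = 0" "\<nu> *s (u \<bullet> y \<bullet> x) = (1 - \<nu>) *s (u \<bullet> x \<bullet> y)"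
    "u \<bullet> x \<bullet> y + u \<bullet> y \<bullet> x \<noteq> 0"
proof -
  have L: "L (Suc (Suc m)) \<noteq> {0}"
    using assms(1) by (auto simp: finite_type_def genuine_finite_type_def fake_type_def)
  obtain w where w: "L m = span {w}" "w \<bullet> x \<bullet> x = 0" "w \<bullet> y \<bullet> y = 0"
    "\<nu> *s (w \<bullet> y \<bullet> x) = (1 - \<nu>) *s (w \<bullet> x \<bullet> y)"
    using assms(1)
    by (fastforce simp: finite_type_def genuine_finite_type_def fake_type_def lnprod_two)
  have "u \<in> span {w}"
    using w(1) assms(2) by (metis span_base singletonI)
  then obtain c where u: "u = c *s w"
    by (auto simp: span_singleton)
  show *: "u \<bullet> x \<bullet> x = 0" "u \<bullet> y \<bullet> y = 0"
    by (simp_all add: u br_linear_simps w)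
  have "\<nu> *s (u \<bullet> y \<bullet> x) = c *s (\<nu> *s (w \<bullet> y \<bullet> x))"
    by (simp add: u br_linear_simps mult.commute)
  also have "\<dots> = (1 - \<nu>) *s (u \<bullet> x \<bullet> y)"
    unfolding w(4) by (simp add: u br_linear_simps mult.commute)
  finally show **: "\<nu> *s (u \<bullet> y \<bullet> x) = (1 - \<nu>) *s (u \<bullet> x \<bullet> y)" .
  show "u \<bullet> x \<bullet> y + u \<bullet> y \<bullet> x \<noteq> 0"
  proof
    assume sum: "u \<bullet> x \<bullet> y + u \<bullet> y \<bullet> x = 0"
    then have yx: "u \<bullet> y \<bullet> x = - (u \<bullet> x \<bullet> y)"
      by (simp add: eq_neg_iff_add_eq_0 add.commute)
    then have "u \<bullet> x \<bullet> y = 0"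
      using ** by (simp add: scale_left_diff_distrib)
    then have "L (Suc (Suc m)) = {0}"
      using span_component_Suc_Suc[OF assms(2,3)] * yx by simp
    then show False
      using L by simp
  qed
qed

text \<open>If [u x] and [u y] are independent, the sum is c times [u x y] and the type is 1/c.
  Otherwise one of them is 0 and the diamond is fake; divisibility of m by q - 1 makes its degree
  the one that counts.\<close>

lemma finite_type_I:
  assumes u: "L m = span {u}" "1 \<le> m" "u \<bullet> x \<bullet> x = 0" "u \<bullet> y \<bullet> y = 0"
    and sum: "u \<bullet> x \<bullet> y + u \<bullet> y \<bullet> x \<noteq> 0" and m: "(q - 1) dvd m"
  shows "\<exists>\<nu>. finite_type x y (Suc m) \<nu>"
proof -
  have u0: "u \<noteq> 0"
    using sum by auto
  have L: "L (Suc (Suc m)) \<noteq> {0}"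
  proof -
    have "u \<bullet> x \<bullet> y + u \<bullet> y \<bullet> x \<in> L (Suc (Suc m))"
      using u(1) span_base[of u "{u}"]
      by (intro subspace_add subspace_component br_x_component br_y_component) auto
    then show ?thesis
      using sum by auto
  qed
  have cong: "[Suc m = 1] (mod (q - 1))"
    using m by (metis cong_0_iff cong_add_lcancel_0_nat plus_1_eq_Suc)
  have L1: "L (Suc m) = span {u \<bullet> x, u \<bullet> y}"
    by (rule span_component_Suc_single[OF u(1,2)])
  consider "u \<bullet> x = 0" | "u \<bullet> y = 0" | "u \<bullet> y \<noteq> 0" "u \<bullet> y \<in> span {u \<bullet> x}"
    | "u \<bullet> x \<noteq> 0" "u \<bullet> y \<notin> span {u \<bullet> x}"
    by blast
  then show ?thesis
  proof cases
    case 1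
    then have "fake_type x y (Suc m) 0"
      using u u0 L by (auto simp: fake_type_def lnprod_two)
    then show ?thesis
      using cong by (auto simp: finite_type_def)
  next
    case 2
    then have "fake_type x y (Suc m) 1"
      using u u0 L by (auto simp: fake_type_def lnprod_two)
    then show ?thesis
      using cong by (auto simp: finite_type_def)
  next
    case 3
    then obtain c where "u \<bullet> y = c *s (u \<bullet> x)" "c \<noteq> 0"
      by (auto simp: span_singleton)
    then have "u \<bullet> y \<bullet> x = 0" "c *s (u \<bullet> x \<bullet> y) = 0"
      using u by (auto simp: br_linear_simps)
    then show ?thesis
      using \<open>c \<noteq> 0\<close> sum by simp
  next
    case 4
    then have "independent {u \<bullet> y, u \<bullet> x}"
      by (simp add: independent_insert)
    moreover have "u \<bullet> y \<noteq> u \<bullet> x"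
      using 4 by (auto intro: span_base)
    ultimately have "dim (span {u \<bullet> y, u \<bullet> x}) = 2"
      by (subst dim_span_eq_card_independent) auto
    then have dim: "dim (L (Suc m)) = 2"
      using L1 by (simp add: insert_commute)
    have ux: "u \<bullet> x \<in> L (Suc m)" "u \<bullet> y \<in> L (Suc m)"
      using L1 by (auto intro: span_base)
    then have "L (Suc (Suc m)) = span {u \<bullet> x \<bullet> x, u \<bullet> x \<bullet> y}"
      using covering_span[of "u \<bullet> x"] 4 by simp
    then have L2: "L (Suc (Suc m)) = span {u \<bullet> x \<bullet> y}"
      using u by (simp add: span_insert_0)
    then have "u \<bullet> x \<bullet> y + u \<bullet> y \<bullet> x \<in> span {u \<bullet> x \<bullet> y}"
      using br_y_component[OF ux(1)] br_x_component[OF ux(2)]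
      by (metis subspace_add subspace_component)
    then obtain c where c: "u \<bullet> x \<bullet> y + u \<bullet> y \<bullet> x = c *s (u \<bullet> x \<bullet> y)"
      by (auto simp: span_singleton)
    then have "c \<noteq> 0"
      using sum by auto
    have yx: "u \<bullet> y \<bullet> x = (c - 1) *s (u \<bullet> x \<bullet> y)"
      using c by (simp add: algebra_simps)
    have "(1 / c) *s (u \<bullet> y \<bullet> x) = (1 - 1 / c) *s (u \<bullet> x \<bullet> y)"
      unfolding yx using \<open>c \<noteq> 0\<close> by (simp add: diff_divide_distrib)
    then have "genuine_finite_type x y (Suc m) (1 / c)"
      using u u0 L dim by (auto simp: genuine_finite_type_def lnprod_two)
    then show ?thesis
      by (auto simp: finite_type_def)
  qed
qed

lemma infinite_v2: "infinite (v 2)" and L_v2: "L (2 * (q - 1)) = span {v 2}"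
proof -
  have v2: "v 2 = h \<star> (q - 3)"
    using v_Suc[of 1] by (simp add: numeral_2_eq_2 nxt_def h_def)
  have q: "2 * (q - 1) = q + 1 + (q - 3)"
    using q_ge_7 by simp
  show L: "L (2 * (q - 1)) = span {v 2}"
    unfolding q v2 by (rule L_h_adpow) (rule h_adpow_y)
  have "2 * q - 1 - 1 = 2 * (q - 1)"
    by simp
  then obtain w where w: "L (2 * (q - 1)) = span {w}" "w \<bullet> x \<bullet> x = 0" "w \<bullet> y \<bullet> y = 0"
    "w \<bullet> y \<bullet> x = - (w \<bullet> x \<bullet> y)"
    using infinite_2 by (auto simp: infinite_type_def lnprod_two)
  then have "v 2 \<in> span {w}"
    using L by (metis span_base singletonI)
  then obtain c where "v 2 = c *s w"
    by (auto simp: span_singleton)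
  then have "v 2 \<bullet> x \<bullet> x = 0" "v 2 \<bullet> y \<bullet> y = 0" "v 2 \<bullet> y \<bullet> x = - (v 2 \<bullet> x \<bullet> y)"
    using w by (simp_all add: br_linear_simps)
  then show "infinite (v 2)"
    by (rule infinite_central[OF central_h v2])
qed

text \<open>With the factor 1/2 in degree \<open>q\<close>, \<open>v1\<close> acts as a shift on \<open>yh\<close>.\<close>

definition yh :: "nat \<Rightarrow> 'a" where
  "yh m = (if m = 1 then (1 / 2) *s g else v m \<bullet> y)"

lemma v1x_v1: "v1 \<bullet> x \<bullet> v1 = v 2 \<bullet> x"
  using x_br_v1_nxt[OF v1xx] v_Suc[of 1] by (simp add: numeral_2_eq_2)

lemma g_v1: "g \<bullet> v1 = 2 *s (v 2 \<bullet> y)"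
proof -
  have "central (v1 \<bullet> y \<bullet> x)"
    using central_h gx by (simp add: central_def g_def adpow_linear br_linear_simps)
  then have "g \<bullet> v1 = - (g \<bullet> x \<star> (q - 3) \<bullet> y)"
    using y_br_v1[of v1] gy by (simp add: g_def)
  then show ?thesis
    using v_Suc[of 1] by (simp add: gx nxt_def h_def numeral_2_eq_2 adpow_linear br_linear_simps)
qed

lemma h_v1: "h \<bullet> v1 = v 2 \<bullet> x \<bullet> y"
proof -
  have "v 2 = h \<star> (q - 3)"
    using v_Suc[of 1] by (simp add: numeral_2_eq_2 nxt_def h_def)
  then have "h \<bullet> v1 = - (2 *s (v 2 \<bullet> y \<bullet> x)) - v 2 \<bullet> x \<bullet> y"
    by (rule chain_start_br_v1[OF central_h])
  also have "\<dots> = v 2 \<bullet> x \<bullet> y"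
    using infinite_v2 scale_left_distrib[of 1 1 "v 2 \<bullet> x \<bullet> y"] by (simp add: infinite_def)
  finally show ?thesis .
qed

end

section \<open>The degrees up to the earliest diamond of finite type, and the parity of
  \<open>a\<close>\<close>

locale nottingham_earliest = nottingham_generators scale br L p q x y
  for scale :: "'f::field \<Rightarrow> 'a::ab_group_add \<Rightarrow> 'a" and br :: "'a \<Rightarrow> 'a \<Rightarrow> 'a"
    and L :: "nat \<Rightarrow> 'a set" and p q :: nat and x y :: 'a +
  fixes a :: nat and \<mu> :: 'f
  assumes earliest: "earliest_finite_type x y (a * (q - 1) + 1) \<mu>"
begin

lemma finite_type_a: "finite_type x y (Suc (a * (q - 1))) \<mu>"
  using earliest by (simp add: earliest_finite_type_def)

lemma not_finite_type: "q < i \<Longrightarrow> i < Suc (a * (q - 1)) \<Longrightarrow> \<not> finite_type x y i \<nu>"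
  using earliest by (auto simp: earliest_finite_type_def)

lemma a_ge_3: "3 \<le> a"
proof -
  have "q < a * (q - 1) + 1"
    using earliest by (simp add: earliest_finite_type_def)
  moreover have "a * (q - 1) \<le> 1 * (q - 1)" if "\<not> 2 \<le> a"
    using that by (intro mult_le_mono1) simp
  ultimately have "2 \<le> a"
    using q_ge_7 by linarith
  moreover have "a \<noteq> 2"
  proof
    assume "a = 2"
    then have "v 2 \<bullet> x \<bullet> y + v 2 \<bullet> y \<bullet> x \<noteq> 0"
      using finite_type_D(4) finite_type_a L_v2 q_ge_7 by simp
    then show False
      using infinite_v2 by (simp add: infinite_def)
  qed
  ultimately show ?thesis
    by simp
qed

lemma component_neq_0': "0 < m \<Longrightarrow> m \<le> Suc (Suc (a * (q - 1))) \<Longrightarrow> L m \<noteq> {0}"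
proof -
  have "L (Suc (Suc (a * (q - 1)))) \<noteq> {0}"
    using finite_type_a by (auto simp: finite_type_def genuine_finite_type_def fake_type_def)
  then show "0 < m \<Longrightarrow> m \<le> Suc (Suc (a * (q - 1))) \<Longrightarrow> L m \<noteq> {0}"
    using component_neq_0_mono by blast
qed

text \<open>By \<open>finite_type_I\<close>, the first diamond that fails to have infinite type has
  finite type, which minimality of \<open>a\<close> forbids in these degrees.\<close>

lemma L_v_infinite: "2 \<le> k \<Longrightarrow> k < a \<Longrightarrow> infinite (v k) \<and> L (k * (q - 1)) = span {v k}"
proof (induction k rule: dec_induct)
  case base
  then show ?case
    using infinite_v2 L_v2 by simp
next
  case (step k)
  then have inf: "infinite (v k)" and Lk: "L (k * (q - 1)) = span {v k}"
    by auto
  have k1: "1 \<le> k * (q - 1)" "1 \<le> Suc k * (q - 1)"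
    using step q_ge_7 by simp_all
  have vk: "v (Suc k) = nxt (v k)"
    using v_Suc step by simp
  have L: "L (Suc k * (q - 1)) = span {v (Suc k)}"
    using L_after_infinite(2)[OF inf Lk k1(1)] vk by (simp add: add.commute)
  have xy: "v (Suc k) \<bullet> x \<bullet> x = 0" "v (Suc k) \<bullet> y \<bullet> y = 0"
    using infinite_nxt[OF inf] vk by simp_all
  have "v (Suc k) \<bullet> x \<bullet> y + v (Suc k) \<bullet> y \<bullet> x = 0"
  proof (rule ccontr)
    assume "v (Suc k) \<bullet> x \<bullet> y + v (Suc k) \<bullet> y \<bullet> x \<noteq> 0"
    then obtain \<nu> where "finite_type x y (Suc (Suc k * (q - 1))) \<nu>"
      using finite_type_I[OF L k1(2) xy] by auto
    moreover have "2 * (q - 1) \<le> Suc k * (q - 1)" "Suc k * (q - 1) < a * (q - 1)"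
      using step q_ge_7 mult_le_mono1[of 2 "Suc k" "q - 1"] mult_less_mono1[of "Suc k" a "q - 1"] by auto
    ultimately show False
      using not_finite_type[of "Suc (Suc k * (q - 1))" \<nu>] q_ge_7 by linarith
  qed
  then have yx: "v (Suc k) \<bullet> y \<bullet> x = - (v (Suc k) \<bullet> x \<bullet> y)"
    by (simp add: eq_neg_iff_add_eq_0 add.commute)
  have "central (v k \<bullet> x \<bullet> y)"
    using inf by (simp add: infinite_def)
  then have "infinite (v (Suc k))"
    by (rule infinite_central) (simp_all add: vk nxt_def[symmetric] xy[unfolded vk] yx[unfolded vk])
  then show ?case
    using L by simp
qed

lemma v_infinite: "2 \<le> k \<Longrightarrow> k < a \<Longrightarrow> infinite (v k)"
  using L_v_infinite by blast

lemma v_infiniteD: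
  assumes "2 \<le> k" "k < a"
  shows "v k \<bullet> x \<bullet> x = 0" "v k \<bullet> y \<bullet> y = 0" "v k \<bullet> y \<bullet> x = - (v k \<bullet> x \<bullet> y)" "central (v k \<bullet> x \<bullet> y)"
  using v_infinite[OF assms] by (auto simp: infinite_def)

lemma v_br_v1:
  assumes "2 \<le> k" "k < a"
  shows "v k \<bullet> v1 = v (Suc k)" "v k \<bullet> x \<bullet> v1 = v (Suc k) \<bullet> x" "v k \<bullet> y \<bullet> v1 = v (Suc k) \<bullet> y"
    "v k \<bullet> x \<bullet> y \<bullet> v1 = - (2 *s (v (Suc k) \<bullet> y \<bullet> x)) - v (Suc k) \<bullet> x \<bullet> y"
  using infinite_br_v1[OF v_infinite[OF assms]] v_Suc[of k] assms by simp_all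

definition E :: 'a where "E = v (a - 1) \<bullet> x \<bullet> y"

lemma Suc_a: "Suc (a - 1) = a" "2 \<le> a - 1" "a - 1 < a"
  using a_ge_3 by simp_all

lemma central_E: "central E"
  using v_infiniteD(4)[OF Suc_a(2,3)] by (simp add: E_def)

lemma E_adpow: "v a = E \<star> (q - 3)"
  using v_Suc[of "a - 1"] Suc_a by (simp add: nxt_def E_def)

lemma L_va: "L (a * (q - 1)) = span {v a}"
proof -
  have "L ((a - 1) * (q - 1) + (q - 1)) = span {nxt (v (a - 1))}"
    by (rule L_after_infinite) (use L_v_infinite[of "a - 1"] Suc_a q_ge_7 in auto)
  moreover have "(a - 1) * (q - 1) + (q - 1) = a * (q - 1)"
    using Suc_a by (metis add.commute mult_Suc)
  ultimately show ?thesis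
    using v_Suc[of "a - 1"] Suc_a by simp
qed

text \<open>A generator normalized so that [v_a x y] = \<mu> d and [v_a y x] = (1 - \<mu>) d, for
  genuine and fake diamonds alike.\<close>

definition d :: 'a where "d = v a \<bullet> x \<bullet> y + v a \<bullet> y \<bullet> x"

lemma a_pos: "1 \<le> a * (q - 1)"
  using a_ge_3 q_ge_7 by simp

lemma vaxx: "v a \<bullet> x \<bullet> x = 0" and vayy: "v a \<bullet> y \<bullet> y = 0"
  and d_neq_0: "d \<noteq> 0"
  and vaxy: "v a \<bullet> x \<bullet> y = \<mu> *s d" and vayx: "v a \<bullet> y \<bullet> x = (1 - \<mu>) *s d"
proof -
  note * = finite_type_D[OF finite_type_a L_va a_pos]
  show "v a \<bullet> x \<bullet> x = 0" "v a \<bullet> y \<bullet> y = 0" "d \<noteq> 0"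
    using * by (simp_all add: d_def)
  show xy: "v a \<bullet> x \<bullet> y = \<mu> *s d"
    using *(3) by (simp add: d_def algebra_simps)
  show "v a \<bullet> y \<bullet> x = (1 - \<mu>) *s d"
    using xy by (simp add: d_def algebra_simps)
qed

lemma L_d: "L (a * (q - 1) + 2) = span {d}"
proof -
  have "L (Suc (Suc (a * (q - 1)))) = span {0, \<mu> *s d, (1 - \<mu>) *s d, 0}"
    using span_component_Suc_Suc[OF L_va a_pos] by (simp add: vaxx vayy vaxy vayx)
  also have "\<dots> \<subseteq> span {d}"
    by (intro span_minimal subspace_span) (auto intro: span_base span_zero span_scale)
  finally show ?thesis
    using br_y_component[of "v a \<bullet> x"] br_x_component[of "v a \<bullet> y"]
      br_x_component[of "v a"] br_y_component[of "v a"] L_va span_base[of "v a" "{v a}"]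
    by (intro equalityI span_minimal subspace_component)
      (auto simp: d_def intro: subspace_add[OF subspace_component])
qed

lemma vay: "\<mu> = 1 \<Longrightarrow> v a \<bullet> y = 0"
proof (rule ccontr)
  assume "\<mu> = 1" "v a \<bullet> y \<noteq> 0"
  moreover have "v a \<bullet> y \<in> L (Suc (a * (q - 1)))"
    using L_va by (intro br_y_component) (auto intro: span_base)
  ultimately have "L (Suc (Suc (a * (q - 1)))) = {0}"
    using covering_eq_0[of "v a \<bullet> y"] vayy vayx by simp
  then show False
    using component_neq_0' by simp
qed

lemma E_adpow_br_v1:
  assumes "i \<le> q - 3"
  shows "E \<star> i \<bullet> v1 = (\<mu> - 2 - of_nat i) *s (d \<star> i)"
proof -
  have "E \<star> i \<bullet> v1 = - (of_nat (i + 2) *s ((1 - \<mu>) *s d \<star> i)) - of_nat (i + 1) *s ((\<mu> *s d) \<star> i)"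
    using chain_br_v1[OF central_E E_adpow assms] vaxx by (simp add: adpow_Suc' vaxy vayx)
  also have "\<dots> = (- (of_nat (i + 2) * (1 - \<mu>)) - of_nat (i + 1) * \<mu>) *s (d \<star> i)"
    unfolding adpow_linear scale_scale
      scale_left_diff_distrib[of "- (of_nat (i + 2) * (1 - \<mu>))" "of_nat (i + 1) * \<mu>"]
    by simp
  also have "- (of_nat (i + 2) * (1 - \<mu>)) - of_nat (i + 1) * \<mu> = \<mu> - 2 - of_nat i"
    by (simp add: algebra_simps)
  finally show ?thesis .
qed

lemma E_br_v1: "E \<bullet> v1 = v a \<bullet> x \<bullet> y - 2 *s d"
  using E_adpow_br_v1[of 0] by (simp add: vaxy scale_left_diff_distrib)

text \<open>Since [z x] = 0 and [z g] = 2 d, brackets with z turn facts about \<open>g\<close> and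
  [y x^j] into facts about \<open>d\<close>.\<close>

definition z :: 'a where "z = v (a - 1) \<bullet> x"

lemma zx: "z \<bullet> x = 0" and zy: "z \<bullet> y = E" and zv1: "z \<bullet> v1 = v a \<bullet> x"
  using v_infiniteD[OF Suc_a(2,3)] v_br_v1[OF Suc_a(2,3)] Suc_a by (simp_all add: z_def E_def)

lemma zg: "z \<bullet> g = 2 *s d"
  using br_br_right[of z v1 y] zv1 zy E_br_v1 by (simp add: g_def)

lemma yh_br_v1: "1 \<le> m \<Longrightarrow> m < a \<Longrightarrow> yh m \<bullet> v1 = yh (Suc m)"
  using g_v1 v_br_v1(3)[of m] by (auto simp: yh_def br_linear_simps numeral_2_eq_2)

lemma vx_br_v1: "1 \<le> l \<Longrightarrow> l < a \<Longrightarrow> v l \<bullet> x \<bullet> v1 = v (Suc l) \<bullet> x"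
  using v1x_v1 v_br_v1(2)[of l] by (cases "l = 1") (auto simp: numeral_2_eq_2)

text \<open>For m at least 2 this bracket is the sum [w x y] + [w y x] with w the next generator, so
  it detects the first diamond that is not of infinite type.\<close>

lemma v1x_br_yh:
  assumes "1 \<le> m" "m < a"
  shows "v1 \<bullet> x \<bullet> yh m = (if m = a - 1 then d else 0)"
proof (cases "m = 1")
  case True
  have "v1 \<bullet> x \<bullet> g = 0"
    using v1x_v1 h_v1 by (simp add: g_def br_br_right h_def[symmetric])
  then show ?thesis
    using True Suc_a by (auto simp: yh_def br_linear_simps)
next
  case False
  then have m: "2 \<le> m"
    using assms by simp
  have "v1 \<bullet> x \<bullet> (v m \<bullet> y) = - (v m \<bullet> y \<bullet> (v1 \<bullet> x))"
    by (rule br_anti)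
  also have "\<dots> = - (v (Suc m) \<bullet> y \<bullet> x + v m \<bullet> x \<bullet> y \<bullet> v1)"
    using v_infiniteD(3)[OF m assms(2)] v_br_v1(3)[OF m assms(2)]
    by (simp add: br_br_right br_linear_simps)
  also have "\<dots> = v (Suc m) \<bullet> x \<bullet> y + v (Suc m) \<bullet> y \<bullet> x"
    using v_br_v1(4)[OF m assms(2)] scale_left_distrib[of 1 1 "v (Suc m) \<bullet> y \<bullet> x"] by simp
  also have "\<dots> = (if m = a - 1 then d else 0)"
    using v_infiniteD(3)[of "Suc m"] m assms by (auto simp: d_def)
  finally show ?thesis
    using False by (simp add: yh_def)
qed

lemma vx_br_yh:
  assumes "1 \<le> l" "1 \<le> m" "l + m \<le> a"
  shows "v l \<bullet> x \<bullet> yh m = (if l + m = a then (- 1) ^ (l - 1) *s d else 0)"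
proof -
  have "v l \<bullet> x \<bullet> yh m = (if m \<le> a - 1
    then ((- 1) ^ (a - 1 - m) * of_nat (l - 1 choose (a - 1 - m))) *s d else 0)"
    by (rule shifted_products[where A = "\<lambda>l. v l \<bullet> x" and B = yh and N = "a - 1" and T = a
          and t = "\<lambda>_. 1" and \<psi> = "\<lambda>_. d" and ?m0.0 = 1])
      (use assms v1x_br_yh vx_br_v1 yh_br_v1 a_ge_3 in auto)
  also have "\<dots> = (if l + m = a then (- 1) ^ (l - 1) *s d else 0)"
  proof (cases "l + m = a")
    case True
    then have "a - 1 - m = l - 1" "m \<le> a - 1"
      using assms by linarith+
    then show ?thesis
      using True by simp
  next
    case False
    then have "l - 1 < a - 1 - m"
      using assms by linarith
    then show ?thesis
      using False by (simp add: binomial_eq_0)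
  qed
  finally show ?thesis .
qed

lemma even_a: "even a"
proof (rule ccontr)
  assume "odd a"
  have "z \<bullet> yh 1 = (- 1) ^ (a - 1 - 1) *s d"
    using vx_br_yh[of "a - 1" 1] a_ge_3 by (simp add: z_def)
  moreover have "z \<bullet> yh 1 = d"
    by (simp add: yh_def br_linear_simps zg)
  moreover have "(- 1 :: 'f) ^ (a - 1 - 1) = - 1"
    using \<open>odd a\<close> a_ge_3 by simp
  ultimately have "(1 + 1) *s d = 0"
    by (simp only: scale_left_distrib) (simp add: eq_neg_iff_add_eq_0[symmetric])
  then show False
    using d_neq_0 by simp
qed

lemma a_ge_4: "4 \<le> a"
  using even_a a_ge_3 by (cases "a = 3") auto

section \<open>The components after the earliest diamond of finite type\<close>

lemma adpow_z: "0 < k \<Longrightarrow> z \<star> k = 0"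
  using adpow_eq_0[of z 1 k] zx by simp

lemma z_br_y_adpow: "z \<bullet> (y \<star> j) = E \<star> j"
  using br_adpow_single[of 0 j z y] adpow_z zy by simp

lemma g_adpow_y: "k \<le> q - 3 \<Longrightarrow> g \<star> k \<bullet> y = 0"
  using h_adpow_y[of "k - 1"] gy q_ge_7 by (cases "k = 0") (simp_all add: g_adpow br_linear_simps)

lemma g_br_y_adpow: "j \<le> q - 3 \<Longrightarrow> g \<bullet> (y \<star> j) = 0"
  by (rule br_adpow_zero) (simp add: g_adpow_y)

text \<open>Write 2 d = [z g]. As \<open>g\<close> commutes with [y x^j], the bracket becomes
  [E x^j g], and \<open>E_adpow_br_v1\<close> supplies the factor.\<close>

lemma d_br_y_adpow:
  assumes "j < q - 3"
  shows "2 *s (d \<bullet> (y \<star> j)) = (\<mu> - 2 - of_nat j) *s (d \<star> j \<bullet> y)"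
proof -
  have "2 *s (d \<bullet> (y \<star> j)) = z \<bullet> g \<bullet> (y \<star> j)"
    by (simp add: zg br_linear_simps)
  also have "\<dots> = E \<star> j \<bullet> g"
    using br_br_left[of z g "y \<star> j"] g_br_y_adpow[of j] assms by (simp add: z_br_y_adpow)
  also have "\<dots> = (\<mu> - 2 - of_nat j) *s (d \<star> j \<bullet> y)"
    using centralD[OF central_E assms] E_adpow_br_v1[of j] assms
    by (simp add: g_def br_br_right br_linear_simps)
  finally show ?thesis .
qed

text \<open>Here [y x^(q-1)] = [v1 x] commutes with both \<open>z\<close> and \<open>g\<close>,
  hence with [z g] = 2 d.\<close>

lemma d_br_u_pred: "d \<bullet> (y \<star> (q - 1)) = 0"
proof -
  have "E \<star> (q - 1) = 0"
    using adpow_adpow[of E "q - 3" 2] E_adpow vaxx unfolding q_diff by (simp add: adpow_Suc)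
  then have "z \<bullet> (v1 \<bullet> x) = 0"
    using z_br_y_adpow[of "q - 1"] unfolding y_adpow_q_pred by simp
  moreover have "g \<bullet> (v1 \<bullet> x) = 0"
  proof -
    have "g \<bullet> (v1 \<bullet> x) = 2 *s (v 2 \<bullet> y \<bullet> x) + 2 *s (v 2 \<bullet> x \<bullet> y)"
      by (simp add: br_br_right g_v1 gx h_v1 br_linear_simps)
    then show ?thesis
      using v_infiniteD(3)[of 2] a_ge_3 by simp
  qed
  ultimately have "z \<bullet> g \<bullet> (v1 \<bullet> x) = 0"
    using br_br_left[of z g "v1 \<bullet> x"] by simp
  then show ?thesis
    unfolding y_adpow_q_pred by (simp add: zg br_linear_simps)
qed

text \<open>One segment further back, [E' x^k] commutes with \<open>g\<close> except for k = q - 2,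
  where it equals \<open>z\<close>. So a bracket of [E' x^k] with [g x^J] has a single term, a
  multiple of [d x^i], and y kills it because it kills both factors.\<close>

lemma choose_mult_d_adpow_y:
  assumes "i + 2 \<le> J" "J \<le> q - 3"
  shows "of_nat (J choose i) *s (d \<star> i \<bullet> y) = 0"
proof -
  define E' where "E' = v (a - 2) \<bullet> x \<bullet> y"
  have a2: "2 \<le> a - 2" "a - 2 < a" "Suc (a - 2) = a - 1"
    using a_ge_4 by simp_all
  have central: "central E'"
    using v_infiniteD(4)[OF a2(1,2)] by (simp add: E'_def)
  have w: "v (a - 1) = E' \<star> (q - 3)"
    using v_Suc[of "a - 2"] a2 by (simp add: nxt_def E'_def)
  have inf: "v (a - 1) \<bullet> x \<bullet> x = 0" "v (a - 1) \<bullet> y \<bullet> x = - E"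
    using v_infiniteD[OF Suc_a(2,3)] by (simp_all add: E_def)
  have E'g: "E' \<star> k \<bullet> g = 0" if k: "k \<noteq> q - 2" for k
  proof -
    consider "k < q - 3" | "k = q - 3" | "q - 3 + 2 \<le> k"
      using k q_ge_7 by linarith
    then show ?thesis
    proof cases
      case 1
      have "E' \<star> k \<bullet> v1 = of_nat (k + 2) *s (E \<star> k) - of_nat (k + 1) *s (E \<star> k)"
        using chain_br_v1[OF central w, of k] 1 inf
        by (simp add: adpow_Suc' adpow_linear E_def[symmetric] del: of_nat_Suc of_nat_add One_nat_def)
      then show ?thesis
        using centralD[OF central 1] centralD[OF central_E 1]
        by (simp add: g_def br_br_right br_linear_simps)
    next
      case 2
      then show ?thesis
        using v_br_v1[OF Suc_a(2,3)] by (simp add: w[symmetric] g_def br_br_right)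
    next
      case 3
      have "E' \<star> k = v (a - 1) \<star> (k - (q - 3))"
        using 3 by (simp add: w adpow_adpow del: One_nat_def)
      then show ?thesis
        using adpow_zero_ge[OF inf(1)] 3 by simp
    qed
  qed
  have "E' \<star> (q - 2) = z"
    by (simp only: q_diff adpow_Suc w[symmetric] z_def)
  then have E'z: "E' \<star> (q - 2) \<bullet> g = 2 *s d"
    by (simp add: zg)
  let ?i = "q - 2 - (J - i)"
  have i: "?i + (J - i) = q - 2" "?i < q - 3" "J - (J - i) = i" "J - i \<le> J"
    using assms q_ge_7 by linarith+
  have "E' \<star> ?i \<bullet> (g \<star> J) = ((- 1) ^ (J - i) * of_nat (J choose (J - i))) *s (E' \<star> ?i \<star> (J - i) \<bullet> g \<star> (J - (J - i)))"
  proof (rule br_adpow_single)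
    fix k assume "k \<le> J" "k \<noteq> J - i"
    then have "?i + k \<noteq> q - 2"
      using i by linarith
    then show "E' \<star> ?i \<star> k \<bullet> g \<star> (J - k) = 0"
      by (simp add: adpow_adpow E'g)
  qed simp
  also have "\<dots> = ((- 1) ^ (J - i) * of_nat (J choose i) * 2) *s (d \<star> i)"
    using binomial_symmetric[of i J] assms by (simp add: adpow_adpow i E'z adpow_linear mult.assoc)
  finally have "E' \<star> ?i \<bullet> (g \<star> J) \<bullet> y = ((- 1) ^ (J - i) * of_nat (J choose i) * 2) *s (d \<star> i \<bullet> y)"
    by (simp add: br_linear_simps)
  moreover have "E' \<star> ?i \<bullet> (g \<star> J) \<bullet> y = 0"
    using br_br_left[of "E' \<star> ?i" "g \<star> J" y] centralD[OF central i(2)] g_adpow_y[of J] assms by simp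
  ultimately show ?thesis
    by simp
qed

text \<open>For J = r + P, with P the highest power of p in r + b = P m, the coefficient is m. The
  bound on 2 r excludes r + b + P = q, and then divisibility by p leaves a gap of at least p, so J
  is in range.\<close>

lemma choose_neq_0_small:
  assumes "p dvd r + b" "1 \<le> b" "b \<le> 2" "2 * r \<le> q"
  shows "\<exists>J. r + 2 \<le> J \<and> J \<le> q - 3 \<and> (of_nat (J choose r) :: 'f) \<noteq> 0"
proof -
  define t where "t = multiplicity p (r + b)"
  define P where "P = p ^ t"
  have "P = p ^ multiplicity p (r + b)"
    by (simp only: P_def t_def)
  then obtain m where P: "r + b = P * m" and m: "(of_nat m :: 'f) \<noteq> 0"
    and pP: "p dvd P" and P5: "5 \<le> P"
    using multiplicity_power_facts[OF assms(1)] assms(2) by (metis add_gr_0 less_le_trans zero_less_one)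
  have less: "r + b + P \<le> q"
    unfolding P_def
  proof (rule power_dvd_less)
    show "p ^ t dvd r + b"
      unfolding P P_def by (rule dvd_triv_left)
  qed (use assms q_ge_7 in linarith)+
  have "r + b + P \<noteq> q"
  proof
    assume eq: "r + b + P = q"
    then have q: "q = P * (m + 1)"
      using P by simp
    have "p ^ t < p ^ qe"
      using eq assms q_eq by (simp add: P_def)
    then have "t < qe"
      using prime_p by (simp add: prime_gt_Suc_0_nat)
    then have "p ^ qe = P * p ^ (qe - t)"
      by (simp add: P_def flip: power_add)
    then have "m + 1 = p ^ (qe - t)"
      using q q_eq P5 by (metis mult_left_cancel not_numeral_le_zero)
    then have "p dvd m + 1"
      using \<open>t < qe\<close> by simp
    then have "5 \<le> m + 1"
      using p_ge_5 dvd_imp_le[of p "m + 1"] by simp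
    then have "P * 4 \<le> r + b"
      using P by simp
    then show False
      using eq assms q_ge_7 by linarith
  qed
  moreover have "p dvd r + b + P"
    using pP by (simp add: P)
  ultimately have "r + b + P + p \<le> q"
    using p_dvd_q less dvd_imp_le[of p "q - (r + b + P)"] by (simp add: dvd_diff_nat)
  then have "r + P \<le> q - 3"
    using assms p_ge_5 by linarith
  moreover have "(of_nat ((r + P) choose r) :: 'f) \<noteq> 0"
  proof -
    have e: "r + P = P * m + (P - b)"
      using P P5 assms by linarith
    have "(r + P) choose r = (r + P) choose P"
      using binomial_symmetric[of r "r + P"] by simp
    then have "(r + P) choose r = (P * m + (P - b)) choose P"
      unfolding e .
    moreover have "(of_nat ((P * m + (P - b)) choose P) :: 'f) = of_nat m"
      unfolding P_def by (rule choose_mult_power) (use P5 assms in \<open>simp add: P_def[symmetric]\<close>)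
    ultimately show ?thesis
      using m by simp
  qed
  ultimately show ?thesis
    using P5 by (intro exI[of _ "r + P"]) auto
qed

text \<open>Differences in m lower t by one, until t = 0 gives 1 = 0. Each difference uses up one of
  the t + 1 equations.\<close>

lemma choose_difference_contradiction:
  assumes "\<And>m. 1 \<le> m \<Longrightarrow> m \<le> t + 1 \<Longrightarrow>
    (of_nat ((n + m) choose t) :: 'f) = c * (if t = 0 then 0 else of_nat ((n + m) choose (t - 1)))"
  shows False
  using assms
proof (induction t)
  case 0
  then show ?case
    using 0[of 1] by simp
next
  case (Suc t)
  have "(of_nat ((n + m) choose t) :: 'f) = c * (if t = 0 then 0 else of_nat ((n + m) choose (t - 1)))"
    if m: "1 \<le> m" "m \<le> t + 1" for m
  proof -
    have 1: "(of_nat ((n + m) choose Suc t) :: 'f) = c * of_nat ((n + m) choose t)"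
      using Suc.prems[of m] m by simp
    have 2: "(of_nat (Suc (n + m) choose Suc t) :: 'f) = c * of_nat (Suc (n + m) choose t)"
      using Suc.prems[of "Suc m"] m by simp
    show ?thesis
      using 1 2 by (cases t) (simp_all add: algebra_simps)
  qed
  then show ?case
    by (rule Suc.IH)
qed

lemma L_central_upto:
  assumes "\<And>i. i < n \<Longrightarrow> e \<star> i \<bullet> y = 0" "L m = span {e}" "1 \<le> m"
  shows "L (m + n) = span {e \<star> n}"
  using assms(1)
proof (induction n)
  case (Suc n)
  then show ?case
    using span_component_Suc_central[of "m + n" "e \<star> n"] assms by (simp add: adpow_Suc)
qed (use assms in simp)

lemma choose_two_eq_0:
  assumes "(of_nat ((n + 2) choose n) :: 'f) = 0"
  shows "(of_nat (n + 2) :: 'f) * (of_nat (n + 2) - 1) = 0"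
proof -
  have "(n + 2) choose n = (n + 2) choose 2"
    using binomial_symmetric[of 2 "n + 2"] by simp
  then show ?thesis
    using of_nat_choose_two[of "n + 2"] assms by simp
qed

lemma first_noncentral_neq:
  assumes r: "r < q - 3" and zero: "\<And>s. s < r \<Longrightarrow> d \<star> s \<bullet> y = 0" and neq: "d \<star> r \<bullet> y \<noteq> 0"
  shows "2 * (- 1) ^ r = \<mu> - 2 - of_nat r" and "r \<noteq> q - 4"
proof -
  have "d \<bullet> (y \<star> r) = (- 1) ^ r *s (d \<star> r \<bullet> y)"
    using br_adpow_single[of r r d y] zero by simp
  then have "(2 * (- 1) ^ r) *s (d \<star> r \<bullet> y) = (\<mu> - 2 - of_nat r) *s (d \<star> r \<bullet> y)"
    using d_br_y_adpow[OF r] by simp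
  then show sign: "2 * (- 1) ^ r = \<mu> - 2 - of_nat r"
    using neq by simp
  \<comment> \<open>For r = q - 4 the sign relation forces \<mu> = -4, while [v_a [y x^(r+1)] y]
    gives (r + 1) \<mu> = 0, that is 12 = 0.\<close>
  show "r \<noteq> q - 4"
  proof
    assume r4: "r = q - 4"
    have n: "q - 3 = Suc r"
      using r4 q_ge_7 by simp
    have "(- 1 :: 'f) ^ r = - 1" "(of_nat r :: 'f) = - 4"
      using r4 minus_one_power_q_diff[of 4] of_nat_q_diff[of 4] q_ge_7 by simp_all
    then have \<mu>: "\<mu> = - 4"
    proof -
      have "\<mu> = 2 * (- 1) ^ r + 2 + of_nat r"
        using sign by (simp add: algebra_simps)
      then show ?thesis
        using \<open>(- 1) ^ r = - 1\<close> \<open>of_nat r = - 4\<close> by simp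
    qed
    have vay: "v a \<bullet> y \<star> Suc k = (1 - \<mu>) *s (d \<star> k)" for k
      by (simp add: adpow_Suc' vayx adpow_linear)
    have "v a \<bullet> (y \<star> Suc r) = (1 - \<mu>) *s (d \<star> r) - (of_nat (Suc r) * \<mu>) *s (d \<star> r)"
      using br_adpow_pair[of 0 "Suc r" "v a" y] adpow_zero_ge[OF vaxx]
      by (simp add: vay vaxy adpow_linear of_nat_Suc[of 0] del: of_nat_Suc)
    also have "\<dots> = ((1 - \<mu>) - of_nat (Suc r) * \<mu>) *s (d \<star> r)"
      by (simp only: scale_left_diff_distrib)
    finally have "v a \<bullet> (y \<star> Suc r) \<bullet> y = ((1 - \<mu>) - of_nat (Suc r) * \<mu>) *s (d \<star> r \<bullet> y)"
      by (simp only: br_linear_simps)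
    moreover have "v a \<bullet> (y \<star> Suc r) \<bullet> y = v a \<bullet> y \<bullet> (y \<star> Suc r)"
      using br_br_left[of "v a" "y \<star> Suc r" y] y_adpow_y_eq_0[of "Suc r"] n by simp
    moreover have "v a \<bullet> y \<bullet> (y \<star> Suc r) = (- 1) ^ Suc r *s (v a \<bullet> y \<star> Suc r \<bullet> y)"
    proof -
      have "v a \<bullet> y \<star> k \<bullet> y = 0" if "k \<le> Suc r" "k \<noteq> Suc r" for k
        using that vayy zero[of "k - 1"] by (cases k) (auto simp: vay br_linear_simps)
      then show ?thesis
        using br_adpow_single[of "Suc r" "Suc r" "v a \<bullet> y" y] by simp
    qed
    ultimately have "((1 - \<mu>) - of_nat (Suc r) * \<mu>) *s (d \<star> r \<bullet> y) = (1 - \<mu>) *s (d \<star> r \<bullet> y)"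
      using \<open>(- 1) ^ r = - 1\<close> by (simp add: vay br_linear_simps)
    then have "of_nat (Suc r) * \<mu> = 0"
      using neq by (simp del: of_nat_Suc)
    moreover have "(of_nat (Suc r) :: 'f) = - 3"
      using \<open>of_nat r = - 4\<close> by simp
    ultimately have "(- 3 :: 'f) * (- 4) = 0"
      using \<mu> by (simp only:)
    then show False
      by simp
  qed
qed

text \<open>
  Take \<open>r\<close> minimal with \<open>[d x\<^sup>r y] \<noteq> 0\<close>, and let \<open>[d x\<^sup>r\<^sup>+\<^sup>1 y] = c [d x\<^sup>r y x]\<close>. Then \<open>d_br_u_pred\<close> reads
  \<open>(1 + c) [d x\<^sup>r y x\<^sup>q\<^sup>-\<^sup>1\<^sup>-\<^sup>r] = 0\<close>, and this product spans the component assumed to be nonzero. The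
  remaining relations exclude \<open>c = -1\<close>.
\<close>

lemma central_d:
  assumes L: "L (Suc a * (q - 1) + 3) \<noteq> {0}"
  shows "central d"
proof -
  have "d \<star> r \<bullet> y = 0" if "r < q - 3" for r
    using that
  proof (induction r rule: less_induct)
    case (less r)
    have zero: "d \<star> s \<bullet> y = 0" if "s < r" for s
      using less that by simp
    show ?case
    proof (rule ccontr)
      assume neq: "d \<star> r \<bullet> y \<noteq> 0"
      note sign = first_noncentral_neq(1)[OF less.prems zero neq]
      have choose_0: "(of_nat (J choose r) :: 'f) = 0" if "r + 2 \<le> J" "J \<le> q - 3" for J
        using choose_mult_d_adpow_y[OF that] neq by simp
      have "r \<noteq> q - 5"
      proof
        assume r: "r = q - 5"
        have r3: "r + 2 = q - 3"
          using r q_ge_7 by simp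
        then have "(of_nat (r + 2) :: 'f) * (of_nat (r + 2) - 1) = 0"
          using choose_two_eq_0[of r] choose_0[of "r + 2"] by simp
        moreover have "(of_nat (r + 2) :: 'f) = - 3"
          unfolding r3 using of_nat_q_diff[of 3] q_ge_7 by simp
        ultimately have "(- 3 :: 'f) * (- 3 - 1) = 0"
          by (simp only:)
        then show False
          by simp
      qed
      then have r6: "r + 3 \<le> q - 3"
        using first_noncentral_neq(2)[OF less.prems zero neq] less.prems by linarith
      have "(of_nat (r + 2) :: 'f) * (of_nat (r + 2) - 1) = 0"
        using choose_two_eq_0[of r] choose_0[of "r + 2"] r6 by simp
      moreover have "(of_nat (r + 2) - 1 :: 'f) = of_nat (r + 1)"
        by simp
      ultimately have r12: "(of_nat (r + 1) :: 'f) = 0 \<or> (of_nat (r + 2) :: 'f) = 0"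
        by (metis mult_eq_0_iff)
      \<comment> \<open>Since r = -1 or r = -2 modulo p, a small r contradicts
        \<open>choose_neq_0_small\<close>. Largeness of r makes it possible to go back up to t + 1
        steps from w in \<open>wyty\<close>.\<close>
      have r_large: "q < 2 * r"
      proof (rule ccontr)
        assume "\<not> q < 2 * r"
        moreover have "p dvd r + 1 \<or> p dvd r + 2"
          using r12 by (simp only: of_nat_eq_0)
        ultimately show False
          using choose_neq_0_small[of r 1] choose_neq_0_small[of r 2] choose_0 by auto
      qed
      define w where "w = d \<star> r"
      define D where "D = a * (q - 1) + 2 + r"
      have L_w: "L D = span {w}"
        unfolding w_def D_def by (rule L_central_upto) (use zero L_d in auto)
      have D: "1 \<le> D"
        by (simp add: D_def)
      have wy: "w \<bullet> y \<noteq> 0"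
        using neq by (simp add: w_def)
      have wL: "w \<in> L D"
        unfolding L_w by (auto intro: span_base)
      have wyy: "w \<bullet> y \<bullet> y = 0"
      proof -
        have "Suc (r - 1) = r"
          using r_large q_ge_7 by linarith
        then have w': "w = d \<star> (r - 1) \<bullet> x"
          unfolding w_def by (metis adpow_Suc)
        have "d \<star> (r - 1) \<bullet> y = 0"
          using zero[of "r - 1"] \<open>Suc (r - 1) = r\<close> by simp
        then have "d \<star> (r - 1) \<bullet> (y \<star> 1) \<bullet> y = 0"
          by (rule br_y_adpow_y) (use q_ge_7 in auto)
        then show ?thesis
          using \<open>d \<star> (r - 1) \<bullet> y = 0\<close> by (simp add: br_br_right br_linear_simps w')
      qed
      have "L (Suc (Suc D)) = span {w \<bullet> y \<bullet> x, w \<bullet> y \<bullet> y}"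
        using covering_span[OF br_y_component[OF wL] wy] by simp
      then have L2: "L (Suc (Suc D)) = span {w \<bullet> y \<bullet> x}"
        by (simp add: wyy insert_commute[of _ 0] span_insert_0)
      have "w \<bullet> x \<bullet> x \<in> L (Suc (Suc D))" "w \<bullet> x \<bullet> y \<in> L (Suc (Suc D))"
        by (intro br_x_component br_y_component wL)+
      then obtain c c2 where c: "w \<bullet> x \<bullet> y = c *s (w \<bullet> y \<bullet> x)" and c2: "w \<bullet> x \<bullet> x = c2 *s (w \<bullet> y \<bullet> x)"
        unfolding L2 by (auto simp: span_singleton)
      have far: "d \<star> (r + s) = c2 *s (w \<bullet> y \<star> (s - 1))" if "2 \<le> s" for s
      proof -
        have "r + s = r + 2 + (s - 2)"
          using that by simp
        then have "d \<star> (r + s) = w \<star> 2 \<star> (s - 2)"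
          unfolding w_def adpow_adpow by (simp only: add.assoc)
        also have "\<dots> = w \<bullet> x \<bullet> x \<star> (s - 2)"
          by (simp only: adpow_2)
        also have "\<dots> = c2 *s (w \<bullet> y \<star> Suc (s - 2))"
          by (simp add: c2 adpow_linear adpow_Suc')
        also have "Suc (s - 2) = s - 1"
          using that by simp
        finally show ?thesis .
      qed
      \<comment> \<open>At the least failing t, brackets of [d x^(r-m)] with [y x^(m+t)] give the
        equations of \<open>choose_difference_contradiction\<close> for m = 1, ..., t + 1.\<close>
      have wyty: "w \<bullet> y \<star> t \<bullet> y = 0" if "t \<le> q - 2 - r" for t
        using that
      proof (induction t rule: less_induct)
        case (less t)
        note IH = less
        show ?case
        proof (cases "t = 0")
          case True
          then show ?thesis
            using wyy by simp
        next
          case False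
          show ?thesis
          proof (rule ccontr)
            assume tneq: "w \<bullet> y \<star> t \<bullet> y \<noteq> 0"
            have "(of_nat ((t + m) choose t) :: 'f) = c * of_nat ((t + m) choose (t - 1))"
              if m: "1 \<le> m" "m \<le> t + 1" for m
            proof -
              have mr: "m \<le> r" "m + t \<le> q - 3"
                using m IH(2) r_large False by linarith+
              have sum0: "d \<star> (r - m) \<star> k \<bullet> y \<star> (m + t - k) = 0"
                if k: "k \<le> m + t" "k \<noteq> m" "k \<noteq> Suc m" for k
              proof (cases "k < m")
                case True
                then show ?thesis
                  using zero[of "r - m + k"] mr by (simp add: adpow_adpow)
              next
                case False
                then have s: "r - m + k = r + (k - m)" "2 \<le> k - m" "k - m - 1 < t"
                  using k mr by linarith+
                then have "w \<bullet> y \<star> (k - m - 1) \<bullet> y = 0"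
                  using IH by simp
                then show ?thesis
                  unfolding adpow_adpow s(1) far[OF s(2)] by (simp add: br_linear_simps)
              qed
              have 1: "d \<star> (r - m) \<star> m \<bullet> y \<star> (m + t - m) = w \<bullet> y \<star> t"
                using mr by (simp add: adpow_adpow w_def)
              have 2: "d \<star> (r - m) \<star> Suc m \<bullet> y \<star> (m + t - Suc m) = c *s (w \<bullet> y \<star> t)"
              proof -
                have "d \<star> (r - m) \<star> Suc m = w \<bullet> x"
                  using mr by (simp add: adpow_adpow w_def adpow_Suc)
                moreover have "Suc (m + t - Suc m) = t"
                  using False by simp
                ultimately show ?thesis
                  using adpow_Suc'[of "w \<bullet> y" "m + t - Suc m"] by (simp add: c adpow_linear)
              qed
              have "d \<star> (r - m) \<bullet> (y \<star> (m + t))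
                = ((- 1) ^ m * of_nat ((m + t) choose m)) *s (w \<bullet> y \<star> t)
                  - ((- 1) ^ m * of_nat ((m + t) choose Suc m)) *s (c *s (w \<bullet> y \<star> t))"
                using br_adpow_pair[of m "m + t" "d \<star> (r - m)" y] sum0 False unfolding 1 2 by simp
              also have "\<dots> = ((- 1) ^ m * (of_nat ((m + t) choose m) - of_nat ((m + t) choose Suc m) * c)) *s (w \<bullet> y \<star> t)"
                by (simp add: algebra_simps)
              finally have "d \<star> (r - m) \<bullet> (y \<star> (m + t)) \<bullet> y
                = ((- 1) ^ m * (of_nat ((m + t) choose m) - of_nat ((m + t) choose Suc m) * c)) *s (w \<bullet> y \<star> t \<bullet> y)"
                by (simp only: br_linear_simps)
              moreover have "d \<star> (r - m) \<bullet> (y \<star> (m + t)) \<bullet> y = 0"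
                by (rule br_y_adpow_y) (use zero[of "r - m"] m mr in auto)
              ultimately have "(of_nat ((m + t) choose m) :: 'f) = of_nat ((m + t) choose Suc m) * c"
                using tneq by simp
              moreover have "(m + t) choose m = (t + m) choose t" "(m + t) choose Suc m = (t + m) choose (t - 1)"
                using binomial_symmetric[of m "m + t"] binomial_symmetric[of "Suc m" "m + t"] False
                by (simp_all add: add.commute)
              ultimately show ?thesis
                by (simp add: mult.commute)
            qed
            then show False
              using choose_difference_contradiction[of t t c] False by simp
          qed
        qed
      qed
      define n where "n = q - 2 - r"
      have n: "q - 1 = r + Suc n" "q - 1 - r = Suc n"
        using less.prems q_ge_7 by (simp_all add: n_def)
      have "L (Suc (Suc D) + n) = span {w \<bullet> y \<bullet> x \<star> n}"
      proof (rule L_central_upto[OF _ L2])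
        show "w \<bullet> y \<bullet> x \<star> i \<bullet> y = 0" if "i < n" for i
          using wyty[of "Suc i"] that by (simp add: n_def adpow_Suc')
      qed simp
      moreover have "Suc (Suc D) + n = Suc a * (q - 1) + 3"
        using less.prems q_ge_7 by (simp add: D_def n_def)
      ultimately have L3: "L (Suc a * (q - 1) + 3) = span {w \<bullet> y \<bullet> x \<star> n}"
        by (simp only:)
      have top: "w \<bullet> y \<star> Suc n \<noteq> 0"
      proof
        assume "w \<bullet> y \<star> Suc n = 0"
        then have "w \<bullet> y \<bullet> x \<star> n = 0"
          by (simp only: adpow_Suc')
        moreover have "span {0} = {0}"
          by simp
        ultimately show False
          using L L3 by (simp only:)
      qed
      have "c = - 1"
      proof -
        have "d \<star> k \<bullet> y \<star> (q - 1 - k) = 0" if "k \<le> q - 1" "k \<noteq> r" "k \<noteq> Suc r" for k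
        proof (cases "k < r")
          case True
          then show ?thesis
            using zero by simp
        next
          case False
          then have k: "k = r + (k - r)" "2 \<le> k - r" "k - r - 1 \<le> q - 2 - r"
            using that by linarith+
          then have "d \<star> k = c2 *s (w \<bullet> y \<star> (k - r - 1))"
            using far[OF k(2)] by simp
          then show ?thesis
            using wyty[OF k(3)] by (simp add: br_linear_simps)
        qed
        then have "d \<bullet> (y \<star> (q - 1)) = ((- 1) ^ r * of_nat (q - 1 choose r)) *s (d \<star> r \<bullet> y \<star> (q - 1 - r))
            - ((- 1) ^ r * of_nat (q - 1 choose Suc r)) *s (d \<star> Suc r \<bullet> y \<star> (q - 1 - Suc r))"
          using less.prems by (intro br_adpow_pair) auto
        moreover have "(- 1) ^ r * of_nat (q - 1 choose r) = (1 :: 'f)"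
          "(- 1) ^ r * of_nat (q - 1 choose Suc r) = (- 1 :: 'f)"
          using coeff_y_adpow_q_pred[of r] coeff_y_adpow_q_pred[of "Suc r"] less.prems by (simp_all add: eq_neg_iff_add_eq_0 neg_eq_iff_add_eq_0)
        moreover have "d \<star> Suc r \<bullet> y \<star> (q - 1 - Suc r) = c *s (w \<bullet> y \<star> Suc n)"
          using n by (simp add: adpow_Suc w_def[symmetric] c adpow_linear adpow_Suc'[symmetric])
        ultimately have "w \<bullet> y \<star> Suc n + c *s (w \<bullet> y \<star> Suc n) = 0"
          using d_br_u_pred n(2) by (simp add: w_def)
        then have "(1 + c) *s (w \<bullet> y \<star> Suc n) = 0"
          by (simp add: scale_left_distrib)
        then show ?thesis
          using top by (simp add: eq_neg_iff_add_eq_0 add.commute)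
      qed
      have wyx: "w \<bullet> y \<bullet> x \<noteq> 0"
        using top by (auto simp: adpow_Suc')
      have dSuc: "d \<star> Suc r \<bullet> y = - (w \<bullet> y \<bullet> x)"
        using c \<open>c = - 1\<close> by (simp add: adpow_Suc w_def)
      \<comment> \<open>With c = -1 also [d x^(r+1) y] is nonzero, so the relation may be used at r
        + 1; it excludes r = -1 modulo p.\<close>
      have "(of_nat (Suc r + 2) :: 'f) * (of_nat (Suc r + 2) - 1) = 0"
      proof -
        have "of_nat (Suc r + 2 choose Suc r) *s (d \<star> Suc r \<bullet> y) = 0"
          by (rule choose_mult_d_adpow_y) (use r6 in auto)
        then show ?thesis
          using choose_two_eq_0[of "Suc r"] wyx by (simp add: dSuc del: of_nat_Suc of_nat_add)
      qed
      moreover have "(of_nat (Suc r + 2) :: 'f) = of_nat (r + 1) + 2"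
        by simp
      ultimately have "(of_nat (r + 1) :: 'f) \<noteq> 0"
        by (auto simp del: of_nat_add of_nat_Suc)
      then have r2: "(of_nat r :: 'f) = - 2"
        using r12 by (simp add: eq_neg_iff_add_eq_0 add.commute)
      \<comment> \<open>For r = -2 this bracket is 0, so \<open>d_br_y_adpow\<close> forces \<mu> =
        1, and the sign relation reads 2 = 1 or -2 = 1.\<close>
      have "d \<bullet> (y \<star> Suc r) = ((- 1) ^ r * of_nat (Suc r)) *s (w \<bullet> y \<bullet> x) - (- 1) ^ r *s (d \<star> Suc r \<bullet> y)"
        using br_adpow_pair[of r "Suc r" d y] zero by (simp add: w_def of_nat_Suc[of 0] del: of_nat_Suc)
      also have "\<dots> = ((- 1) ^ r * of_nat (Suc r) + (- 1) ^ r) *s (w \<bullet> y \<bullet> x)"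
        by (simp add: dSuc scale_left_distrib del: of_nat_Suc)
      also have "(- 1) ^ r * of_nat (Suc r) + (- 1) ^ r = (- 1) ^ r * (of_nat r + 2 :: 'f)"
        by (simp add: algebra_simps)
      finally have "d \<bullet> (y \<star> Suc r) = 0"
        using r2 by simp
      then have "(\<mu> - 2 - of_nat (Suc r)) *s (d \<star> Suc r \<bullet> y) = 0"
        using d_br_y_adpow[of "Suc r"] r6 by simp
      then have "\<mu> = 1"
        using wyx r2 by (simp add: dSuc)
      then have "2 * (- 1) ^ r = (1 :: 'f)"
        using sign r2 by simp
      moreover have "(2 :: 'f) \<noteq> 1"
        using add_cancel_right_right[of "1 :: 'f" 1] by simp
      ultimately show False
        by (cases "even r") (auto simp: neg_eq_iff_add_eq_0)
    qed
  qed
  then show ?thesis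
    by (simp add: central_def)
qed

section \<open>The diamond in degree (a + 1) (q - 1) + 1 and the proof of (b)\<close>

definition w1 :: 'a where "w1 = d \<star> (q - 3)"
definition \<delta> :: 'a where "\<delta> = w1 \<bullet> x \<bullet> y + w1 \<bullet> y \<bullet> x"

lemma w1_adpow: "w1 \<star> n = d \<star> (q - 3 + n)"
  by (simp add: w1_def adpow_adpow)

lemma w1xxx: "w1 \<bullet> x \<bullet> x \<bullet> x = 0"
proof -
  have "w1 \<bullet> x \<bullet> x \<bullet> x = w1 \<star> 3"
    by (simp add: numeral_3_eq_3 adpow_Suc)
  also have "\<dots> = d \<star> q"
    using q_ge_7 by (simp add: w1_adpow)
  finally show ?thesis
    by (simp add: adpow_q_eq_0)
qed

text \<open>Because (1 - \<mu>) d = [v_a y x], the left side is [v_a y x^q].\<close>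

lemma w1xx: "(1 - \<mu>) *s (w1 \<bullet> x \<bullet> x) = 0"
proof -
  have "(1 - \<mu>) *s (w1 \<bullet> x \<bullet> x) = (1 - \<mu>) *s (d \<star> (q - 1))"
    by (simp only: q_diff w1_def adpow_Suc)
  also have "\<dots> = v a \<bullet> y \<bullet> x \<star> (q - 1)"
    by (simp only: vayx adpow_linear)
  also have "\<dots> = v a \<bullet> y \<star> q"
    using q_ge_7 by (simp add: adpow_Suc'[symmetric])
  finally show ?thesis
    by (simp add: adpow_q_eq_0)
qed

lemma nxt_va: "nxt (v a) = \<mu> *s w1"
  by (simp add: nxt_def vaxy adpow_linear w1_def)

lemma vax_v1: "v a \<bullet> x \<bullet> v1 = \<mu> *s (w1 \<bullet> x)"
  using x_br_v1_nxt[OF vaxx] by (simp add: nxt_va br_linear_simps)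

lemma va_v1: "v a \<bullet> v1 = (1 + \<mu>) *s w1"
proof -
  have "v a \<bullet> y \<star> (q - 2) = (1 - \<mu>) *s w1"
    by (simp only: q_diff adpow_Suc' vayx adpow_linear w1_def)
  then have "v a \<bullet> v1 = (1 - \<mu>) *s w1 + (2 * \<mu>) *s w1"
    using br_v1[OF vaxx] by (simp add: nxt_va)
  also have "\<dots> = (1 + \<mu>) *s w1"
    by (simp only: scale_left_distrib[symmetric]) simp
  finally show ?thesis .
qed

context
  assumes central_d': "central d"
begin

lemma L_w1: "L (Suc a * (q - 1)) = span {w1}"
proof -
  have "Suc a * (q - 1) = a * (q - 1) + 2 + (q - 3)"
    using q_ge_7 by simp
  then show ?thesis
    unfolding w1_def using L_central[OF central_d' L_d, of "q - 3"] by (simp only:)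
qed

lemma w1yy: "w1 \<bullet> y \<bullet> y = 0" and w1yxy: "w1 \<bullet> y \<bullet> x \<bullet> y = 0" and w1xyy: "w1 \<bullet> x \<bullet> y \<bullet> y = 0"
  using central_after[OF central_d' w1_def] by auto

lemma d_v1: "d \<bullet> v1 = - (2 *s (w1 \<bullet> y \<bullet> x)) - w1 \<bullet> x \<bullet> y"
  by (rule chain_start_br_v1[OF central_d' w1_def])

lemma d_v1': "d \<bullet> v1 = - (w1 \<bullet> y \<bullet> x) - \<delta>"
  using scale_left_distrib[of 1 1 "w1 \<bullet> y \<bullet> x"] by (simp add: d_v1 \<delta>_def)

text \<open>Expand [d [y x^(q-1)]] = 0: modulo p all signed coefficients are 1, and y centralizes
  all but the last three terms.\<close>

lemma \<delta>x: "\<delta> \<bullet> x = - (w1 \<bullet> x \<bullet> x \<bullet> y)"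
proof -
  have "0 = (\<Sum>k\<le>q - 1. ((- 1) ^ k * of_nat (q - 1 choose k)) *s (d \<star> k \<bullet> y \<star> (q - 1 - k)))"
    using d_br_u_pred br_adpow[of d y "q - 1"] by simp
  also have "\<dots> = (\<Sum>k\<in>{q - 3, q - 2, q - 1}. ((- 1) ^ k * of_nat (q - 1 choose k)) *s (d \<star> k \<bullet> y \<star> (q - 1 - k)))"
  proof (rule sum.mono_neutral_right)
    show "\<forall>k\<in>{..q - 1} - {q - 3, q - 2, q - 1}. ((- 1) ^ k * of_nat (q - 1 choose k)) *s (d \<star> k \<bullet> y \<star> (q - 1 - k)) = 0"
    proof
      fix k assume k: "k \<in> {..q - 1} - {q - 3, q - 2, q - 1}"
      then have "k \<le> q - 1" "k \<noteq> q - 3" "k \<noteq> q - 2" "k \<noteq> q - 1"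
        by auto
      then have "k < q - 3"
        by linarith
      then show "((- 1) ^ k * of_nat (q - 1 choose k)) *s (d \<star> k \<bullet> y \<star> (q - 1 - k)) = 0"
        using centralD[OF central_d'] by simp
    qed
  qed auto
  also have "\<dots> = (\<Sum>k\<in>{q - 3, q - 2, q - 1}. d \<star> k \<bullet> y \<star> (q - 1 - k))"
  proof (rule sum.cong)
    fix k assume "k \<in> {q - 3, q - 2, q - 1}"
    then have "k \<le> q - 1"
      by auto
    then show "((- 1) ^ k * of_nat (q - 1 choose k)) *s (d \<star> k \<bullet> y \<star> (q - 1 - k)) = d \<star> k \<bullet> y \<star> (q - 1 - k)"
      using coeff_y_adpow_q_pred by (simp only: scale_one)
  qed simp
  also have "\<dots> = w1 \<bullet> y \<bullet> x \<bullet> x + (w1 \<bullet> x \<bullet> y \<bullet> x + w1 \<bullet> x \<bullet> x \<bullet> y)"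
  proof -
    have "q - 1 - (q - 3) = Suc (Suc 0)" "q - 1 - (q - 2) = Suc 0" "q - 1 - (q - 1) = 0"
      using q_ge_7 by auto
    moreover have "q - 3 \<noteq> q - 2" "q - 3 \<noteq> q - 1" "q - 2 \<noteq> q - 1"
      using q_ge_7 by auto
    moreover have "d \<star> (q - 2) = w1 \<bullet> x" "d \<star> (q - 1) = w1 \<bullet> x \<bullet> x"
      by (simp_all only: q_diff adpow_Suc w1_def)
    ultimately show ?thesis
      by (simp add: adpow_Suc adpow_2 w1_def del: One_nat_def)
  qed
  finally show ?thesis
    by (simp add: \<delta>_def br_linear_simps eq_neg_iff_add_eq_0 algebra_simps)
qed

lemma \<delta>y: "\<delta> \<bullet> y = 0"
  by (simp add: \<delta>_def br_linear_simps w1yxy w1xyy)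

lemma vay_v1: "v a \<bullet> y \<bullet> v1 = (\<mu> - 1) *s (w1 \<bullet> y)"
proof -
  have "central (v a \<bullet> y \<bullet> x)"
    using central_d' by (simp add: vayx central_def adpow_linear br_linear_simps)
  then have "v a \<bullet> y \<bullet> v1 = - ((1 - \<mu>) *s (w1 \<bullet> y))"
    using y_br_v1[OF vayy] by (simp add: vayx adpow_linear w1_def br_linear_simps)
  then show ?thesis
    by (simp add: scale_left_diff_distrib)
qed

lemma v1x_vay: "v1 \<bullet> x \<bullet> (v a \<bullet> y) = (\<mu> - 1) *s \<delta>"
proof -
  have "v1 \<bullet> x \<bullet> (v a \<bullet> y) = - (v a \<bullet> y \<bullet> (v1 \<bullet> x))"
    by (rule br_anti)
  also have "\<dots> = - ((\<mu> - 1) *s (w1 \<bullet> y \<bullet> x) - (1 - \<mu>) *s (d \<bullet> v1))"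
    by (simp add: br_br_right vay_v1 vayx br_linear_simps)
  also have "\<dots> = (\<mu> - 1) *s \<delta>"
    by (simp add: d_v1' algebra_simps)
  finally show ?thesis .
qed

text \<open>
  Evaluate \<open>[[v\<^sub>l x] [v\<^sub>m y]]\<close> with \<open>l + m = a + 1\<close> starting from either end, \<open>l = 1\<close> and \<open>m = 1\<close>.
\<close>

lemma \<delta>_relation: "(2 * \<mu> - 1) *s \<delta> = of_nat (a - 1) *s (d \<bullet> v1)"
proof -
  have "v l \<bullet> x \<bullet> yh (Suc a - l) = (- 1) ^ l *s ((1 - \<mu>) *s \<delta> + of_nat (l - 1) *s (d \<bullet> v1))"
    if "1 \<le> l" "l \<le> a" for l
    using that
  proof (induction l rule: dec_induct)
    case base
    then show ?case
      using v1x_vay a_ge_3 by (simp add: yh_def algebra_simps)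
  next
    case (step l)
    have sub: "Suc a - Suc l = a - l" "Suc (a - l) = Suc a - l"
      using step by auto
    have "v (Suc l) \<bullet> x \<bullet> yh (a - l) = v l \<bullet> x \<bullet> v1 \<bullet> yh (a - l)"
      using vx_br_v1[of l] step by simp
    also have "\<dots> = v l \<bullet> x \<bullet> yh (a - l) \<bullet> v1 - v l \<bullet> x \<bullet> (yh (a - l) \<bullet> v1)"
      by (simp add: br_br_right)
    also have "yh (a - l) \<bullet> v1 = yh (Suc a - l)"
      using yh_br_v1[of "a - l"] step sub by simp
    also have "v l \<bullet> x \<bullet> yh (a - l) = (- 1) ^ (l - 1) *s d"
      using vx_br_yh[of l "a - l"] step by simp
    also have "(- 1) ^ (l - 1) *s d \<bullet> v1 = - ((- 1) ^ l *s (d \<bullet> v1))"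
      using step by (cases l) (simp_all add: br_linear_simps)
    also have "v l \<bullet> x \<bullet> yh (Suc a - l) = (- 1) ^ l *s ((1 - \<mu>) *s \<delta> + of_nat (l - 1) *s (d \<bullet> v1))"
      using step by simp
    finally have *: "v (Suc l) \<bullet> x \<bullet> yh (a - l)
      = - ((- 1) ^ l *s (d \<bullet> v1)) - (- 1) ^ l *s ((1 - \<mu>) *s \<delta> + of_nat (l - 1) *s (d \<bullet> v1))" .
    have "(of_nat l :: 'f) = 1 + of_nat (l - 1)"
      using step by (cases l) auto
    then show ?case
      unfolding sub * by (simp add: algebra_simps)
  qed
  from this[of a] have "v a \<bullet> x \<bullet> yh 1 = (1 - \<mu>) *s \<delta> + of_nat (a - 1) *s (d \<bullet> v1)"
    using even_a a_ge_3 by simp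
  moreover have "v a \<bullet> x \<bullet> yh 1 = \<mu> *s \<delta>"
  proof -
    have "v a \<bullet> x \<bullet> g = \<mu> *s (w1 \<bullet> x \<bullet> y - d \<bullet> v1)"
      by (simp add: g_def br_br_right vax_v1 vaxy br_linear_simps algebra_simps)
    also have "w1 \<bullet> x \<bullet> y - d \<bullet> v1 = 2 *s \<delta>"
      using scale_left_distrib[of 1 1 \<delta>] by (simp add: d_v1' \<delta>_def)
    finally show ?thesis
      by (simp add: yh_def br_linear_simps)
  qed
  ultimately have "\<mu> *s \<delta> - (1 - \<mu>) *s \<delta> = of_nat (a - 1) *s (d \<bullet> v1)"
    by (metis add_diff_cancel_left')
  moreover have "2 * \<mu> - 1 = \<mu> - (1 - \<mu>)"
    by simp
  ultimately show ?thesis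
    by (simp only: scale_left_diff_distrib)
qed

lemma Suc_a_pos: "1 \<le> Suc a * (q - 1)"
  using q_ge_7 by simp

lemma w1_in_L: "w1 \<in> L (Suc a * (q - 1))"
  unfolding L_w1 by (simp add: span_base)

lemma L_w1_plus_3:
  assumes "w1 \<bullet> x \<bullet> x \<bullet> y = 0" "w1 \<bullet> x \<bullet> y \<bullet> x = 0" "w1 \<bullet> y \<bullet> x \<bullet> x = 0"
  shows "L (Suc a * (q - 1) + 3) = {0}"
proof -
  let ?S = "{w1 \<bullet> x \<bullet> x, w1 \<bullet> x \<bullet> y, w1 \<bullet> y \<bullet> x, w1 \<bullet> y \<bullet> y}"
  have "L (Suc (Suc (Suc (Suc a * (q - 1))))) = span ((\<lambda>u. u \<bullet> x) ` ?S \<union> (\<lambda>u. u \<bullet> y) ` ?S)"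
    by (rule span_component_Suc[OF span_component_Suc_Suc[OF L_w1 Suc_a_pos]]) simp
  also have "(\<lambda>u. u \<bullet> x) ` ?S \<union> (\<lambda>u. u \<bullet> y) ` ?S = {0}"
    using assms w1xxx w1yy w1yxy w1xyy by auto
  finally show ?thesis
    by (simp add: numeral_3_eq_3)
qed

text \<open>If [w1 x x y] = 0, then \<delta> is killed by x and \<open>\<delta>_relation\<close>
  bracketed with x kills the rest. Otherwise \<mu> = 1. If then [w1 y] = 0, the relation becomes a
  \<delta> = 0; if not, covering makes [w1 x x] a multiple of [w1 y x], which y kills.\<close>

lemma L_w1_plus_3_eq_0:
  assumes a: "(of_nat (a - 1) :: 'f) \<noteq> 0"
    and exc: "\<not> ((of_nat a :: 'f) = 0 \<and> \<mu> = 1 \<and> w1 \<bullet> y = 0)"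
  shows "L (Suc a * (q - 1) + 3) = {0}"
proof -
  have rel: "(2 * \<mu> - 1) *s (\<delta> \<bullet> x) = of_nat (a - 1) *s (- (w1 \<bullet> y \<bullet> x \<bullet> x) - \<delta> \<bullet> x)"
    using arg_cong[OF \<delta>_relation, of "\<lambda>u. u \<bullet> x"] by (simp only: d_v1' br_linear_simps)
  have xyx: "w1 \<bullet> x \<bullet> y \<bullet> x = \<delta> \<bullet> x - w1 \<bullet> y \<bullet> x \<bullet> x"
    by (simp add: \<delta>_def br_linear_simps)
  show ?thesis
  proof (cases "w1 \<bullet> x \<bullet> x \<bullet> y = 0")
    case True
    then have "\<delta> \<bullet> x = 0"
      using \<delta>x by simp
    moreover from this have "w1 \<bullet> y \<bullet> x \<bullet> x = 0"
      using rel a by simp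
    ultimately show ?thesis
      using xyx True by (intro L_w1_plus_3) simp_all
  next
    case False
    then have \<mu>: "\<mu> = 1"
      using w1xx by auto
    show ?thesis
    proof (cases "w1 \<bullet> y = 0")
      case True
      then have d: "\<delta> = w1 \<bullet> x \<bullet> y" and a0: "(of_nat a :: 'f) \<noteq> 0"
        using exc \<mu> by (simp_all add: \<delta>_def)
      have "\<delta> + of_nat (a - 1) *s \<delta> = 0"
        using \<delta>_relation True \<mu> by (simp add: d_v1' eq_neg_iff_add_eq_0)
      then have "(1 + of_nat (a - 1)) *s \<delta> = 0"
        by (simp add: scale_left_distrib)
      moreover have "1 + of_nat (a - 1) = (of_nat a :: 'f)"
        using a_ge_3 by (cases a) simp_all
      ultimately have "\<delta> = 0"
        using a0 by simp
      then show ?thesis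
        using \<delta>x False by simp
    next
      case wy: False
      have "L (Suc (Suc (Suc a * (q - 1)))) = span {w1 \<bullet> y \<bullet> x, w1 \<bullet> y \<bullet> y}"
        using covering_span[OF br_y_component[OF w1_in_L] wy] by simp
      then have "L (Suc (Suc (Suc a * (q - 1)))) = span {w1 \<bullet> y \<bullet> x}"
        by (simp add: w1yy insert_commute[of _ 0] span_insert_0)
      moreover have "w1 \<bullet> x \<bullet> x \<in> L (Suc (Suc (Suc a * (q - 1))))"
        by (intro br_x_component w1_in_L)
      ultimately obtain c where "w1 \<bullet> x \<bullet> x = c *s (w1 \<bullet> y \<bullet> x)"
        by (auto simp: span_singleton)
      then show ?thesis
        using False w1yxy by (simp add: br_linear_simps)
    qed
  qed
qed

text \<open>Now \<open>\<delta>_relation\<close> reads (2 \<mu> - 1) \<delta> = 0. Whichever of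
  \<delta> and [w1 x x] is not yet 0 is annihilated by x and y, hence is 0 by covering, as the next
  component is nonzero.\<close>

lemma infinite_w1:
  assumes a: "(of_nat (a - 1) :: 'f) = 0" and L: "L (Suc a * (q - 1) + 3) \<noteq> {0}"
  shows "infinite w1"
proof -
  have kill: "u = 0" if "u \<in> L (Suc (Suc (Suc a * (q - 1))))" "u \<bullet> x = 0" "u \<bullet> y = 0" for u
  proof (rule ccontr)
    assume "u \<noteq> 0"
    then have "L (Suc (Suc (Suc (Suc a * (q - 1))))) = {0}"
      using covering_eq_0[OF that(1)] that by simp
    then show False
      using L by (simp only: numeral_3_eq_3 add_Suc_right add_0_right)
  qed
  have \<delta>L: "\<delta> \<in> L (Suc (Suc (Suc a * (q - 1))))"
    unfolding \<delta>_def
    by (intro subspace_add[OF subspace_component] br_x_component br_y_component w1_in_L)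
  have rel: "(2 * \<mu> - 1) *s \<delta> = 0"
    using \<delta>_relation a by simp
  have "w1 \<bullet> x \<bullet> x = 0 \<and> \<delta> = 0"
  proof (cases "\<mu> = 1")
    case True
    then have "\<delta> = 0"
      using rel by simp
    moreover have "w1 \<bullet> x \<bullet> x = 0"
    proof (rule kill)
      show "w1 \<bullet> x \<bullet> x \<in> L (Suc (Suc (Suc a * (q - 1))))"
        by (intro br_x_component w1_in_L)
    qed (use \<delta>x w1xxx \<open>\<delta> = 0\<close> in auto)
    ultimately show ?thesis
      by simp
  next
    case False
    then have "w1 \<bullet> x \<bullet> x = 0"
      using w1xx by simp
    moreover from this have "\<delta> = 0"
      using \<delta>x \<delta>y by (intro kill[OF \<delta>L]) auto
    ultimately show ?thesis
      by simp
  qed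
  then have xx: "w1 \<bullet> x \<bullet> x = 0" and "w1 \<bullet> y \<bullet> x + w1 \<bullet> x \<bullet> y = 0"
    by (simp_all add: \<delta>_def add.commute)
  then have "w1 \<bullet> y \<bullet> x = - (w1 \<bullet> x \<bullet> y)"
    by (simp add: eq_neg_iff_add_eq_0)
  with xx show ?thesis
    by (rule infinite_central[OF central_d' w1_def _ w1yy])
qed

end

section \<open>The case \<open>a \<equiv> 1 (mod p)\<close>\<close>

text \<open>The sequence restarts with \<open>w1\<close> at a + 1, since \<open>nxt (v a)\<close> is
  \<mu> times \<open>w1\<close> and would be 0 for \<mu> = 0.\<close>

definition vv :: "nat \<Rightarrow> 'a" where
  "vv m = (if m \<le> a then v m else (nxt ^^ (m - a - 1)) w1)"

lemma vv_le: "m \<le> a \<Longrightarrow> vv m = v m"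
  by (simp add: vv_def)

lemma vv_Suc_a: "vv (Suc a) = w1"
  by (simp add: vv_def)

lemma vv_nxt:
  assumes "a < m"
  shows "vv (Suc m) = nxt (vv m)"
proof -
  have "Suc m - a - 1 = Suc (m - a - 1)"
    using assms by simp
  then show ?thesis
    using assms by (simp add: vv_def del: One_nat_def)
qed

lemma vv_infinite_step:
  assumes "a < m" "infinite (vv m)"
  shows "vv m \<bullet> v1 = vv (Suc m)" "vv m \<bullet> x \<bullet> v1 = vv (Suc m) \<bullet> x"
    "vv m \<bullet> y \<bullet> v1 = vv (Suc m) \<bullet> y"
    "vv m \<bullet> x \<bullet> y \<bullet> v1 = - (2 *s (vv (Suc m) \<bullet> y \<bullet> x)) - vv (Suc m) \<bullet> x \<bullet> y"
  using infinite_br_v1[OF assms(2)] vv_nxt[OF assms(1)] by simp_all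

text \<open>Apply Leibniz' rule to both summands; infinite type cancels [v_l x y v_m] against
  [v_l y x v_m]. The right side is antisymmetric in l and m, which makes the comparison with the
  swapped indices productive.\<close>

lemma vx_br_vy:
  assumes "2 \<le> l" "l < a" "2 \<le> m" "m < a"
  shows "v l \<bullet> x \<bullet> v m \<bullet> y + v l \<bullet> y \<bullet> v m \<bullet> x
    = v l \<bullet> x \<bullet> (v m \<bullet> y) - v m \<bullet> x \<bullet> (v l \<bullet> y)"
proof -
  have "v l \<bullet> x \<bullet> v m \<bullet> y = v l \<bullet> x \<bullet> y \<bullet> v m + v l \<bullet> x \<bullet> (v m \<bullet> y)"
    by (rule br_br_left)
  moreover have "v l \<bullet> y \<bullet> v m \<bullet> x = v l \<bullet> y \<bullet> x \<bullet> v m + v l \<bullet> y \<bullet> (v m \<bullet> x)"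
    by (rule br_br_left)
  moreover have "v l \<bullet> y \<bullet> (v m \<bullet> x) = - (v m \<bullet> x \<bullet> (v l \<bullet> y))"
    by (rule br_anti)
  ultimately show ?thesis
    using v_infiniteD(3)[OF assms(1,2)] by (simp add: br_linear_simps)
qed

context
  fixes P m :: nat and s :: nat
  assumes cd: "central d" and P_def: "P = p ^ s" and P5: "5 \<le> P" and odd_P: "odd P"
begin

lemmas choose_P = choose_power_cases[OF P_def]

lemma d_br_v1_eq: "infinite w1 \<Longrightarrow> d \<bullet> v1 = w1 \<bullet> x \<bullet> y"
  using d_v1[OF cd] scale_left_distrib[of 1 1 "w1 \<bullet> x \<bullet> y"] by (simp add: infinite_def)

lemma vv_br_v1:
  assumes "2 \<le> i" "a < i \<Longrightarrow> infinite (vv i)"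
  shows "vv i \<bullet> v1 = (if i = a then 1 + \<mu> else 1) *s vv (Suc i)"
    "vv i \<bullet> y \<bullet> v1 = (if i = a then \<mu> - 1 else 1) *s (vv (Suc i) \<bullet> y)"
proof -
  consider "i < a" | "i = a" | "a < i"
    by linarith
  then have "vv i \<bullet> v1 = (if i = a then 1 + \<mu> else 1) *s vv (Suc i)
    \<and> vv i \<bullet> y \<bullet> v1 = (if i = a then \<mu> - 1 else 1) *s (vv (Suc i) \<bullet> y)"
  proof cases
    case 1
    then show ?thesis
      using v_br_v1[OF assms(1)] by (simp add: vv_le)
  next
    case 2
    then show ?thesis
      using va_v1 vay_v1[OF cd] by (simp add: vv_le vv_Suc_a)
  next
    case 3
    then show ?thesis
      using vv_infinite_step[of i] assms by simp
  qed
  then show "vv i \<bullet> v1 = (if i = a then 1 + \<mu> else 1) *s vv (Suc i)"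
    "vv i \<bullet> y \<bullet> v1 = (if i = a then \<mu> - 1 else 1) *s (vv (Suc i) \<bullet> y)"
    by auto
qed

context
  assumes a: "a - 1 = P * m" and m2: "2 \<le> m"
begin

lemma aP: "a = P * m + 1" "2 * P \<le> a - 1" "a - P - 1 = P * (m - 1)" "2 \<le> a - P"
proof -
  show 1: "a = P * m + 1"
    using a a_ge_3 by simp
  have "P * 2 \<le> P * m"
    using m2 by (rule mult_le_mono2)
  then show "2 * P \<le> a - 1" "2 \<le> a - P"
    using 1 P5 by linarith+
  show "a - P - 1 = P * (m - 1)"
    using 1 by (simp add: diff_mult_distrib2)
qed

text \<open>The initial value comes from [v_a [v1 x]] = (1 + \<mu>) [w1 x] - \<mu> [w1 x]. The
  irregular factor 1 + \<mu> sits at M = a, where \<open>shifted_products\<close> allows any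
  value.\<close>

lemma vx_br_vv:
  assumes inf: "\<And>i. 1 \<le> i \<Longrightarrow> i < j \<Longrightarrow> infinite (vv (a + i))"
    and lm: "1 \<le> l" "l < a" "2 \<le> k" "l + k \<le> a + j"
  shows "v l \<bullet> x \<bullet> vv k = (if k \<le> a
    then ((- 1) ^ (a - k) * of_nat (l - 1 choose (a - k))) *s - (vv (a + Suc (l - 1 - (a - k))) \<bullet> x) else 0)"
proof (rule shifted_products[where A = "\<lambda>l. v l \<bullet> x" and B = vv and N = "a - 1" and T = "a + j"
      and t = "\<lambda>i. if i = a then 1 + \<mu> else 1" and \<psi> = "\<lambda>i. - (vv (a + Suc i) \<bullet> x)" and ?m0.0 = 2])
  show "v l \<bullet> x \<bullet> v1 = v (Suc l) \<bullet> x" if "1 \<le> l" "l < a - 1" for l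
    using vx_br_v1[of l] that by simp
  show "vv i \<bullet> v1 = (if i = a then 1 + \<mu> else 1) *s vv (Suc i)" if "2 \<le> i" "Suc (Suc i) \<le> a + j" for i
    using vv_br_v1(1)[of i] inf[of "i - a"] that by simp
  show "v 1 \<bullet> x \<bullet> vv i = (if i = a then - (vv (a + Suc 0) \<bullet> x) else 0)"
    if i: "2 \<le> i" "Suc i \<le> a + j" for i
  proof -
    have 1: "v 1 \<bullet> x \<bullet> vv i = - (vv i \<bullet> (v1 \<bullet> x))"
      by (simp add: br_anti[of "v1 \<bullet> x"])
    consider "i < a" | "i = a" | "a < i"
      by linarith
    then show ?thesis
    proof cases
      case 1
      then show ?thesis
        using infinite_br_v1x[OF v_infinite[OF i(1)]] \<open>v 1 \<bullet> x \<bullet> vv i = _\<close> by (simp add: vv_le)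
    next
      case 2
      then show ?thesis
        unfolding 1 using va_v1 vax_v1
        by (simp add: vv_le vv_Suc_a br_br_right br_linear_simps scale_left_distrib)
    next
      case 3
      then show ?thesis
        unfolding 1 using infinite_br_v1x[of "vv i"] inf[of "i - a"] i by simp
    qed
  qed
  show "- (vv (a + Suc i) \<bullet> x) \<bullet> v1 = - (vv (a + Suc (Suc i)) \<bullet> x)" if "a + Suc (Suc i) \<le> a + j" for i
    using vv_infinite_step(2)[of "a + Suc i"] inf[of "Suc i"] that by (simp add: br_linear_simps)
qed (use lm in auto)

lemma vy_br_vv:
  assumes inf: "\<And>i. 1 \<le> i \<Longrightarrow> i < j \<Longrightarrow> infinite (vv (a + i))"
    and lm: "1 \<le> l" "l < a" "2 \<le> k" "l + k \<le> a + j"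
  shows "yh l \<bullet> vv k = (if k \<le> a
    then ((- 1) ^ (a - k) * of_nat (l - 1 choose (a - k))) *s - (vv (a + Suc (l - 1 - (a - k))) \<bullet> y) else 0)"
proof (rule shifted_products[where A = yh and B = vv and N = "a - 1" and T = "a + j"
      and t = "\<lambda>i. if i = a then 1 + \<mu> else 1" and \<psi> = "\<lambda>i. - (vv (a + Suc i) \<bullet> y)" and ?m0.0 = 2])
  show "yh l \<bullet> v1 = yh (Suc l)" if "1 \<le> l" "l < a - 1" for l
    using yh_br_v1[of l] that by simp
  show "vv i \<bullet> v1 = (if i = a then 1 + \<mu> else 1) *s vv (Suc i)" if "2 \<le> i" "Suc (Suc i) \<le> a + j" for i
    using vv_br_v1(1)[of i] inf[of "i - a"] that by simp
  show "yh 1 \<bullet> vv i = (if i = a then - (vv (a + Suc 0) \<bullet> y) else 0)"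
    if i: "2 \<le> i" "Suc i \<le> a + j" for i
  proof -
    have 1: "yh 1 \<bullet> vv i = - ((1 / 2) *s (vv i \<bullet> g))"
      by (simp add: yh_def br_linear_simps br_anti[of g])
    consider "i < a" | "i = a" | "a < i"
      by linarith
    then show ?thesis
    proof cases
      case 1
      then show ?thesis
        using infinite_br_g[OF v_infinite[OF i(1)]] \<open>yh 1 \<bullet> vv i = _\<close> by (simp add: vv_le)
    next
      case 2
      \<comment> \<open>The factor is 2 for every type \<mu>, and the factor 1/2 in
        \<open>yh 1\<close> removes it.\<close>
      have "v a \<bullet> g = ((1 + \<mu>) - (\<mu> - 1)) *s (w1 \<bullet> y)"
        unfolding g_def br_br_right va_v1 vay_v1[OF cd]
        by (simp only: br_linear_simps scale_left_diff_distrib[of "1 + \<mu>"])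
      then show ?thesis
        unfolding 1 using 2 by (simp add: vv_le vv_Suc_a)
    next
      case 3
      then show ?thesis
        unfolding 1 using infinite_br_g[of "vv i"] inf[of "i - a"] i by simp
    qed
  qed
  show "- (vv (a + Suc i) \<bullet> y) \<bullet> v1 = - (vv (a + Suc (Suc i)) \<bullet> y)" if "a + Suc (Suc i) \<le> a + j" for i
    using vv_infinite_step(3)[of "a + Suc i"] inf[of "Suc i"] that by (simp add: br_linear_simps)
qed (use lm in auto)

lemma vx_br_vvy:
  assumes inf: "\<And>i. 1 \<le> i \<Longrightarrow> i \<le> j \<Longrightarrow> infinite (vv (a + i))" and j: "1 \<le> j"
    and lm: "1 \<le> l" "l < a" "2 \<le> k" "l + k \<le> a + j"
  shows "v l \<bullet> x \<bullet> (vv k \<bullet> y) = (if k \<le> a - 1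
    then ((- 1) ^ (a - 1 - k) * of_nat (l - 1 choose (a - 1 - k))) *s
      (\<lambda>i. if i = 0 then d else vv (a + i) \<bullet> x \<bullet> y) (l - 1 - (a - 1 - k)) else 0)"
proof (rule shifted_products[where A = "\<lambda>l. v l \<bullet> x" and B = "\<lambda>i. vv i \<bullet> y" and N = "a - 1" and T = "a + j"
      and t = "\<lambda>i. if i = a then \<mu> - 1 else 1" and ?m0.0 = 2])
  have w1: "infinite w1"
    using inf[of 1] j by (simp add: vv_Suc_a)
  show "v l \<bullet> x \<bullet> v1 = v (Suc l) \<bullet> x" if "1 \<le> l" "l < a - 1" for l
    using vx_br_v1[of l] that by simp
  show "vv i \<bullet> y \<bullet> v1 = (if i = a then \<mu> - 1 else 1) *s (vv (Suc i) \<bullet> y)"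
    if "2 \<le> i" "Suc (Suc i) \<le> a + j" for i
    using vv_br_v1(2)[of i] inf[of "i - a"] that by simp
  show "v 1 \<bullet> x \<bullet> (vv i \<bullet> y) = (if i = a - 1 then (if (0::nat) = 0 then d else vv (a + 0) \<bullet> x \<bullet> y) else 0)"
    if i: "2 \<le> i" "Suc i \<le> a + j" for i
  proof -
    consider "i < a" | "i = a" | "a < i"
      by linarith
    then show ?thesis
    proof cases
      case 1
      then show ?thesis
        using v1x_br_yh[of i] i by (simp add: vv_le yh_def)
    next
      case 2
      have "\<delta> = 0"
        using w1 by (simp add: infinite_def \<delta>_def)
      then show ?thesis
        using v1x_vay[OF cd] 2 Suc_a(3) by (auto simp: vv_le)
    next
      case 3
      have inf_i: "infinite (vv i)" "infinite (vv (Suc i))"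
        using inf[of "i - a"] inf[of "Suc i - a"] i 3 by auto
      have "v1 \<bullet> x \<bullet> (vv i \<bullet> y) = - (vv i \<bullet> y \<bullet> (v1 \<bullet> x))"
        by (rule br_anti)
      also have "\<dots> = - (vv (Suc i) \<bullet> y \<bullet> x + vv i \<bullet> x \<bullet> y \<bullet> v1)"
        using vv_infinite_step(3)[OF 3 inf_i(1)] inf_i(1)
        by (simp add: infinite_def br_br_right br_linear_simps)
      also have "\<dots> = vv (Suc i) \<bullet> y \<bullet> x + vv (Suc i) \<bullet> x \<bullet> y"
        using vv_infinite_step(4)[OF 3 inf_i(1)] scale_left_distrib[of 1 1 "vv (Suc i) \<bullet> y \<bullet> x"] by simp
      also have "\<dots> = 0"
        using inf_i(2) by (simp add: infinite_def)
      finally show ?thesis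
        using 3 by auto
    qed
  qed
  show "(if i = 0 then d else vv (a + i) \<bullet> x \<bullet> y) \<bullet> v1
      = (if Suc i = 0 then d else vv (a + Suc i) \<bullet> x \<bullet> y)" if i: "a - 1 + Suc (Suc i) \<le> a + j" for i
  proof (cases "i = 0")
    case True
    then show ?thesis
      using d_br_v1_eq[OF w1] by (simp add: vv_Suc_a)
  next
    case False
    have "infinite (vv (a + i))" "infinite (vv (Suc (a + i)))"
      using inf[of i] inf[of "Suc i"] i False a_ge_3 by auto
    then have "vv (a + i) \<bullet> x \<bullet> y \<bullet> v1 = vv (Suc (a + i)) \<bullet> x \<bullet> y"
      using vv_infinite_step(4)[of "a + i"] False scale_left_distrib[of 1 1 "vv (Suc (a + i)) \<bullet> x \<bullet> y"]
      by (simp add: infinite_def)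
    then show ?thesis
      using False by simp
  qed
qed (use lm in auto)

text \<open>With l = j + P and k = a - P the coefficient is 1 modulo p, and for swapped indices it
  is C(P (m - 1), j - 1) = 0. Adding \<open>vx_br_vy\<close> for both orders gives the relation of
  infinite type.\<close>

lemma infinite_vv:
  assumes w1: "infinite w1"
  shows "1 \<le> j \<Longrightarrow> j \<le> P \<Longrightarrow> infinite (vv (a + j))"
proof (induction j rule: less_induct)
  case (less j)
  show ?case
  proof (cases "j = 1")
    case True
    then show ?thesis
      using w1 by (simp add: vv_Suc_a)
  next
    case False
    then have j: "2 \<le> j" "j \<le> P"
      using less.prems by auto
    have inf: "infinite (vv (a + i))" if "1 \<le> i" "i < j" for i
      using less.IH[of i] that j by simp
    let ?l = "j + P" and ?k = "a - P"
    let ?w = "vv (a + j)"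
    have lk: "2 \<le> ?l" "?l < a" "2 \<le> ?k" "?k < a" "?l + ?k = a + j"
      using j aP P5 a_ge_3 by linarith+
    have vv: "vv ?k = v ?k" "vv ?l = v ?l"
      using lk by (simp_all add: vv_le)
    have yh: "yh ?k = v ?k \<bullet> y" "yh ?l = v ?l \<bullet> y"
      using lk by (auto simp: yh_def)
    have C: "(of_nat (?l - 1 choose (a - ?k)) :: 'f) = 1" "(of_nat (?k - 1 choose (a - ?l)) :: 'f) = 0"
    proof -
      have "?l - 1 = (j - 1) + P" "a - ?k = P"
        using j(1) lk(2) by simp_all
      then show "(of_nat (?l - 1 choose (a - ?k)) :: 'f) = 1"
        using choose_P(1)[of "j - 1"] j by simp
      have e: "?k - 1 = P * (m - 1) + 0" "a - ?l = ?k - 1 - (j - 1)" "j - 1 \<le> ?k - 1"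
        using aP(3) j lk(2) by simp_all
      have "?k - 1 choose (a - ?l) = ?k - 1 choose (j - 1)"
        unfolding e(2) using binomial_symmetric[OF e(3)] by simp
      then show "(of_nat (?k - 1 choose (a - ?l)) :: 'f) = 0"
        using choose_P(3)[of "j - 1" "m - 1" 0] j e(1) by (simp add: binomial_eq_0 del: One_nat_def)
    qed
    have idx: "a + Suc (?l - 1 - (a - ?k)) = a + j" "a - ?k = P"
      using lk(2) j(1) by simp_all
    have le: "?k \<le> a" "?l \<le> a" "1 \<le> ?l" "1 \<le> ?k" "?l + ?k \<le> a + j" "?k + ?l \<le> a + j"
      using lk by linarith+
    have "((- 1) ^ (a - ?k) :: 'f) = - 1"
      unfolding idx(2) using odd_P by simp
    then have 1: "v ?l \<bullet> x \<bullet> v ?k = ?w \<bullet> x" "v ?l \<bullet> y \<bullet> v ?k = ?w \<bullet> y"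
      using vx_br_vv[OF inf le(3) lk(2,3) le(5)] vy_br_vv[OF inf le(3) lk(2,3) le(5)] C(1) le(1)
      unfolding vv yh idx(1) by (simp_all only: if_True) simp_all
    have 2: "v ?k \<bullet> x \<bullet> v ?l = 0" "v ?k \<bullet> y \<bullet> v ?l = 0"
      using vx_br_vv[OF inf le(4) lk(4,1) le(6)] vy_br_vv[OF inf le(4) lk(4,1) le(6)] C(2) le(2)
      unfolding vv yh by (simp_all only: if_True) simp_all
    have "?w \<bullet> x \<bullet> y + ?w \<bullet> y \<bullet> x = 0"
      using vx_br_vy[OF lk(1-4)] vx_br_vy[OF lk(3,4,1,2)] unfolding 1 2 by simp
    moreover have "?w = nxt (vv (a + (j - 1)))"
      using vv_nxt[of "a + (j - 1)"] j by simp
    ultimately show ?thesis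
      using infinite_nxt_iff[OF inf[of "j - 1"]] j by simp
  qed
qed

text \<open>Take l = 2 P and k = a - P. Infinite type makes the left side of \<open>vx_br_vy\<close>
  vanish, and the two products on the right are 1 and -(m - 1) times the same element, so m times it
  is 0.\<close>

lemma vv_P_eq_0:
  assumes w1: "infinite w1" and m: "(of_nat m :: 'f) \<noteq> 0"
  shows "vv (a + P) \<bullet> x \<bullet> y = 0"
proof -
  let ?D = "vv (a + P) \<bullet> x \<bullet> y"
  note inf = infinite_vv[OF w1]
  let ?l = "2 * P" and ?k = "a - P"
  have lk: "2 \<le> ?l" "?l < a" "2 \<le> ?k" "?k < a" "?l + ?k = a + P" "?k + ?l = a + P"
    using aP P5 a_ge_3 by linarith+
  have vv: "vv ?k = v ?k" "vv ?l = v ?l"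
    using lk by (simp_all add: vv_le)
  have yh: "yh ?k = v ?k \<bullet> y" "yh ?l = v ?l \<bullet> y"
    using lk by (auto simp: yh_def)
  have "v ?l \<bullet> x \<bullet> v ?k \<bullet> y + v ?l \<bullet> y \<bullet> v ?k \<bullet> x = 0"
  proof -
    have "infinite (vv (a + P))"
      using inf[of P] P5 by simp
    then have "vv (a + P) \<bullet> y \<bullet> x = - (vv (a + P) \<bullet> x \<bullet> y)"
      by (simp add: infinite_def)
    moreover have "a + Suc (?l - 1 - (a - ?k)) = a + P"
      using lk(2) P5 by simp
    ultimately show ?thesis
      using vx_br_vv[of P ?l ?k] vy_br_vv[of P ?l ?k] inf lk
      unfolding vv yh by (simp add: br_linear_simps)
  qed
  then have eq: "v ?l \<bullet> x \<bullet> (v ?k \<bullet> y) = v ?k \<bullet> x \<bullet> (v ?l \<bullet> y)"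
    using vx_br_vy[OF lk(1-4)] by simp
  have i: "a - 1 - ?k = P - 1" "?l - 1 - (P - 1) = P" "?l - 1 = (P - 1) + P" "?k \<le> a - 1" "?l \<le> a - 1"
    using lk(2) P5 by simp_all
  have "(of_nat (?l - 1 choose (P - 1)) :: 'f) = 1"
    using choose_P(2)[of "P - 1" "P - 1"] P5 unfolding i by simp
  moreover have "even (P - 1)"
    using odd_P P5 by simp
  ultimately have 1: "v ?l \<bullet> x \<bullet> (v ?k \<bullet> y) = ?D"
    using vx_br_vvy[of P ?l ?k] inf lk(1-5) P5 i(4) unfolding vv i(1) by (simp add: i(2) del: One_nat_def)
  have k: "?k - 1 - (a - 1 - ?l) = P" "?k - 1 = P * (m - 1) + 0" "a - 1 - ?l = ?k - 1 - P"
    using aP(3) lk(2) P5 by simp_all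
  have k4: "P \<le> ?k - 1"
    using lk(2) by linarith
  have "?k - 1 choose (a - 1 - ?l) = ?k - 1 choose P"
    unfolding k(3) using binomial_symmetric[OF k4] by simp
  then have "(of_nat (?k - 1 choose (a - 1 - ?l)) :: 'f) = of_nat (m - 1)"
    using choose_P(4)[of 0 "m - 1"] P5 unfolding k(2) by simp
  moreover have "odd (a - 1 - ?l)"
    using even_a a_ge_3 lk by simp
  ultimately have 2: "v ?k \<bullet> x \<bullet> (v ?l \<bullet> y) = - (of_nat (m - 1) *s ?D)"
    using vx_br_vvy[of P ?k ?l] inf lk(1-4,6) P5 i(5) unfolding vv by (simp add: k(1) del: One_nat_def)
  have "(1 + of_nat (m - 1)) *s ?D = 0"
    using eq unfolding 1 2 by (simp add: scale_left_distrib eq_neg_iff_add_eq_0)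
  moreover have "1 + of_nat (m - 1) = (of_nat m :: 'f)"
    using m2 by (cases m) simp_all
  ultimately show ?thesis
    using m by simp
qed

lemma L_vv:
  assumes w1: "infinite w1"
  shows "1 \<le> j \<Longrightarrow> j \<le> P \<Longrightarrow> L ((a + j) * (q - 1)) = span {vv (a + j)}"
proof (induction j rule: dec_induct)
  case base
  then show ?case
    using L_w1[OF cd] by (simp add: vv_Suc_a)
next
  case (step j)
  have "infinite (vv (a + j))" "L ((a + j) * (q - 1)) = span {vv (a + j)}" "1 \<le> (a + j) * (q - 1)"
    using step infinite_vv[OF w1, of j] q_ge_7 a_ge_3 by auto
  then have "L ((a + j) * (q - 1) + (q - 1)) = span {nxt (vv (a + j))}"
    by (rule L_after_infinite)
  moreover have "(a + j) * (q - 1) + (q - 1) = (a + Suc j) * (q - 1)"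
    by simp
  ultimately show ?case
    using vv_nxt[of "a + j"] step by (simp only:) simp
qed

lemma L_vv_eq_0:
  assumes w1: "infinite w1" and m: "(of_nat m :: 'f) \<noteq> 0"
  shows "L ((a + P) * (q - 1) + 2) = {0}"
proof -
  have "L ((a + P) * (q - 1) + 2) = span {vv (a + P) \<bullet> x \<bullet> y}"
    using infinite_vv[OF w1, of P] L_vv[OF w1, of P] P5 q_ge_7 by (intro L_after_infinite) auto
  then show ?thesis
    using vv_P_eq_0[OF assms] by simp
qed

end

end

lemma component_eq_0_one_mod_p:
  assumes a1: "(of_nat (a - 1) :: 'f) = 0" and not_power: "\<not> (\<exists>k. a - 1 = p ^ k)"
  shows "L ((a + p ^ multiplicity p (a - 1)) * (q - 1) + 2) = {0}"
proof (rule ccontr)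
  assume L: "L ((a + p ^ multiplicity p (a - 1)) * (q - 1) + 2) \<noteq> {0}"
  define s where "s = multiplicity p (a - 1)"
  define P where "P = p ^ s"
  have "p dvd a - 1" "0 < a - 1"
    using a1 a_ge_3 of_nat_eq_0[of "a - 1"] by simp_all
  then obtain m where P: "5 \<le> P" "odd P" and m: "a - 1 = P * m" "(of_nat m :: 'f) \<noteq> 0"
    using multiplicity_power_facts[of "a - 1" P] by (auto simp: P_def s_def)
  \<comment> \<open>With m = 1 the number a - 1 would be P. From m >= 2 the index 2 P stays below
    a.\<close>
  have "m \<noteq> 1"
    using not_power m by (auto simp: P_def)
  moreover have "m \<noteq> 0"
    using m(2) by (metis of_nat_0)
  ultimately have m2: "2 \<le> m"
    by simp
  have "L (Suc a * (q - 1) + 3) \<noteq> {0}"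
    by (rule component_mult_mono[OF L]) (use P in \<open>auto simp: P_def s_def\<close>)
  note cd = central_d[OF this] and w1 = infinite_w1[OF central_d[OF this] a1 this]
  have "L ((a + P) * (q - 1) + 2) = {0}"
    by (rule L_vv_eq_0[OF cd P_def P m(1) m2 w1 m(2)])
  then show False
    using L by (simp add: P_def s_def)
qed

section \<open>The case \<open>a \<equiv> 0 (mod p)\<close>\<close>

text \<open>
  Here the diamond in degree \<open>a (q - 1) + 1\<close> is fake of type 1. Read as a diamond of type 0 in the
  next degree it is followed by diamonds of infinite type in degrees \<open>k (q - 1) + 2\<close>, \<open>k > a\<close>,
  and \<open>xx k\<close> spans the component just below.
\<close>

definition xx :: "nat \<Rightarrow> 'a" where
  "xx m = (if m \<le> a then v m \<bullet> x else (nxt ^^ (m - a - 1)) (w1 \<bullet> x))"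

lemma xx_le: "m \<le> a \<Longrightarrow> xx m = v m \<bullet> x"
  by (simp add: xx_def)

lemma xx_Suc_a: "xx (Suc a) = w1 \<bullet> x"
  by (simp add: xx_def)

lemma xx_nxt:
  assumes "a < m"
  shows "xx (Suc m) = nxt (xx m)"
proof -
  have "Suc m - a - 1 = Suc (m - a - 1)"
    using assms by simp
  then show ?thesis
    using assms by (simp add: xx_def del: One_nat_def)
qed

text \<open>Since [v_i x x] = 0, bracketing [v_i x [v_k y]] with x moves x into the second factor,
  where infinite type trades [v_k y x] for -[v_k x y].\<close>

lemma vx_br_vx:
  assumes "2 \<le> l" "l < a" "2 \<le> m" "m < a"
  shows "v l \<bullet> x \<bullet> (v m \<bullet> x) \<bullet> y = v m \<bullet> x \<bullet> (v l \<bullet> y) \<bullet> x - v l \<bullet> x \<bullet> (v m \<bullet> y) \<bullet> x"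
proof -
  have *: "v i \<bullet> x \<bullet> (v k \<bullet> y) \<bullet> x = - (v i \<bullet> x \<bullet> (v k \<bullet> x \<bullet> y))"
    if "2 \<le> i" "i < a" "2 \<le> k" "k < a" for i k
    using br_br_left[of "v i \<bullet> x" "v k \<bullet> y" x] v_infiniteD(1)[OF that(1,2)] v_infiniteD(3)[OF that(3,4)]
    by (simp add: br_linear_simps)
  have "v l \<bullet> x \<bullet> (v m \<bullet> x) \<bullet> y = v l \<bullet> x \<bullet> y \<bullet> (v m \<bullet> x) + v l \<bullet> x \<bullet> (v m \<bullet> x \<bullet> y)"
    by (rule br_br_left)
  also have "v l \<bullet> x \<bullet> y \<bullet> (v m \<bullet> x) = - (v m \<bullet> x \<bullet> (v l \<bullet> x \<bullet> y))"
    by (rule br_anti)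
  finally show ?thesis
    using *[OF assms] *[OF assms(3,4,1,2)] by simp
qed

context
  fixes P m :: nat and s :: nat
  assumes cd: "central d" and P_def: "P = p ^ s" and P5: "5 \<le> P" and odd_P: "odd P"
    and a: "a = P * m" and m3: "3 \<le> m" and \<mu>1: "\<mu> = 1" and w1y: "w1 \<bullet> y = 0"
begin

lemma aP': "3 * P \<le> a" "a - P - 1 = P * (m - 2) + (P - 1)" "a - 2 = P * (m - 1) + (P - 2)"
proof -
  have "P * 3 \<le> P * m"
    using m3 by (rule mult_le_mono2)
  then show "3 * P \<le> a"
    using a by simp
  have "P * m = P * (m - 2) + 2 * P" "P * m = P * (m - 1) + P"
    using m3 by (simp_all add: diff_mult_distrib2)
  then show "a - P - 1 = P * (m - 2) + (P - 1)" "a - 2 = P * (m - 1) + (P - 2)"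
    using a P5 by linarith+
qed

text \<open>As [w1 y] = 0, y centralizes one component more, so a chain of full length starts at
  [d x]: everything is shifted by one degree.\<close>

lemma w1x: "w1 \<bullet> x \<bullet> x \<bullet> x = 0" "w1 \<bullet> x \<bullet> y \<bullet> y = 0" "central (d \<bullet> x)" "w1 \<bullet> x = d \<bullet> x \<star> (q - 3)"
proof -
  show "w1 \<bullet> x \<bullet> x \<bullet> x = 0" "w1 \<bullet> x \<bullet> y \<bullet> y = 0"
    using w1xxx w1xyy[OF cd] by auto
  show "w1 \<bullet> x = d \<bullet> x \<star> (q - 3)"
    by (simp add: w1_def adpow_Suc[symmetric] adpow_Suc'[symmetric])
  have "d \<star> Suc i \<bullet> y = 0" if "i < q - 3" for i
    using centralD[OF cd, of "Suc i"] w1y that unfolding w1_def by (cases "Suc i = q - 3") auto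
  then show "central (d \<bullet> x)"
    by (simp add: central_def adpow_Suc')
qed

lemma infinite_xx_iff:
  assumes inf: "\<And>i. 1 \<le> i \<Longrightarrow> i < j \<Longrightarrow> infinite (xx (a + i))" and j: "1 \<le> j"
  shows "xx (a + j) \<bullet> x \<bullet> x = 0" "xx (a + j) \<bullet> y \<bullet> y = 0"
    "xx (a + j) \<bullet> y \<bullet> x = - (xx (a + j) \<bullet> x \<bullet> y) \<Longrightarrow> infinite (xx (a + j))"
proof -
  have "xx (a + j) \<bullet> x \<bullet> x = 0 \<and> xx (a + j) \<bullet> y \<bullet> y = 0
    \<and> (xx (a + j) \<bullet> y \<bullet> x = - (xx (a + j) \<bullet> x \<bullet> y) \<longrightarrow> infinite (xx (a + j)))"
  proof (cases "j = 1")
    case True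
    then show ?thesis
      using w1x infinite_central[OF w1x(3,4)] by (simp add: xx_Suc_a)
  next
    case False
    then have "xx (a + j) = nxt (xx (a + (j - 1)))" "infinite (xx (a + (j - 1)))"
      using xx_nxt[of "a + (j - 1)"] inf[of "j - 1"] j by simp_all
    then show ?thesis
      using infinite_nxt infinite_nxt_iff by simp
  qed
  then show "xx (a + j) \<bullet> x \<bullet> x = 0" "xx (a + j) \<bullet> y \<bullet> y = 0"
    "xx (a + j) \<bullet> y \<bullet> x = - (xx (a + j) \<bullet> x \<bullet> y) \<Longrightarrow> infinite (xx (a + j))"
    by auto
qed

lemma xx_br_v1:
  assumes "1 \<le> i" "a < i \<Longrightarrow> infinite (xx i)"
  shows "xx i \<bullet> v1 = xx (Suc i)"
proof -
  consider "i < a" | "i = a" | "a < i"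
    by linarith
  then show ?thesis
  proof cases
    case 1
    then show ?thesis
      using vx_br_v1[OF assms(1)] by (simp add: xx_le)
  next
    case 2
    then show ?thesis
      using vax_v1 by (simp add: xx_le xx_Suc_a \<mu>1)
  next
    case 3
    then show ?thesis
      using infinite_br_v1(1)[of "xx i"] assms xx_nxt by simp
  qed
qed

lemma d_br_v1: "d \<bullet> v1 = - (xx (Suc a) \<bullet> y)"
  using d_v1[OF cd] by (simp add: w1y xx_Suc_a)

lemma vx_br_xx:
  assumes inf: "\<And>i. 1 \<le> i \<Longrightarrow> i < j \<Longrightarrow> infinite (xx (a + i))"
    and lm: "1 \<le> l" "l < a" "2 \<le> k" "l + k \<le> a + j"
  shows "v l \<bullet> x \<bullet> xx k = (if k \<le> a
    then ((- 1) ^ (a - k) * of_nat (l - 1 choose (a - k))) *s - (xx (a + Suc (l - 1 - (a - k))) \<bullet> x) else 0)"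
proof (rule shifted_products[where A = "\<lambda>l. v l \<bullet> x" and B = xx and N = "a - 1" and T = "a + j"
      and t = "\<lambda>_. 1" and \<psi> = "\<lambda>i. - (xx (a + Suc i) \<bullet> x)" and ?m0.0 = 2])
  show "v l \<bullet> x \<bullet> v1 = v (Suc l) \<bullet> x" if "1 \<le> l" "l < a - 1" for l
    using vx_br_v1[of l] that by simp
  show "xx i \<bullet> v1 = 1 *s xx (Suc i)" if "2 \<le> i" "Suc (Suc i) \<le> a + j" for i
    using xx_br_v1[of i] inf[of "i - a"] that by simp
  show "v 1 \<bullet> x \<bullet> xx i = (if i = a then - (xx (a + Suc 0) \<bullet> x) else 0)"
    if i: "2 \<le> i" "Suc i \<le> a + j" for i
  proof -
    have "xx i \<bullet> v1 = xx (Suc i)"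
      using xx_br_v1[of i] inf[of "i - a"] i by simp
    then have 1: "v 1 \<bullet> x \<bullet> xx i = - (xx (Suc i) \<bullet> x - xx i \<bullet> x \<bullet> v1)"
      by (simp add: br_anti[of "v1 \<bullet> x"] br_br_right)
    consider "i < a" | "i = a" | "a < i"
      by linarith
    then show ?thesis
    proof cases
      case 1
      then have "xx (Suc i) \<bullet> x = 0" "xx i \<bullet> x = 0"
        using v_infiniteD(1)[of i] v_infiniteD(1)[of "Suc i"] vaxx i
        by (cases "Suc i = a"; simp add: xx_le)+
      then show ?thesis
        using 1 \<open>v 1 \<bullet> x \<bullet> xx i = _\<close> by simp
    next
      case 2
      then show ?thesis
        unfolding 1 using vaxx by (simp add: xx_le)
    next
      case 3
      then show ?thesis
        unfolding 1 using infinite_br_v1(2)[of "xx i"] inf[of "i - a"] i xx_nxt by simp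
    qed
  qed
  show "- (xx (a + Suc i) \<bullet> x) \<bullet> v1 = - (xx (a + Suc (Suc i)) \<bullet> x)" if "a + Suc (Suc i) \<le> a + j" for i
    using infinite_br_v1(2)[of "xx (a + Suc i)"] inf[of "Suc i"] that xx_nxt[of "a + Suc i"]
    by (simp add: br_linear_simps)
qed (use lm in auto)

lemma vx_br_vy':
  assumes inf: "\<And>i. 1 \<le> i \<Longrightarrow> i < j \<Longrightarrow> infinite (xx (a + i))" and j: "1 \<le> j"
    and lm: "1 \<le> l" "l < a" "2 \<le> k" "k < a" "l + k = a + j"
  shows "v l \<bullet> x \<bullet> (v k \<bullet> y)
    = - (((- 1) ^ (a - 1 - k) * of_nat (l - 1 choose (a - 1 - k))) *s (xx (a + j) \<bullet> y))"
proof -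
  \<comment> \<open>For \<mu> = 1 the product [v_a y] is 0, so the sequence shifted by
    \<open>v1\<close> runs into 0 at index a.\<close>
  let ?B = "\<lambda>i. if i < a then v i \<bullet> y else 0"
  let ?\<psi> = "\<lambda>i. if i = 0 then d else - (xx (a + i) \<bullet> y)"
  have "v l \<bullet> x \<bullet> ?B k = (if k \<le> a - 1
    then ((- 1) ^ (a - 1 - k) * of_nat (l - 1 choose (a - 1 - k))) *s ?\<psi> (l - 1 - (a - 1 - k)) else 0)"
  proof (rule shifted_products[where A = "\<lambda>l. v l \<bullet> x" and B = ?B and N = "a - 1" and T = "a + j"
      and t = "\<lambda>_. 1" and \<psi> = ?\<psi> and ?m0.0 = 2])
    show "v l \<bullet> x \<bullet> v1 = v (Suc l) \<bullet> x" if "1 \<le> l" "l < a - 1" for l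
      using vx_br_v1[of l] that by simp
    show "?B i \<bullet> v1 = 1 *s ?B (Suc i)" if "2 \<le> i" for i
      using v_br_v1(3)[of i] that vay[OF \<mu>1] by (cases "Suc i = a") auto
    show "v 1 \<bullet> x \<bullet> ?B i = (if i = a - 1 then ?\<psi> 0 else 0)" if "2 \<le> i" for i
      using v1x_br_yh[of i] that a_ge_3 by (auto simp: yh_def)
    show "?\<psi> i \<bullet> v1 = ?\<psi> (Suc i)" if i: "a - 1 + Suc (Suc i) \<le> a + j" for i
    proof (cases "i = 0")
      case True
      then show ?thesis
        by (simp add: d_br_v1)
    next
      case False
      then have "infinite (xx (a + i))"
        using inf[of i] i a_ge_3 by simp
      then show ?thesis
        using infinite_br_v1(3)[of "xx (a + i)"] False xx_nxt[of "a + i"] by (simp add: br_linear_simps)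
    qed
  qed (use lm in auto)
  moreover have idx: "l - 1 - (a - 1 - k) = j" "(k \<le> a - 1) = True" "(k < a) = True" "(j = 0) = False"
    using lm j by auto
  ultimately show ?thesis
    unfolding idx if_True if_False by simp
qed

lemmas choose_P' = choose_power_cases[OF P_def]

text \<open>With l = j + P and k = a - P, the left side of \<open>vx_br_vx\<close> has coefficient
  1. On the right one product vanishes by C(j - 1, P - 1) = 0, and the other has C(P - 1, j) =
  (-1)^j, which cancels the sign of the recursion.\<close>

lemma infinite_xx: "1 \<le> j \<Longrightarrow> j < P \<Longrightarrow> infinite (xx (a + j))"
proof (induction j rule: less_induct)
  case (less j)
  have inf: "infinite (xx (a + i))" if "1 \<le> i" "i < j" for i
    using less.IH[of i] that less.prems by simp
  let ?l = "j + P" and ?k = "a - P"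
  let ?w = "xx (a + j)"
  have lk: "2 \<le> ?l" "?l < a" "2 \<le> ?k" "?k < a" "?l + ?k = a + j" "?k + ?l = a + j"
    using less.prems aP'(1) P5 by linarith+
  have le: "1 \<le> ?l" "1 \<le> ?k" "?l + ?k \<le> a + j" "?k \<le> a"
    using lk by simp_all
  have i: "a - ?k = P" "a - 1 - ?k = P - 1" "?l - 1 = (j - 1) + P" "a + Suc (?l - 1 - P) = a + j"
    "a - 1 - ?l = ?k - 1 - j" "j \<le> ?k - 1"
    using less.prems lk(2) P5 by simp_all
  have "(of_nat (?l - 1 choose P) :: 'f) = 1" "(of_nat (?l - 1 choose (P - 1)) :: 'f) = 0"
    unfolding i(3) using choose_P'(1)[of "j - 1"] choose_P'(2)[of "P - 1" "j - 1"] less.prems P5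
    by (simp_all add: binomial_eq_0)
  note C = this
  have sgn: "(- 1 :: 'f) ^ P = - 1"
    using odd_P by simp
  have "v ?l \<bullet> x \<bullet> (v ?k \<bullet> x) = ?w \<bullet> x"
    using vx_br_xx[OF inf le(1) lk(2,3) le(3)] xx_le[OF le(4)] le(4)
    unfolding i(1) i(4) C sgn by simp
  moreover have "v ?l \<bullet> x \<bullet> (v ?k \<bullet> y) = 0"
    using vx_br_vy'[OF inf less.prems(1) le(1) lk(2-5)] unfolding i(2) C by simp
  moreover have "v ?k \<bullet> x \<bullet> (v ?l \<bullet> y) = - (?w \<bullet> y)"
  proof -
    have "?k - 1 choose (a - 1 - ?l) = ?k - 1 choose j"
      unfolding i(5) using binomial_symmetric[OF i(6)] by simp
    then have "(of_nat (?k - 1 choose (a - 1 - ?l)) :: 'f) = (- 1) ^ j"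
      unfolding aP'(2) using choose_P'(3)[of j "m - 2" "P - 1"] choose_P'(5)[of j] less.prems by simp
    moreover have "(- 1 :: 'f) ^ (a - 1 - ?l) = (- 1) ^ j"
    proof -
      have "even (a - 1 - ?l) \<longleftrightarrow> even j"
        using even_a odd_P lk(2) by simp
      then show ?thesis
        by (simp add: minus_one_power_iff)
    qed
    moreover have "(- 1 :: 'f) ^ j * (- 1) ^ j = 1"
      by (simp add: power_add[symmetric] mult_2[symmetric])
    ultimately show ?thesis
      using vx_br_vy'[OF inf less.prems(1) le(2) lk(4,1,2,6)] by simp
  qed
  ultimately have "?w \<bullet> x \<bullet> y = - (?w \<bullet> y \<bullet> x)"
    using vx_br_vx[OF lk(1-4)] by (simp add: br_linear_simps)
  then have "?w \<bullet> y \<bullet> x = - (?w \<bullet> x \<bullet> y)"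
    by simp
  then show ?case
    using infinite_xx_iff(3)[OF inf less.prems(1)] by simp
qed

lemma xx_P_eq_0:
  assumes m: "(of_nat m :: 'f) \<noteq> 0"
  shows "xx (a + P) \<bullet> y \<bullet> x = 0" "xx (a + P) \<bullet> x \<bullet> y = 0"
proof -
  let ?w = "xx (a + P)"
  have inf: "infinite (xx (a + i))" if "1 \<le> i" "i < P" for i
    using infinite_xx that by simp
  have P1: "1 \<le> P"
    using P5 by simp
  show yx: "?w \<bullet> y \<bullet> x = 0"
  proof -
    \<comment> \<open>Here the left side of \<open>vx_br_vx\<close> has coefficient P, which is 0
      modulo p, and on the right m - 1 and 1 add up to m.\<close>
    let ?l = "P + 1" and ?k = "a - 1"
    have lk: "2 \<le> ?l" "?l < a" "2 \<le> ?k" "?k < a" "?l + ?k = a + P" "?k + ?l = a + P"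
      using aP'(1) P5 by linarith+
    have le: "1 \<le> ?l" "1 \<le> ?k" "?l + ?k \<le> a + P" "?k \<le> a"
      using lk by simp_all
    have i: "a - ?k = 1" "a - 1 - ?k = 0" "?l - 1 = P" "?k - 1 = a - 2" "a - 1 - ?l = a - 2 - P" "P \<le> a - 2"
      using lk(2) P5 by simp_all
    have "v ?l \<bullet> x \<bullet> (v ?k \<bullet> x) = 0"
    proof -
      have "(of_nat P :: 'f) = 0"
        using choose_P'(3)[of 1 1 0] P5 by simp
      then show ?thesis
        using vx_br_xx[OF inf le(1) lk(2,3) le(3)] le(4)
        unfolding i(1) i(3) by (simp add: xx_le)
    qed
    moreover have "v ?l \<bullet> x \<bullet> (v ?k \<bullet> y) = - (?w \<bullet> y)"
      using vx_br_vy'[OF inf P1 le(1) lk(2-5)] unfolding i(2) by simp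
    moreover have "v ?k \<bullet> x \<bullet> (v ?l \<bullet> y) = of_nat (m - 1) *s (?w \<bullet> y)"
    proof -
      have "a - 2 choose (a - 2 - P) = a - 2 choose P"
        using binomial_symmetric[OF i(6)] by simp
      then have "(of_nat (a - 2 choose (a - 2 - P)) :: 'f) = of_nat (m - 1)"
        unfolding aP'(3) using choose_P'(4)[of "P - 2" "m - 1"] P5 by simp
      moreover have "odd (a - 2 - P)"
        using even_a odd_P i(6) a_ge_3 by simp
      ultimately show ?thesis
        using vx_br_vy'[OF inf P1 le(2) lk(4,1,2,6)] unfolding i(4,5) by simp
    qed
    ultimately have "0 = of_nat (m - 1) *s (?w \<bullet> y \<bullet> x) + ?w \<bullet> y \<bullet> x"
      using vx_br_vx[OF lk(1-4)] by (simp add: br_linear_simps)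
    then have "(of_nat (m - 1) + 1) *s (?w \<bullet> y \<bullet> x) = 0"
      by (simp add: scale_left_distrib)
    moreover have "of_nat (m - 1) + 1 = (of_nat m :: 'f)"
      using m3 by (cases m) simp_all
    ultimately show ?thesis
      using m by simp
  qed
  show "?w \<bullet> x \<bullet> y = 0"
  proof -
    \<comment> \<open>Both terms on the right of \<open>vx_br_vx\<close> are now multiples of
      [w y x] = 0, so [w x y] is isolated on the left.\<close>
    let ?l = "P + P" and ?k = "a - P"
    have lk: "2 \<le> ?l" "?l < a" "2 \<le> ?k" "?k < a" "?l + ?k = a + P" "?k + ?l = a + P"
      using aP'(1) P5 by linarith+
    have le: "1 \<le> ?l" "1 \<le> ?k" "?l + ?k \<le> a + P" "?k \<le> a"
      using lk by simp_all
    have i: "a - ?k = P" "?l - 1 = (P - 1) + P" "a + Suc (?l - 1 - P) = a + P"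
      using lk(2) P5 by simp_all
    have C: "(of_nat (?l - 1 choose P) :: 'f) = 1"
      unfolding i(2) using choose_P'(1)[of "P - 1"] P5 by simp
    have sgn: "(- 1 :: 'f) ^ P = - 1"
      using odd_P by simp
    have "v ?l \<bullet> x \<bullet> (v ?k \<bullet> x) = ?w \<bullet> x"
      using vx_br_xx[OF inf le(1) lk(2,3) le(3)] xx_le[OF le(4)] le(4)
      unfolding i(1) i(3) C sgn by simp
    moreover have "v ?l \<bullet> x \<bullet> (v ?k \<bullet> y) \<bullet> x = 0" "v ?k \<bullet> x \<bullet> (v ?l \<bullet> y) \<bullet> x = 0"
      using vx_br_vy'[OF inf P1 le(1) lk(2-5)] vx_br_vy'[OF inf P1 le(2) lk(4,1,2,6)] yx
      by (simp_all add: br_linear_simps)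
    ultimately show ?thesis
      using vx_br_vx[OF lk(1-4)] by simp
  qed
qed

lemma L_xx:
  "1 \<le> j \<Longrightarrow> j \<le> P \<Longrightarrow> L ((a + j) * (q - 1) + 1) = span {xx (a + j)}"
proof (induction j rule: dec_induct)
  case base
  have "L (Suc (Suc a * (q - 1))) = span {w1 \<bullet> x}"
    by (rule span_component_Suc_central[OF L_w1[OF cd] Suc_a_pos[OF cd] w1y])
  then show ?case
    by (simp add: xx_Suc_a)
next
  case (step j)
  have "infinite (xx (a + j))" "L ((a + j) * (q - 1) + 1) = span {xx (a + j)}"
    using step infinite_xx[of j] by auto
  then have "L ((a + j) * (q - 1) + 1 + (q - 1)) = span {nxt (xx (a + j))}"
    by (rule L_after_infinite) simp
  moreover have "(a + j) * (q - 1) + 1 + (q - 1) = (a + Suc j) * (q - 1) + 1"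
    by simp
  ultimately show ?case
    using xx_nxt[of "a + j"] step by (simp only:) simp
qed

lemma L_xx_eq_0:
  assumes m: "(of_nat m :: 'f) \<noteq> 0"
  shows "L ((a + P) * (q - 1) + 3) = {0}"
proof -
  have P1: "1 \<le> P"
    using P5 by simp
  have inf: "infinite (xx (a + i))" if "1 \<le> i" "i < P" for i
    using infinite_xx that by simp
  have "L (Suc (Suc ((a + P) * (q - 1) + 1))) = span {0}"
    using span_component_Suc_Suc[OF L_xx[OF P1 order_refl]] infinite_xx_iff(1,2)[OF inf P1] xx_P_eq_0[OF m]
    by simp
  then show ?thesis
    by (simp add: numeral_3_eq_3)
qed

end

lemma component_eq_0_zero_mod_p:
  assumes a0: "(of_nat a :: 'f) = 0" and \<mu>: "\<mu> = 1" and y0: "\<forall>u\<in>L (Suc a * (q - 1)). u \<bullet> y = 0"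
    and not_power: "\<not> (\<exists>k. a div 2 = p ^ k)"
  shows "L ((a + p ^ multiplicity p a) * (q - 1) + 3) = {0}"
proof (rule ccontr)
  assume L: "L ((a + p ^ multiplicity p a) * (q - 1) + 3) \<noteq> {0}"
  define s where "s = multiplicity p a"
  define P where "P = p ^ s"
  have "p dvd a" "0 < a"
    using a0 a_ge_3 of_nat_eq_0[of a] by simp_all
  moreover have "P = p ^ multiplicity p a"
    by (simp only: P_def s_def)
  ultimately obtain m where P: "5 \<le> P" "odd P" and m: "a = P * m" "(of_nat m :: 'f) \<noteq> 0"
    using multiplicity_power_facts[of a P] by blast
  \<comment> \<open>As a is even and P odd, m is even, and m = 2 would make a / 2 the power P. So 3
    <= m, and the index 2 P stays below a.\<close>
  have "even m"
    using even_a P(2) m(1) by (metis even_mult_iff)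
  moreover have "m \<noteq> 2"
    using not_power m(1) by (auto simp: P_def)
  moreover have "m \<noteq> 0"
    using m(2) by (metis of_nat_0)
  ultimately have m3: "3 \<le> m"
    by (cases "m = 1") auto
  have "L (Suc a * (q - 1) + 3) \<noteq> {0}"
    by (rule component_mult_mono[OF L]) (use P in \<open>auto simp: P_def s_def\<close>)
  note cd = central_d[OF this]
  have "w1 \<bullet> y = 0"
    using y0 w1_in_L[OF cd] by blast
  then have "L ((a + P) * (q - 1) + 3) = {0}"
    by (rule L_xx_eq_0[OF cd P_def P m(1) m3 \<mu> _ m(2)])
  then show False
    using L by (simp add: P_def s_def)
qed

section \<open>Assertion (b) in terms of \<open>L\<close>, and the final assembly\<close>

lemma component_eq_0_general:
  assumes a1: "(of_nat (a - 1) :: 'f) \<noteq> 0"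
    and exc: "\<not> ((of_nat a :: 'f) = 0 \<and> \<mu> = 1 \<and> (\<forall>u\<in>L (Suc a * (q - 1)). u \<bullet> y = 0))"
  shows "L (Suc a * (q - 1) + 3) = {0}"
proof (rule ccontr)
  assume L: "L (Suc a * (q - 1) + 3) \<noteq> {0}"
  note cd = central_d[OF L]
  have "\<forall>u\<in>L (Suc a * (q - 1)). u \<bullet> y = 0" if "w1 \<bullet> y = 0"
    using that unfolding L_w1[OF cd] by (auto simp: span_singleton br_linear_simps)
  then show False
    using L_w1_plus_3_eq_0[OF cd a1] exc L by blast
qed

end

theorem theorem10:
  fixes scale :: "'f::field \<Rightarrow> 'a::ab_group_add \<Rightarrow> 'a"
    and br :: "'a \<Rightarrow> 'a \<Rightarrow> 'a"
    and L :: "nat \<Rightarrow> 'a set"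
    and p q a :: nat
    and x y :: 'a
    and \<mu> :: 'f
  assumes "nottingham_algebra scale br L p q"
    and "nottingham_algebra.standard_generators scale br L q x y"
    and "thin_lie_algebra.infinite_type scale br L x y (2 * q - 1)"
    and "nottingham_algebra.earliest_finite_type scale br L q x y (a * (q - 1) + 1) \<mu>"
  shows "even a \<and>
    (\<not> [a = 1] (mod p) \<longrightarrow>
      \<not> ([a = 0] (mod p) \<and> \<mu> = 1 \<and> (\<forall>z\<in>L ((a + 1) * (q - 1)). br z y = 0)) \<longrightarrow>
      L ((a + 1) * (q - 1) + 3) = {0}) \<and>
    ([a = 1] (mod p) \<longrightarrow> \<not> (\<exists>k. a - 1 = p ^ k) \<longrightarrow>
      L ((a + p ^ multiplicity p (a - 1)) * (q - 1) + 2) = {0}) \<and>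
    ([a = 0] (mod p) \<longrightarrow> \<mu> = 1 \<longrightarrow> (\<forall>z\<in>L ((a + 1) * (q - 1)). br z y = 0) \<longrightarrow>
      \<not> (\<exists>k. a div 2 = p ^ k) \<longrightarrow>
      L ((a + p ^ multiplicity p a) * (q - 1) + 3) = {0})"
proof -
  interpret nottingham_earliest scale br L p q x y a \<mu>
    by (intro nottingham_earliest.intro nottingham_generators.intro nottingham_earliest_axioms.intro
        nottingham_generators_axioms.intro assms)
  have a1: "[a = 1] (mod p) \<longleftrightarrow> (of_nat (a - 1) :: 'f) = 0"
    unfolding of_nat_eq_0 using cong_altdef_nat[of 1 a p] a_ge_3 by simp
  have a0: "[a = 0] (mod p) \<longleftrightarrow> (of_nat a :: 'f) = 0"
    by (simp add: cong_0_iff of_nat_eq_0)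
  show ?thesis
    unfolding a1 a0 Suc_eq_plus1[symmetric]
    using even_a component_eq_0_general component_eq_0_one_mod_p component_eq_0_zero_mod_p by blast
qed

end
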